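(* Let $n\ge 1$. The set $\{M_\beta+\mathcal I_{B_n\times B_n}\mid \beta\in B_n\}$ is a bihomogeneous basis (over $\mathbb{Q}$) of the trivial component $\mathcal C^{B_n}$ of $\mathcal C$ under the diagonal action of $B_n$.
   Context: $B_n$ is the hyperoctahedral group of signed permutations of $[n]=\{1,\dots,n\}$, written in one-line notation $\beta=\beta(1)\cdots\beta(n)$, where each $\beta(i)$ is a nonzero integer and $\sigma(i):=|\beta(i)|$ defines a permutation of $[n]$; $\beta$ is extended by $\beta(-i)=-\beta(i)$, which defines products and inverses. A negative entry $-k$ is written $\bar k$. Let $R=\mathbb{Q}[x_1,\dots,x_n,y_1,\dots,y_n]$, bigraded by degree in the $x$'s and degree in the $y$'s. $B_n$ acts diagonally on $R$ by $\beta\cdot x_i=\pm x_{\sigma(i)}$ and $\beta\cdot y_i=\pm y_{\sigma(i)}$, the sign being that of $\beta(i)$. $\mathcal I_{B_n\times B_n}$ is the ideal of $R$ generated by the invariants without constant term of the action of $B_n\times B_n$ on $R$ (first factor acting on the $x$'s, second on the $y$'s); equivalently it is generated by $\sum_k x_k^{2j}$ and $\sum_k y_k^{2j}$, $1\le j\le n$. Put $\mathcal C=R/\mathcal I_{B_n\times B_n}$ with the induced bigrading and diagonal $B_n$-action; its trivial component $\mathcal C^{B_n}$ is the subspace of elements fixed by all of $B_n$. Use the linear order $\bar 1\prec\bar 2\prec\cdots\prec\bar n\prec 1\prec 2\prec\cdots\prec n$ and set $\mathrm{Des}(\beta)=\{i\in[n-1]\mid \beta(i)\succ\beta(i+1)\}$.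 For $i\in[n]$ let $g_i(\beta)=2\delta_i(\beta)+\eta_i(\beta)$, where $\delta_i(\beta)=\#\{j\in \mathrm{Des}(\beta)\mid j<i\}$ and $\eta_i(\beta)=1$ if $\beta(i)>0$, $\eta_i(\beta)=0$ otherwise. Let $\widetilde g_i(\beta)=g_{\sigma(i)}(\beta^{-1})$ with $\sigma(i)=|\beta(i)|$. For vectors $\mathbf a,\mathbf b\in\mathbb{N}^n$ (nonnegative integers), $M(\mathbf a,\mathbf b)$ denotes the sum of the distinct monomials in the orbit of $\mathbf x^{\mathbf a}\mathbf y^{\mathbf b}=\prod_i x_i^{a_i}y_i^{b_i}$ under simultaneous permutation of the indices of the $x$'s and the $y$'s by $S_n$. Finally, $M_\beta:=M(\mathbf g(\beta),\widetilde{\mathbf g}(\beta))$ with $\mathbf g(\beta)=(g_1(\beta),\dots,g_n(\beta))$ and $\widetilde{\mathbf g}(\beta)=(\widetilde g_1(\beta),\dots,\widetilde g_n(\beta))$. *)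

theory Defs
  imports
    "HOL-Library.Poly_Mapping"
    "HOL-Combinatorics.Permutations"
    "HOL-Algebra.QuotRing"
    "Jordan_Normal_Form.VS_Connect"
begin

text \<open>A signed permutation is represented by its odd extension to all of \<^typ>\<open>int\<close>, acting as the
  identity outside \<open>{-n..n}\<close>, so that products and inverses are those of functions.  The entries
  \<open>\<beta> 1, \<dots>, \<beta> n\<close> are automatically nonzero, since their absolute values lie in \<open>{1..n}\<close>.\<close>

definition signed_perms :: "nat \<Rightarrow> (int \<Rightarrow> int) set" where
  "signed_perms n = {\<beta>. (\<forall>i. \<beta> (- i) = - \<beta> i) \<and> (\<forall>i > int n. \<beta> i = i) \<and>
     bij_betw (\<lambda>i. \<bar>\<beta> i\<bar>) {1..int n} {1..int n}}"

definition sp_abs :: "(int \<Rightarrow> int) \<Rightarrow> nat \<Rightarrow> nat" where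
  "sp_abs \<beta> i = nat \<bar>\<beta> (int i)\<bar>"

text \<open>The order \<open>-1 \<prec> -2 \<prec> \<cdots> \<prec> -n \<prec> 1 \<prec> 2 \<prec> \<cdots> \<prec> n\<close> on nonzero integers; note that
  the negative numbers come in order of increasing absolute value.\<close>

definition prec :: "int \<Rightarrow> int \<Rightarrow> bool" where
  "prec a b \<longleftrightarrow> a < 0 \<and> b > 0 \<or> a < 0 \<and> b < 0 \<and> \<bar>a\<bar> < \<bar>b\<bar> \<or> a > 0 \<and> b > 0 \<and> a < b"

definition Des :: "nat \<Rightarrow> (int \<Rightarrow> int) \<Rightarrow> nat set" where
  "Des n \<beta> = {i \<in> {1..<n}. prec (\<beta> (int (i + 1))) (\<beta> (int i))}"

definition delta :: "nat \<Rightarrow> (int \<Rightarrow> int) \<Rightarrow> nat \<Rightarrow> nat" where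
  "delta n \<beta> i = card {j \<in> Des n \<beta>. j < i}"

definition eta :: "(int \<Rightarrow> int) \<Rightarrow> nat \<Rightarrow> nat" where
  "eta \<beta> i = (if \<beta> (int i) > 0 then 1 else 0)"

definition gvec :: "nat \<Rightarrow> (int \<Rightarrow> int) \<Rightarrow> nat \<Rightarrow> nat" where
  "gvec n \<beta> i = 2 * delta n \<beta> i + eta \<beta> i"

definition gvec_tilde :: "nat \<Rightarrow> (int \<Rightarrow> int) \<Rightarrow> nat \<Rightarrow> nat" where
  "gvec_tilde n \<beta> i = gvec n (inv_into UNIV \<beta>) (sp_abs \<beta> i)"

datatype var = Xvar nat | Yvar nat

type_synonym xypoly = "(var \<Rightarrow>\<^sub>0 nat) \<Rightarrow>\<^sub>0 rat"

definition Const :: "rat \<Rightarrow> xypoly" where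
  "Const c = Poly_Mapping.single 0 c"

definition Var :: "var \<Rightarrow> xypoly" where
  "Var v = Poly_Mapping.single (Poly_Mapping.single v 1) 1"

text \<open>The type \<^typ>\<open>xypoly\<close> has infinitely many variables; the ring below is its subring
  of polynomials in \<open>x\<^sub>1, \<dots>, x\<^sub>n, y\<^sub>1, \<dots>, y\<^sub>n\<close>.\<close>

definition xyring :: "nat \<Rightarrow> xypoly ring" where
  "xyring n = \<lparr>carrier = {p. \<forall>m \<in> Poly_Mapping.keys p.
                  Poly_Mapping.keys m \<subseteq> Xvar ` {1..n} \<union> Yvar ` {1..n}},
     mult = (*), one = 1, zero = 0, add = (+)\<rparr>"

definition substitute :: "(var \<Rightarrow> xypoly) \<Rightarrow> xypoly \<Rightarrow> xypoly" where
  "substitute f p = (\<Sum>m \<in> Poly_Mapping.keys p. Const (Poly_Mapping.lookup p m) *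
     (\<Prod>v \<in> Poly_Mapping.keys m. f v ^ Poly_Mapping.lookup m v))"

fun act_var :: "(int \<Rightarrow> int) \<Rightarrow> (int \<Rightarrow> int) \<Rightarrow> var \<Rightarrow> xypoly" where
  "act_var \<beta> \<gamma> (Xvar i) = Const (of_int (sgn (\<beta> (int i)))) * Var (Xvar (sp_abs \<beta> i))"
| "act_var \<beta> \<gamma> (Yvar i) = Const (of_int (sgn (\<gamma> (int i)))) * Var (Yvar (sp_abs \<gamma> i))"

definition act2 :: "(int \<Rightarrow> int) \<Rightarrow> (int \<Rightarrow> int) \<Rightarrow> xypoly \<Rightarrow> xypoly" where
  "act2 \<beta> \<gamma> = substitute (act_var \<beta> \<gamma>)"

definition diag_act :: "(int \<Rightarrow> int) \<Rightarrow> xypoly \<Rightarrow> xypoly" where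
  "diag_act \<beta> = act2 \<beta> \<beta>"

definition bihomogeneous :: "nat \<Rightarrow> nat \<Rightarrow> nat \<Rightarrow> xypoly \<Rightarrow> bool" where
  "bihomogeneous n d e p \<longleftrightarrow> (\<forall>m \<in> Poly_Mapping.keys p.
     (\<Sum>i = 1..n. Poly_Mapping.lookup m (Xvar i)) = d \<and>
     (\<Sum>i = 1..n. Poly_Mapping.lookup m (Yvar i)) = e)"

definition coinv_ideal :: "nat \<Rightarrow> xypoly set" where
  "coinv_ideal n = Idl\<^bsub>xyring n\<^esub> {p \<in> carrier (xyring n).
     (\<forall>\<beta> \<in> signed_perms n. \<forall>\<gamma> \<in> signed_perms n. act2 \<beta> \<gamma> p = p) \<and>
     Poly_Mapping.lookup p 0 = 0}"

definition coinv_class :: "nat \<Rightarrow> xypoly \<Rightarrow> xypoly set" where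
  "coinv_class n p = coinv_ideal n +>\<^bsub>xyring n\<^esub> p"

definition coinv :: "nat \<Rightarrow> (rat, xypoly set) module" where
  "coinv n = ring.extend (xyring n Quot coinv_ideal n)
     (module.fields (\<lambda>c A. coinv_class n (Const c) \<otimes>\<^bsub>xyring n Quot coinv_ideal n\<^esub> A))"

definition coinv_bidegree :: "nat \<Rightarrow> nat \<Rightarrow> nat \<Rightarrow> xypoly set set" where
  "coinv_bidegree n d e = coinv_class n ` {p \<in> carrier (xyring n). bihomogeneous n d e p}"

text \<open>Since the ideal is stable under the diagonal action, \<open>\<beta>\<close> sends the class of \<open>p\<close> to the
  class of \<open>\<beta>\<cdot>p\<close> by taking the image of a coset elementwise.\<close>

definition trivial_component :: "nat \<Rightarrow> (rat, xypoly set) module" where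
  "trivial_component n = (coinv n)\<lparr>carrier :=
     {A \<in> carrier (coinv n). \<forall>\<beta> \<in> signed_perms n. diag_act \<beta> ` A = A}\<rparr>"

definition perm_monom :: "nat \<Rightarrow> (nat \<Rightarrow> nat) \<Rightarrow> (nat \<Rightarrow> nat) \<Rightarrow> (nat \<Rightarrow> nat) \<Rightarrow> (var \<Rightarrow>\<^sub>0 nat)" where
  "perm_monom n a b \<pi> = (\<Sum>i = 1..n. Poly_Mapping.single (Xvar (\<pi> i)) (a i) +
     Poly_Mapping.single (Yvar (\<pi> i)) (b i))"

text \<open>Summing over the image set counts each distinct monomial of the orbit once.\<close>

definition orbit_sum :: "nat \<Rightarrow> (nat \<Rightarrow> nat) \<Rightarrow> (nat \<Rightarrow> nat) \<Rightarrow> xypoly" where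
  "orbit_sum n a b =
     (\<Sum>m \<in> perm_monom n a b ` {\<pi>. \<pi> permutes {1..n}}. Poly_Mapping.single m 1)"

definition Mpoly :: "nat \<Rightarrow> (int \<Rightarrow> int) \<Rightarrow> xypoly" where
  "Mpoly n \<beta> = orbit_sum n (gvec n \<beta>) (gvec_tilde n \<beta>)"

end

theory Submission
  imports Defs "Jordan_Normal_Form.Determinant"
begin

text \<open>Write \<open>G\<close> for the group of signed permutations, \<open>R\<close> for the polynomial ring, \<open>A\<close> for the
invariants of \<open>G \<times> G\<close> in \<open>R\<close> (\<open>bi_invariants\<close>) and \<open>D\<close> for the diagonal invariants
(\<open>diag_invariants\<close>).  Averaging over \<open>G\<close> shows that every class fixed by \<open>G\<close> contains an
element of \<open>D\<close> (\<open>carrier_trivial_component\<close>).  It remains to see that the polynomials \<open>M\<^sub>\<beta>\<close>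
generate \<open>D\<close> as an \<open>A\<close>-module and that in a relation \<open>\<Sum> h\<^sub>\<beta> M\<^sub>\<beta> = 0\<close> with \<open>h\<^sub>\<beta> \<in> A\<close> no \<open>h\<^sub>\<beta>\<close> has
a constant term.

\<^bold>\<open>Spanning\<close> (\<open>diag_invariants_module_span\<close>).  Symmetrizing a monomial \<open>x\<^sup>a y\<^sup>b\<close> gives zero when
some \<open>a\<^sub>i + b\<^sub>i\<close> is odd, and otherwise a positive multiple of the orbit sum \<open>M(a, b)\<close>; so these
orbit sums span \<open>D\<close>.  Sort the pairs \<open>(a\<^sub>i, b\<^sub>i)\<close> so that \<open>a\<close> increases, with ties broken by \<open>b\<close>,
let \<open>\<beta>\<close> send a position in this order to the position of the same pair when \<open>b\<close> is sorted
first, and make it positive exactly at odd \<open>a\<^sub>i\<close> (\<open>sorting_signed_perm\<close>).  Then \<open>a - g(\<beta>)\<close> is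
even, nonnegative and weakly increasing, and likewise for \<open>b\<close> and \<open>\<beta>\<^sup>-\<^sup>1\<close>.  If \<open>a \<noteq> g(\<beta>)\<close>, one
can subtract \<open>2\<close> from \<open>a\<close> on a final segment of \<open>k\<close> positions without disturbing the order
(\<open>reducible_positions\<close>).  Multiplying the smaller orbit sum by the elementary symmetric
function \<open>e\<^sub>k(x\<^sub>1\<^sup>2, \<dots>, x\<^sub>n\<^sup>2)\<close>, which lies in \<open>A\<close>, returns a positive multiple of \<open>M(a, b)\<close> plus
multiples of orbit sums that are smaller for the lexicographic order on
\<open>(\<Sum> a\<^sub>i\<^sup>2 + b\<^sub>i\<^sup>2, \<Sum> a\<^sub>i b\<^sub>i)\<close> (\<open>straighten_step\<close>); the same works for \<open>b\<close> and the \<open>y\<^sub>i\<^sup>2\<close>.  When neither step applies, \<open>M(a, b)\<close> is \<open>M\<^sub>\<beta>\<close>.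

\<^bold>\<open>Independence\<close> (\<open>eval_coefficients_zero\<close>, \<open>constant_terms_zero\<close>).  For
\<open>t \<noteq> 0\<close> put \<open>x = t(1, \<dots>, n)\<close> and \<open>y = t(\<gamma>(1), \<dots>, \<gamma>(n))\<close> for
\<open>\<gamma> \<in> G\<close>.  These \<open>|G|\<close> points lie in distinct diagonal orbits, so symmetrized Lagrange
polynomials show that \<open>D\<close> takes arbitrary values on them, while every element of \<open>A\<close> is
constant on them.  As the \<open>|G|\<close> polynomials \<open>M\<^sub>\<beta>\<close> generate \<open>D\<close> over \<open>A\<close>, their square matrix of
values has a right inverse, hence is invertible.  A relation \<open>\<Sum> h\<^sub>\<beta> M\<^sub>\<beta> = 0\<close> with \<open>h\<^sub>\<beta> \<in> A\<close>
therefore forces \<open>h\<^sub>\<beta>\<close> to vanish at \<open>x = y = t(1, \<dots>, n)\<close> for all \<open>t \<noteq> 0\<close>, and so its constant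
term is zero.  Finally, symmetrizing an element of the ideal yields \<open>\<Sum> h\<^sub>\<beta> M\<^sub>\<beta>\<close> with
\<open>h\<^sub>\<beta> \<in> A\<close> free of constant terms (\<open>symmetrize_coinv_ideal\<close>); comparing constant terms shows that
a rational combination of the \<open>M\<^sub>\<beta>\<close> lies in the ideal only if all its coefficients vanish.\<close>

abbreviation lookup where "lookup \<equiv> Poly_Mapping.lookup"
abbreviation keys where "keys \<equiv> Poly_Mapping.keys"
abbreviation single where "single \<equiv> Poly_Mapping.single"

section \<open>Evaluating polynomials\<close>

definition monom_val :: "('v \<Rightarrow> 'b::comm_ring_1) \<Rightarrow> ('v \<Rightarrow>\<^sub>0 nat) \<Rightarrow> 'b" where
  "monom_val f m = (\<Prod>v \<in> keys m. f v ^ lookup m v)"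

text \<open>The scalars pass through \<open>h\<close>, so that one notion covers substitution of polynomials (\<open>h = Const\<close>),
evaluation at rational points (\<open>h\<close> the identity) and restriction to a line (values in univariate
polynomials).\<close>

definition poly_val :: "('c::zero \<Rightarrow> 'b) \<Rightarrow> ('v \<Rightarrow> 'b::comm_ring_1) \<Rightarrow> (('v \<Rightarrow>\<^sub>0 nat) \<Rightarrow>\<^sub>0 'c) \<Rightarrow> 'b" where
  "poly_val h f p = (\<Sum>m \<in> keys p. h (lookup p m) * monom_val f m)"

lemma monom_val_superset:
  assumes "finite S" "keys m \<subseteq> S"
  shows "monom_val f m = (\<Prod>v \<in> S. f v ^ lookup m v)"
  unfolding monom_val_def using assms
  by (intro prod.mono_neutral_left) (auto simp: in_keys_iff)

lemma monom_val_add: "monom_val f (m + m') = monom_val f m * monom_val f m'"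
proof -
  let ?S = "keys m \<union> keys m'"
  have "keys (m + m') \<subseteq> ?S" by (rule keys_add)
  then show ?thesis
    by (simp add: monom_val_superset[of ?S] lookup_add power_add prod.distrib)
qed

lemma monom_val_zero [simp]: "monom_val f 0 = 1"
  by (simp add: monom_val_def)

lemma monom_val_single [simp]: "monom_val f (single v k) = f v ^ k"
  by (cases "k = 0") (auto simp: monom_val_def)

lemma poly_val_superset:
  assumes "finite S" "keys p \<subseteq> S" "h 0 = 0"
  shows "poly_val h f p = (\<Sum>m \<in> S. h (lookup p m) * monom_val f m)"
  unfolding poly_val_def using assms
  by (intro sum.mono_neutral_left) (auto simp: in_keys_iff)

lemma poly_mapping_expand: "(p :: 'a \<Rightarrow>\<^sub>0 'b::comm_monoid_add) = (\<Sum>m\<in>keys p. single m (lookup p m))"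
  by (rule poly_mapping_eqI)
     (simp add: lookup_sum lookup_single when_def in_keys_iff)

locale scalar_hom =
  fixes h :: "'c::comm_ring_1 \<Rightarrow> 'b::comm_ring_1"
  assumes h_add: "h (x + y) = h x + h y" and h_mult: "h (x * y) = h x * h y" and h_one: "h 1 = 1"
begin

lemma h_zero: "h 0 = 0"
  using h_add[of 0 0] by simp

lemma poly_val_zero: "poly_val h f 0 = 0"
  by (simp add: poly_val_def)

lemma poly_val_single: "poly_val h f (single m c) = h c * monom_val f m"
  by (cases "c = 0") (auto simp: poly_val_def h_zero)

lemma poly_val_one: "poly_val h f 1 = 1"
  using poly_val_single[of f 0 1] by (simp add: h_one)

lemma poly_val_add: "poly_val h f (p + q) = poly_val h f p + poly_val h f q"
proof -
  let ?S = "keys p \<union> keys q"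
  have "keys (p + q) \<subseteq> ?S" by (rule keys_add)
  then show ?thesis
    by (simp add: poly_val_superset[of ?S] h_zero lookup_add h_add sum.distrib distrib_right)
qed

lemma poly_val_sum: "poly_val h f (sum g I) = (\<Sum>i\<in>I. poly_val h f (g i))"
  by (induction I rule: infinite_finite_induct) (auto simp: poly_val_add poly_val_zero)

lemma poly_val_mult: "poly_val h f (p * q) = poly_val h f p * poly_val h f q"
proof -
  have "poly_val h f (p * q) =
     poly_val h f ((\<Sum>m\<in>keys p. single m (lookup p m)) * (\<Sum>m\<in>keys q. single m (lookup q m)))"
    by (simp flip: poly_mapping_expand)
  also have "\<dots> = (\<Sum>m\<in>keys p. poly_val h f (single m (lookup p m))) *
      (\<Sum>m\<in>keys q. poly_val h f (single m (lookup q m)))"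
    by (simp add: sum_product mult_single poly_val_sum poly_val_single monom_val_add h_mult mult_ac)
  also have "\<dots> = poly_val h f p * poly_val h f q"
    by (simp flip: poly_mapping_expand add: poly_val_sum[symmetric])
  finally show ?thesis .
qed

lemma poly_val_diff: "poly_val h f (p - q) = poly_val h f p - poly_val h f q"
  using poly_val_add[of f "p - q" q] by simp

lemma poly_val_prod: "poly_val h f (prod g I) = (\<Prod>i\<in>I. poly_val h f (g i))"
  by (induction I rule: infinite_finite_induct) (auto simp: poly_val_mult poly_val_one)

lemma poly_val_power: "poly_val h f (p ^ k) = poly_val h f p ^ k"
  by (induction k) (auto simp: poly_val_mult poly_val_one)

end

lemma Const_add: "Const (a + b) = Const a + Const b"
  by (simp add: Const_def single_add)
lemma Const_mult: "Const (a * b) = Const a * Const b"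
  by (simp add: Const_def mult_single)
lemma Const_one [simp]: "Const 1 = 1"
  by (simp add: Const_def)
lemma Const_zero [simp]: "Const 0 = 0"
  by (simp add: Const_def)
lemma Const_of_nat: "Const (of_nat k) = of_nat k"
  by (simp add: Const_def single_of_nat)
lemma Const_power: "Const (a ^ k) = Const a ^ k"
  by (induction k) (auto simp: Const_mult)
lemma Const_minus: "Const (- a) = - Const a"
  by (simp add: Const_def single_uminus)
interpretation Const: scalar_hom Const
  by standard (auto simp: Const_add Const_mult)

interpretation rat: scalar_hom "\<lambda>c::rat. c"
  by standard auto

lemma substitute_eq: "substitute f = poly_val Const f"
  by (rule ext) (simp add: substitute_def poly_val_def monom_val_def)

lemma poly_val_Var: "scalar_hom h \<Longrightarrow> poly_val h f (Var v) = f v"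
  by (simp add: Var_def scalar_hom.poly_val_single scalar_hom.h_one)

lemma poly_val_Const: "scalar_hom h \<Longrightarrow> poly_val h f (Const c) = h c"
  by (simp add: Const_def scalar_hom.poly_val_single)

lemma poly_val_substitute:
  assumes "scalar_hom h"
  shows "poly_val h f (substitute g p) = poly_val h (\<lambda>v. poly_val h f (g v)) p"
proof -
  interpret scalar_hom h by fact
  show ?thesis
    unfolding substitute_def
    by (simp add: poly_val_sum poly_val_mult poly_val_prod poly_val_power poly_val_Const[OF assms]
          poly_val_def[of h "\<lambda>v. poly_val h f (g v)"] monom_val_def)
qed

lemma Var_power: "Var v ^ k = single (single v k) 1"
  by (induction k) (auto simp: Var_def mult_single simp flip: single_add)

lemma prod_single: "(\<Prod>i\<in>I. single (g i) (1::rat)) = single (\<Sum>i\<in>I. g i) 1"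
  by (induction I rule: infinite_finite_induct) (auto simp: mult_single)

lemma monom_val_Var: "monom_val Var m = single m 1"
  using poly_mapping_expand[of m] by (simp add: monom_val_def Var_power prod_single)

lemma substitute_Var: "substitute Var p = p"
  by (simp add: substitute_eq poly_val_def monom_val_Var Const_def mult_single flip: poly_mapping_expand)

section \<open>The group of signed permutations\<close>

text \<open>The notation \<open>inv\<close> is taken by inverses in groups and rings.\<close>

abbreviation finv :: "('a \<Rightarrow> 'b) \<Rightarrow> 'b \<Rightarrow> 'a" where "finv f \<equiv> inv_into UNIV f"

lemma signed_perms_odd: "\<beta> \<in> signed_perms n \<Longrightarrow> \<beta> (- i) = - \<beta> i"
  by (simp add: signed_perms_def)

lemma signed_perms_zero: "\<beta> \<in> signed_perms n \<Longrightarrow> \<beta> 0 = 0"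
  using signed_perms_odd[of \<beta> n 0] by simp

lemma signed_perms_outside:
  assumes "\<beta> \<in> signed_perms n" "\<bar>i\<bar> > int n"
  shows "\<beta> i = i"
proof (cases "i \<ge> 0")
  case True
  then show ?thesis using assms by (simp add: signed_perms_def)
next
  case False
  have "\<forall>j > int n. \<beta> j = j" using assms(1) by (simp add: signed_perms_def)
  then have "\<beta> (- i) = - i" using False assms(2) by (metis abs_of_neg not_le)
  then show ?thesis using signed_perms_odd[OF assms(1), of i] by simp
qed

lemma signed_perms_bij_abs: "\<beta> \<in> signed_perms n \<Longrightarrow> bij_betw (\<lambda>i. \<bar>\<beta> i\<bar>) {1..int n} {1..int n}"
  by (simp add: signed_perms_def)

lemma signed_perms_abs: "\<beta> \<in> signed_perms n \<Longrightarrow> \<bar>\<beta> \<bar>i\<bar>\<bar> = \<bar>\<beta> i\<bar>"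
  using signed_perms_odd[of \<beta> n i] by (cases "i \<ge> 0") auto

lemma signed_perms_range:
  assumes "\<beta> \<in> signed_perms n" "i \<in> {1..int n}"
  shows "\<bar>\<beta> i\<bar> \<in> {1..int n}"
  using bij_betwE[OF signed_perms_bij_abs[OF assms(1)]] assms(2) by blast

lemma signed_perms_bij:
  assumes b: "\<beta> \<in> signed_perms n"
  shows "bij \<beta>"
proof (rule bijI)
  have ninj: "i = j" if "\<bar>\<beta> i\<bar> = \<bar>\<beta> j\<bar>" "i \<ge> 0" "j \<ge> 0" for i j
  proof -
    have r: "k = 0 \<and> \<bar>\<beta> k\<bar> = 0 \<or> k > int n \<and> \<bar>\<beta> k\<bar> = k \<or>
        k \<in> {1..int n} \<and> \<bar>\<beta> k\<bar> \<in> {1..int n}" if "k \<ge> 0" for k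
    proof -
      have "k = 0 \<or> k > int n \<or> k \<in> {1..int n}"
        using that unfolding atLeastAtMost_iff by linarith
      then consider "k = 0" | "k > int n" | "k \<in> {1..int n}" by blast
      then show ?thesis
        by cases (use signed_perms_zero[OF b] signed_perms_outside[OF b, of k]
          signed_perms_range[OF b, of k] that in simp_all)
    qed
    have inj: "inj_on (\<lambda>i. \<bar>\<beta> i\<bar>) {1..int n}"
      using signed_perms_bij_abs[OF b] by (rule bij_betw_imp_inj_on)
    have "i = j" if "i \<in> {1..int n}" "j \<in> {1..int n}"
      using inj \<open>\<bar>\<beta> i\<bar> = \<bar>\<beta> j\<bar>\<close> that by (rule inj_onD)
    then show ?thesis using r[OF that(2)] r[OF that(3)] that(1) unfolding atLeastAtMost_iff by linarith
  qed
  show "inj \<beta>"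
  proof (rule injI)
    fix i j assume e: "\<beta> i = \<beta> j"
    have "\<bar>\<beta> \<bar>i\<bar>\<bar> = \<bar>\<beta> \<bar>j\<bar>\<bar>" by (simp only: signed_perms_abs[OF b] e)
    then have "\<bar>i\<bar> = \<bar>j\<bar>" by (rule ninj) simp_all
    then consider "i = j" | "i = - j" by linarith
    then show "i = j"
    proof cases
      case 2
      then have "\<beta> j = 0" using e signed_perms_odd[OF b, of j] by simp
      then have "\<bar>\<beta> \<bar>j\<bar>\<bar> = \<bar>\<beta> 0\<bar>" by (simp only: signed_perms_abs[OF b] signed_perms_zero[OF b])
      then have "\<bar>j\<bar> = 0" by (rule ninj) simp_all
      then show ?thesis using 2 by simp
    qed
  qed
  show "surj \<beta>"
  proof (unfold surj_def, rule allI)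
    fix k
    consider "k = 0 \<or> \<bar>k\<bar> > int n" | "\<bar>k\<bar> \<in> {1..int n}" by fastforce
    then show "\<exists>x. k = \<beta> x"
    proof cases
      case 1
      then show ?thesis
        by (metis signed_perms_zero[OF b] signed_perms_outside[OF b])
    next
      case 2
      then have "\<bar>k\<bar> \<in> (\<lambda>i. \<bar>\<beta> i\<bar>) ` {1..int n}"
        using bij_betw_imp_surj_on[OF signed_perms_bij_abs[OF b]] by simp
      then obtain i where "\<bar>\<beta> i\<bar> = \<bar>k\<bar>" by force
      then have "k = \<beta> i \<or> k = \<beta> (- i)" using signed_perms_odd[OF b, of i] by auto
      then show ?thesis by blast
    qed
  qed
qed

lemma signed_perms_id: "id \<in> signed_perms n"
proof -
  have "bij_betw (\<lambda>i. \<bar>i\<bar>) {1..int n} {1..int n}"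
    by (rule bij_betwI[where g = "\<lambda>i. i"]) auto
  then show ?thesis by (simp add: signed_perms_def)
qed

lemma signed_perms_comp:
  assumes b: "\<beta> \<in> signed_perms n" and c: "\<gamma> \<in> signed_perms n"
  shows "\<beta> \<circ> \<gamma> \<in> signed_perms n"
proof -
  have "bij_betw ((\<lambda>i. \<bar>\<beta> i\<bar>) \<circ> (\<lambda>i. \<bar>\<gamma> i\<bar>)) {1..int n} {1..int n}"
    by (rule bij_betw_trans[OF signed_perms_bij_abs[OF c] signed_perms_bij_abs[OF b]])
  then have "bij_betw (\<lambda>i. \<bar>\<beta> (\<gamma> i)\<bar>) {1..int n} {1..int n}"
    by (simp add: o_def signed_perms_abs[OF b])
  then show ?thesis
    using b c by (auto simp: signed_perms_def)
qed

lemma signed_perms_inv_apply: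
  assumes "\<beta> \<in> signed_perms n"
  shows "finv \<beta> (\<beta> i) = i" "\<beta> (finv \<beta> i) = i"
  using signed_perms_bij[OF assms] by (auto simp: bij_is_inj bij_is_surj surj_f_inv_f)

lemma signed_perms_inv:
  assumes b: "\<beta> \<in> signed_perms n"
  shows "finv \<beta> \<in> signed_perms n"
proof -
  note ii = signed_perms_inv_apply[OF b]
  have odd: "finv \<beta> (- i) = - finv \<beta> i" for i
    using signed_perms_odd[OF b, of "finv \<beta> i"] ii(1)[of "- finv \<beta> i"] ii(2)[of i] by simp
  have out: "finv \<beta> i = i" if "i > int n" for i
    using signed_perms_outside[OF b, of i] ii(1)[of i] that by simp
  have g: "\<bar>finv \<beta> \<bar>\<beta> i\<bar>\<bar> = \<bar>i\<bar>" for i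
    using ii(1)[of i] odd[of "\<beta> i"] by (cases "\<beta> i \<ge> 0") auto
  have f: "\<bar>\<beta> \<bar>finv \<beta> i\<bar>\<bar> = \<bar>i\<bar>" for i
    by (simp add: signed_perms_abs[OF b] ii)
  have r: "\<bar>finv \<beta> i\<bar> \<in> {1..int n}" if "i \<in> {1..int n}" for i
  proof -
    have "i \<in> (\<lambda>i. \<bar>\<beta> i\<bar>) ` {1..int n}"
      using that bij_betw_imp_surj_on[OF signed_perms_bij_abs[OF b]] by simp
    then obtain j where "j \<in> {1..int n}" "i = \<bar>\<beta> j\<bar>" by blast
    then show ?thesis using g[of j] by auto
  qed
  have "bij_betw (\<lambda>i. \<bar>finv \<beta> i\<bar>) {1..int n} {1..int n}"
    by (rule bij_betwI[where g = "\<lambda>i. \<bar>\<beta> i\<bar>"])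
       (use r signed_perms_range[OF b] g f in auto)
  then show ?thesis using odd out by (simp add: signed_perms_def)
qed

lemma signed_perms_eqI:
  assumes "\<beta> \<in> signed_perms n" "\<gamma> \<in> signed_perms n" "\<And>i. i \<in> {1..int n} \<Longrightarrow> \<beta> i = \<gamma> i"
  shows "\<beta> = \<gamma>"
proof
  fix i
  consider "i = 0" | "\<bar>i\<bar> > int n" | "i \<in> {1..int n}" | "- i \<in> {1..int n}" by fastforce
  then show "\<beta> i = \<gamma> i"
  proof cases
    case 4
    then have "\<beta> (- i) = \<gamma> (- i)" by (rule assms(3))
    then show ?thesis using assms by (simp add: signed_perms_odd)
  qed (use assms signed_perms_zero signed_perms_outside in \<open>metis+\<close>)
qed

lemma finite_signed_perms: "finite (signed_perms n)"
proof -
  let ?D = "{1..int n}"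
  have "inj_on (\<lambda>\<beta>. restrict \<beta> ?D) (signed_perms n)"
  proof (rule inj_onI)
    fix \<beta> \<gamma> assume bc: "\<beta> \<in> signed_perms n" "\<gamma> \<in> signed_perms n"
      and e: "restrict \<beta> ?D = restrict \<gamma> ?D"
    show "\<beta> = \<gamma>"
      by (rule signed_perms_eqI[OF bc]) (metis e restrict_apply')
  qed
  moreover have "(\<lambda>\<beta>. restrict \<beta> ?D) ` signed_perms n \<subseteq> (\<Pi>\<^sub>E i\<in>?D. {- int n..int n})"
    using signed_perms_range by fastforce
  moreover have "finite (\<Pi>\<^sub>E i\<in>?D. {- int n..int n})"
    by (intro finite_PiE) auto
  ultimately show ?thesis
    using finite_imageD finite_subset by blast
qed

lemma bij_betw_comp_signed_perms:
  assumes "\<gamma> \<in> signed_perms n"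
  shows "bij_betw (\<lambda>\<beta>. \<beta> \<circ> \<gamma>) (signed_perms n) (signed_perms n)"
    and "bij_betw (\<lambda>\<beta>. \<gamma> \<circ> \<beta>) (signed_perms n) (signed_perms n)"
  by (rule bij_betwI[where g = "\<lambda>\<beta>. \<beta> \<circ> finv \<gamma>"] bij_betwI[where g = "\<lambda>\<beta>. finv \<gamma> \<circ> \<beta>"];
      use assms signed_perms_comp signed_perms_inv signed_perms_inv_apply[OF assms] in
        \<open>auto simp: fun_eq_iff\<close>)+

lemma int_sp_abs: "int (sp_abs \<beta> i) = \<bar>\<beta> (int i)\<bar>"
  by (simp add: sp_abs_def)

lemma sp_abs_comp:
  assumes "\<beta> \<in> signed_perms n"
  shows "sp_abs (\<beta> \<circ> \<gamma>) i = sp_abs \<beta> (sp_abs \<gamma> i)"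
  by (simp add: sp_abs_def signed_perms_abs[OF assms])

lemma sp_abs_id [simp]: "sp_abs id i = i"
  by (simp add: sp_abs_def)

lemma sp_abs_inv:
  assumes "\<beta> \<in> signed_perms n"
  shows "sp_abs (finv \<beta>) (sp_abs \<beta> i) = i" "sp_abs \<beta> (sp_abs (finv \<beta>) i) = i"
proof -
  have e: "finv \<beta> \<circ> \<beta> = id" "\<beta> \<circ> finv \<beta> = id"
    using signed_perms_inv_apply[OF assms] by auto
  show "sp_abs (finv \<beta>) (sp_abs \<beta> i) = i" "sp_abs \<beta> (sp_abs (finv \<beta>) i) = i"
    using sp_abs_comp[OF assms, of "finv \<beta>" i] sp_abs_comp[OF signed_perms_inv[OF assms], of \<beta> i]
    by (simp_all add: e)
qed

lemma sp_abs_permutes: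
  assumes "\<beta> \<in> signed_perms n"
  shows "sp_abs \<beta> permutes {1..n}"
proof (rule bij_imp_permutes)
  have r: "sp_abs \<gamma> i \<in> {1..n}" if "\<gamma> \<in> signed_perms n" "i \<in> {1..n}" for \<gamma> i
    using signed_perms_range[OF that(1), of "int i"] that(2) by (auto simp: sp_abs_def)
  show "bij_betw (sp_abs \<beta>) {1..n} {1..n}"
    by (rule bij_betwI[where g = "sp_abs (finv \<beta>)"])
       (use r assms signed_perms_inv sp_abs_inv[OF assms] in auto)
  show "sp_abs \<beta> i = i" if "i \<notin> {1..n}" for i
  proof (cases "i = 0")
    case True
    then show ?thesis by (simp add: sp_abs_def signed_perms_zero[OF assms])
  next
    case False
    then show ?thesis using that signed_perms_outside[OF assms, of "int i"] by (auto simp: sp_abs_def)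
  qed
qed

lemma sp_abs_in [simp]: "\<beta> \<in> signed_perms n \<Longrightarrow> sp_abs \<beta> i \<in> {1..n} \<longleftrightarrow> i \<in> {1..n}"
  using permutes_in_image[OF sp_abs_permutes] by blast

text \<open>The signed permutation with underlying permutation \<open>\<pi>\<close> and a prescribed set of positive entries.
Outside \<open>{-n..n}\<close> the sign is forced, because signed permutations are the identity there.\<close>

definition make_signed :: "nat \<Rightarrow> (nat \<Rightarrow> nat) \<Rightarrow> (nat \<Rightarrow> bool) \<Rightarrow> int \<Rightarrow> int" where
  "make_signed n \<pi> pos k =
     (if nat \<bar>k\<bar> \<in> {1..n} \<and> \<not> pos (nat \<bar>k\<bar>) then - sgn k else sgn k) * int (\<pi> (nat \<bar>k\<bar>))"

lemma abs_make_signed: "k \<noteq> 0 \<Longrightarrow> \<bar>make_signed n \<pi> pos k\<bar> = int (\<pi> (nat \<bar>k\<bar>))"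
  by (simp add: make_signed_def abs_mult)

lemma make_signed_in:
  assumes "\<pi> permutes {1..n}"
  shows "make_signed n \<pi> pos \<in> signed_perms n"
proof -
  note pin = permutes_in_image[OF assms]
  have p: "\<pi> i \<in> {1..n}" "finv \<pi> i \<in> {1..n}" if "i \<in> {1..n}" for i
    using that pin[of i] permutes_in_image[OF permutes_inv[OF assms], of i] by simp_all
  have "bij_betw (\<lambda>k. int (\<pi> (nat \<bar>k\<bar>))) {1..int n} {1..int n}"
  proof (rule bij_betwI[where g = "\<lambda>k. int (finv \<pi> (nat \<bar>k\<bar>))"])
    show "(\<lambda>k. int (\<pi> (nat \<bar>k\<bar>))) \<in> {1..int n} \<rightarrow> {1..int n}"
    proof
      fix k assume "k \<in> {1..int n}"
      then have "nat \<bar>k\<bar> \<in> {1..n}" by auto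
      from p(1)[OF this] show "int (\<pi> (nat \<bar>k\<bar>)) \<in> {1..int n}" by auto
    qed
    show "(\<lambda>k. int (finv \<pi> (nat \<bar>k\<bar>))) \<in> {1..int n} \<rightarrow> {1..int n}"
    proof
      fix k assume "k \<in> {1..int n}"
      then have "nat \<bar>k\<bar> \<in> {1..n}" by auto
      from p(2)[OF this] show "int (finv \<pi> (nat \<bar>k\<bar>)) \<in> {1..int n}" by auto
    qed
  qed (auto simp: permutes_inverses[OF assms])
  then have "bij_betw (\<lambda>k. \<bar>make_signed n \<pi> pos k\<bar>) {1..int n} {1..int n}"
    by (rule iffD1[OF bij_betw_cong, rotated]) (simp add: abs_make_signed)
  moreover have "make_signed n \<pi> pos i = i" if "i > int n" for i
  proof -
    have "nat \<bar>i\<bar> \<notin> {1..n}" using that by auto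
    moreover from this have "\<pi> (nat \<bar>i\<bar>) = nat \<bar>i\<bar>" using assms by (simp add: permutes_not_in)
    ultimately show ?thesis using that by (simp add: make_signed_def)
  qed
  ultimately show ?thesis
    by (simp add: signed_perms_def make_signed_def)
qed

lemma sp_abs_make_signed:
  assumes "\<pi> permutes {1..n}"
  shows "sp_abs (make_signed n \<pi> pos) = \<pi>"
proof
  fix i
  have "\<pi> 0 = 0" using assms by (simp add: permutes_not_in)
  then show "sp_abs (make_signed n \<pi> pos) i = \<pi> i"
    by (cases "i = 0") (auto simp: sp_abs_def abs_make_signed make_signed_def)
qed

lemma make_signed_pos_iff:
  assumes "\<pi> permutes {1..n}" "i \<in> {1..n}"
  shows "make_signed n \<pi> pos (int i) > 0 \<longleftrightarrow> pos i"
proof -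
  have "\<pi> i \<in> {1..n}" using assms(2) permutes_in_image[OF assms(1), of i] by simp
  then show ?thesis using assms(2) by (auto simp: make_signed_def)
qed

section \<open>The polynomial ring and the two actions\<close>

abbreviation xy_vars :: "nat \<Rightarrow> var set" where
  "xy_vars n \<equiv> Xvar ` {1..n} \<union> Yvar ` {1..n}"

abbreviation xypolys :: "nat \<Rightarrow> xypoly set" where
  "xypolys n \<equiv> carrier (xyring n)"

lemma xypolys_iff: "p \<in> xypolys n \<longleftrightarrow> (\<forall>m \<in> keys p. keys m \<subseteq> xy_vars n)"
  by (simp add: xyring_def)

lemma xypolys_single: "keys m \<subseteq> xy_vars n \<Longrightarrow> single m c \<in> xypolys n"
  by (cases "c = 0") (auto simp: xypolys_iff)

lemma xypolys_Const: "Const c \<in> xypolys n"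
  unfolding Const_def by (rule xypolys_single) simp

lemma xypolys_zero: "0 \<in> xypolys n"
  using xypolys_Const[of 0] by simp

lemma xypolys_one: "1 \<in> xypolys n"
  using xypolys_Const[of 1] by simp

lemma xypolys_Var: "v \<in> xy_vars n \<Longrightarrow> Var v \<in> xypolys n"
  unfolding Var_def by (rule xypolys_single) simp

lemma xypolys_add: "p \<in> xypolys n \<Longrightarrow> q \<in> xypolys n \<Longrightarrow> p + q \<in> xypolys n"
  using keys_add[of p q] unfolding xypolys_iff by blast

lemma xypolys_mult:
  assumes "p \<in> xypolys n" "q \<in> xypolys n"
  shows "p * q \<in> xypolys n"
  unfolding xypolys_iff
proof
  fix m assume "m \<in> keys (p * q)"
  then obtain a b where "m = a + b" "a \<in> keys p" "b \<in> keys q"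
    using keys_mult[of p q] by blast
  then show "keys m \<subseteq> xy_vars n"
    using assms keys_add[of a b] unfolding xypolys_iff by blast
qed

lemma xypolys_uminus: "p \<in> xypolys n \<Longrightarrow> - p \<in> xypolys n"
  using xypolys_mult[OF xypolys_Const[of "-1"], of p n] by (simp add: Const_minus)

lemma xypolys_diff: "p \<in> xypolys n \<Longrightarrow> q \<in> xypolys n \<Longrightarrow> p - q \<in> xypolys n"
  using xypolys_add[OF _ xypolys_uminus, of p n q] by simp

lemma xypolys_sum: "(\<And>i. i \<in> I \<Longrightarrow> f i \<in> xypolys n) \<Longrightarrow> sum f I \<in> xypolys n"
  by (induction I rule: infinite_finite_induct) (auto intro: xypolys_add xypolys_zero)

lemma xypolys_prod: "(\<And>i. i \<in> I \<Longrightarrow> f i \<in> xypolys n) \<Longrightarrow> prod f I \<in> xypolys n"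
  by (induction I rule: infinite_finite_induct) (auto intro: xypolys_mult xypolys_one)

lemma xypolys_power: "p \<in> xypolys n \<Longrightarrow> p ^ k \<in> xypolys n"
  by (induction k) (auto intro: xypolys_mult xypolys_one)

lemmas xypolys_closed = xypolys_Const xypolys_zero xypolys_one xypolys_Var xypolys_add xypolys_mult
  xypolys_uminus xypolys_diff xypolys_sum xypolys_prod xypolys_power

lemma xypolys_substitute:
  assumes "p \<in> xypolys n" "\<And>v. v \<in> xy_vars n \<Longrightarrow> f v \<in> xypolys n"
  shows "substitute f p \<in> xypolys n"
  unfolding substitute_def
  by (intro xypolys_sum xypolys_mult xypolys_Const xypolys_prod xypolys_power assms(2))
    (use assms(1) in \<open>unfold xypolys_iff, blast\<close>)

lemma poly_val_cong:
  assumes "p \<in> xypolys n" "\<And>v. v \<in> xy_vars n \<Longrightarrow> f v = g v"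
  shows "poly_val h f p = poly_val h g p"
  unfolding poly_val_def monom_val_def
proof (intro sum.cong refl arg_cong2[where f = "(*)"] prod.cong)
  fix m v assume "m \<in> keys p" "v \<in> keys m"
  then have "v \<in> xy_vars n" using assms(1) unfolding xypolys_iff by blast
  then show "f v ^ lookup m v = g v ^ lookup m v" using assms(2) by simp
qed

text \<open>The constant term is evaluation at the origin, hence multiplicative.\<close>

lemma lookup_zero_eq: "lookup p 0 = poly_val (\<lambda>c::rat. c) (\<lambda>v. 0) p" for p :: xypoly
proof -
  have mv: "monom_val (\<lambda>v. 0::rat) m = (if m = 0 then 1 else 0)" for m :: "var \<Rightarrow>\<^sub>0 nat"
  proof (cases "keys m = {}")
    case False
    then have "m \<noteq> 0" by auto
    moreover have "(\<Prod>v\<in>keys m. (0::rat) ^ lookup m v) = 0"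
    proof -
      obtain v where "v \<in> keys m" using False by blast
      then show ?thesis by (intro prod_zero) (auto simp: in_keys_iff intro!: bexI[of _ v])
    qed
    ultimately show ?thesis by (simp add: monom_val_def)
  next
    case True
    then have "m = 0" by (intro poly_mapping_eqI) (auto simp: in_keys_iff)
    then show ?thesis by simp
  qed
  have "poly_val (\<lambda>c::rat. c) (\<lambda>v. 0) p = (\<Sum>m\<in>keys p. if m = 0 then lookup p m else 0)"
    unfolding poly_val_def mv by (intro sum.cong) auto
  then show ?thesis by (simp add: in_keys_iff)
qed

lemma lookup_mult_zero: "lookup (p * q) 0 = lookup p 0 * (lookup q 0 :: rat)" for p q :: xypoly
  by (simp add: lookup_zero_eq rat.poly_val_mult)

lemma act2_eq: "act2 \<beta> \<gamma> = poly_val Const (act_var \<beta> \<gamma>)"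
  by (simp add: act2_def substitute_eq)

lemma act2_add: "act2 \<beta> \<gamma> (p + q) = act2 \<beta> \<gamma> p + act2 \<beta> \<gamma> q"
  and act2_mult: "act2 \<beta> \<gamma> (p * q) = act2 \<beta> \<gamma> p * act2 \<beta> \<gamma> q"
  and act2_sum: "act2 \<beta> \<gamma> (sum f I) = (\<Sum>i\<in>I. act2 \<beta> \<gamma> (f i))"
  and act2_prod: "act2 \<beta> \<gamma> (prod g J) = (\<Prod>j\<in>J. act2 \<beta> \<gamma> (g j))"
  and act2_power: "act2 \<beta> \<gamma> (p ^ k) = act2 \<beta> \<gamma> p ^ k"
  and act2_diff: "act2 \<beta> \<gamma> (p - q) = act2 \<beta> \<gamma> p - act2 \<beta> \<gamma> q"
  and act2_Const: "act2 \<beta> \<gamma> (Const c) = Const c"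
  and act2_zero: "act2 \<beta> \<gamma> 0 = 0"
  and act2_Var: "act2 \<beta> \<gamma> (Var v) = act_var \<beta> \<gamma> v"
  by (simp_all add: act2_eq Const.poly_val_add Const.poly_val_mult Const.poly_val_sum
      Const.poly_val_prod Const.poly_val_power Const.poly_val_diff poly_val_Const Const.poly_val_zero
      poly_val_Var Const.scalar_hom_axioms)

lemma act_var_in:
  assumes "\<beta> \<in> signed_perms n" "\<gamma> \<in> signed_perms n" "v \<in> xy_vars n"
  shows "act_var \<beta> \<gamma> v \<in> xypolys n"
proof (cases v)
  case Xvar: (Xvar i)
  then have "i \<in> {1..n}" using assms(3) by auto
  then have "sp_abs \<beta> i \<in> {1..n}" by (simp only: sp_abs_in[OF assms(1)])
  then have "Xvar (sp_abs \<beta> i) \<in> xy_vars n" by blast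
  then show ?thesis unfolding Xvar by (simp add: xypolys_mult xypolys_Const xypolys_Var del: Un_iff)
next
  case Yvar: (Yvar i)
  then have "i \<in> {1..n}" using assms(3) by auto
  then have "sp_abs \<gamma> i \<in> {1..n}" by (simp only: sp_abs_in[OF assms(2)])
  then have "Yvar (sp_abs \<gamma> i) \<in> xy_vars n" by blast
  then show ?thesis unfolding Yvar by (simp add: xypolys_mult xypolys_Const xypolys_Var del: Un_iff)
qed

lemma act2_in:
  assumes "\<beta> \<in> signed_perms n" "\<gamma> \<in> signed_perms n" "p \<in> xypolys n"
  shows "act2 \<beta> \<gamma> p \<in> xypolys n"
  unfolding act2_def using assms by (intro xypolys_substitute act_var_in)

lemma sgn_signed_perms: "\<beta> \<in> signed_perms n \<Longrightarrow> sgn (\<beta> (\<bar>i\<bar>)) * sgn i = sgn (\<beta> i)"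
  using signed_perms_odd[of \<beta> n i] signed_perms_zero[of \<beta> n] by (cases "i = 0"; cases "i > 0") auto

lemma act2_act2:
  assumes b: "\<beta> \<in> signed_perms n" and g: "\<gamma> \<in> signed_perms n"
  shows "act2 \<beta> \<gamma> (act2 \<beta>' \<gamma>' p) = act2 (\<beta> \<circ> \<beta>') (\<gamma> \<circ> \<gamma>') p"
proof -
  have sgns: "of_int (sgn (\<beta>' i)) * of_int (sgn (\<beta> (int (sp_abs \<beta>' j)))) = (of_int (sgn ((\<beta> \<circ> \<beta>') i)) :: rat)"
    if "i = int j" "\<beta> \<in> signed_perms n" for \<beta> \<beta>' i j
  proof -
    have "sgn (\<beta>' i) * sgn (\<beta> (int (sp_abs \<beta>' j))) = sgn (\<beta> (\<beta>' i))"
      using sgn_signed_perms[OF that(2), of "\<beta>' i"] that(1) by (simp add: int_sp_abs mult.commute)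
    then show ?thesis by (metis of_int_mult o_apply)
  qed
  have "act2 \<beta> \<gamma> (act_var \<beta>' \<gamma>' v) = act_var (\<beta> \<circ> \<beta>') (\<gamma> \<circ> \<gamma>') v" for v
  proof (cases v)
    case (Xvar i)
    then show ?thesis
      using sgns[OF refl b, of \<beta>' i]
      by (simp add: act2_mult act2_Const act2_Var sp_abs_comp[OF b] del: o_apply
          flip: mult.assoc Const_mult)
  next
    case (Yvar i)
    then show ?thesis
      using sgns[OF refl g, of \<gamma>' i]
      by (simp add: act2_mult act2_Const act2_Var sp_abs_comp[OF g] del: o_apply
          flip: mult.assoc Const_mult)
  qed
  then show ?thesis
    using poly_val_substitute[OF Const.scalar_hom_axioms, of "act_var \<beta> \<gamma>" "act_var \<beta>' \<gamma>'" p]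
    by (simp add: act2_eq substitute_eq)
qed

text \<open>Membership in the ring matters: the action sends the spurious variable \<^term>\<open>Var (Xvar 0)\<close> to zero,
since signed permutations fix \<open>0\<close>, which has no sign.\<close>

lemma act2_id:
  assumes "p \<in> xypolys n"
  shows "act2 id id p = p"
proof -
  have "act2 id id p = poly_val Const Var p"
    unfolding act2_eq using assms by (rule poly_val_cong) auto
  then show ?thesis using substitute_Var[of p] by (simp add: substitute_eq)
qed

section \<open>Invariants and symmetrization\<close>

definition diag_invariants :: "nat \<Rightarrow> xypoly set" where
  "diag_invariants n = {p \<in> xypolys n. \<forall>\<beta> \<in> signed_perms n. diag_act \<beta> p = p}"

definition bi_invariants :: "nat \<Rightarrow> xypoly set" where
  "bi_invariants n = {p \<in> xypolys n. \<forall>\<beta> \<in> signed_perms n. \<forall>\<gamma> \<in> signed_perms n. act2 \<beta> \<gamma> p = p}"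

text \<open>The sum is left undivided by the order of the group, so that symmetrized monomials have integer
coefficients.\<close>

definition symmetrize :: "nat \<Rightarrow> xypoly \<Rightarrow> xypoly" where
  "symmetrize n p = (\<Sum>\<beta>\<in>signed_perms n. diag_act \<beta> p)"

lemma diag_act_in: "\<beta> \<in> signed_perms n \<Longrightarrow> p \<in> xypolys n \<Longrightarrow> diag_act \<beta> p \<in> xypolys n"
  by (simp add: diag_act_def act2_in)

lemma bi_invariants_closed:
  "Const c \<in> bi_invariants n"
  "p \<in> bi_invariants n \<Longrightarrow> q \<in> bi_invariants n \<Longrightarrow> p + q \<in> bi_invariants n"
  "p \<in> bi_invariants n \<Longrightarrow> q \<in> bi_invariants n \<Longrightarrow> p - q \<in> bi_invariants n"
  "p \<in> bi_invariants n \<Longrightarrow> q \<in> bi_invariants n \<Longrightarrow> p * q \<in> bi_invariants n"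
  by (auto simp: bi_invariants_def act2_add act2_mult act2_diff act2_Const intro: xypolys_closed)

lemma symmetrize_add: "symmetrize n (p + q) = symmetrize n p + symmetrize n q"
  by (simp add: symmetrize_def diag_act_def act2_add sum.distrib)

lemma symmetrize_sum: "symmetrize n (sum f I) = (\<Sum>i\<in>I. symmetrize n (f i))"
  unfolding symmetrize_def diag_act_def act2_sum by (rule sum.swap)

text \<open>Symmetrization is linear over the bi-invariants.  This is what lets multiplication by symmetric
functions be computed on single monomials.\<close>

lemma symmetrize_mult:
  assumes "h \<in> bi_invariants n"
  shows "symmetrize n (h * p) = h * symmetrize n p"
  using assms by (simp add: symmetrize_def diag_act_def act2_mult sum_distrib_left bi_invariants_def)

lemma symmetrize_Const_mult: "symmetrize n (Const c * p) = Const c * symmetrize n p"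
  by (intro symmetrize_mult bi_invariants_closed)

lemma symmetrize_in:
  assumes "p \<in> xypolys n"
  shows "symmetrize n p \<in> diag_invariants n"
proof -
  have "diag_act \<gamma> (symmetrize n p) = symmetrize n p" if g: "\<gamma> \<in> signed_perms n" for \<gamma>
  proof -
    have "diag_act \<gamma> (symmetrize n p) = (\<Sum>\<beta>\<in>signed_perms n. diag_act (\<gamma> \<circ> \<beta>) p)"
      by (simp add: symmetrize_def diag_act_def act2_sum act2_act2[OF g g])
    also have "\<dots> = symmetrize n p"
      unfolding symmetrize_def
      by (rule sum.reindex_bij_betw[OF bij_betw_comp_signed_perms(2)[OF g]])
    finally show ?thesis .
  qed
  moreover have "symmetrize n p \<in> xypolys n"
    unfolding symmetrize_def using assms by (intro xypolys_sum diag_act_in)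
  ultimately show ?thesis by (simp add: diag_invariants_def)
qed

lemma symmetrize_diag_act:
  assumes "\<gamma> \<in> signed_perms n"
  shows "symmetrize n (diag_act \<gamma> p) = symmetrize n p"
proof -
  have "symmetrize n (diag_act \<gamma> p) = (\<Sum>\<beta>\<in>signed_perms n. diag_act (\<beta> \<circ> \<gamma>) p)"
    unfolding symmetrize_def diag_act_def by (intro sum.cong refl act2_act2)
  also have "\<dots> = symmetrize n p"
    unfolding symmetrize_def
    by (rule sum.reindex_bij_betw[OF bij_betw_comp_signed_perms(1)[OF assms]])
  finally show ?thesis .
qed

lemma symmetrize_invariant:
  assumes "p \<in> diag_invariants n"
  shows "symmetrize n p = Const (of_nat (card (signed_perms n))) * p"
  using assms by (simp add: symmetrize_def diag_invariants_def Const_of_nat)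

lemma card_signed_perms_pos: "card (signed_perms n) > 0"
  using finite_signed_perms signed_perms_id by (auto simp: card_gt_0_iff)

section \<open>Symmetrized monomials and orbit sums\<close>

definition xymonom :: "nat \<Rightarrow> (nat \<Rightarrow> nat) \<Rightarrow> (nat \<Rightarrow> nat) \<Rightarrow> xypoly" where
  "xymonom n a b = single (perm_monom n a b id) 1"

definition sym_monom :: "nat \<Rightarrow> (nat \<Rightarrow> nat) \<Rightarrow> (nat \<Rightarrow> nat) \<Rightarrow> xypoly" where
  "sym_monom n a b = symmetrize n (xymonom n a b)"

definition parity_matched :: "nat \<Rightarrow> (nat \<Rightarrow> nat) \<Rightarrow> (nat \<Rightarrow> nat) \<Rightarrow> bool" where
  "parity_matched n a b \<longleftrightarrow> (\<forall>i\<in>{1..n}. even (a i + b i))"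

lemma single_perm_monom:
  "single (perm_monom n a b \<pi>) 1 = (\<Prod>i=1..n. Var (Xvar (\<pi> i)) ^ a i * Var (Yvar (\<pi> i)) ^ b i)"
  by (simp add: perm_monom_def Var_power mult_single prod_single)

lemma xymonom_prod: "xymonom n a b = (\<Prod>i=1..n. Var (Xvar i) ^ a i * Var (Yvar i) ^ b i)"
  by (simp add: xymonom_def single_perm_monom)

lemma lookup_perm_monom:
  assumes "\<pi> permutes {1..n}" "j \<in> {1..n}"
  shows "lookup (perm_monom n a b \<pi>) (Xvar (\<pi> j)) = a j"
    and "lookup (perm_monom n a b \<pi>) (Yvar (\<pi> j)) = b j"
proof -
  have e: "\<pi> i = \<pi> j \<longleftrightarrow> i = j" for i
    using permutes_inj[OF assms(1)] by (auto dest: injD)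
  show "lookup (perm_monom n a b \<pi>) (Xvar (\<pi> j)) = a j"
    "lookup (perm_monom n a b \<pi>) (Yvar (\<pi> j)) = b j"
    using assms(2) by (simp_all add: perm_monom_def lookup_sum lookup_add lookup_single when_def e)
qed

lemma keys_perm_monom:
  assumes "\<pi> permutes {1..n}"
  shows "keys (perm_monom n a b \<pi>) \<subseteq> xy_vars n"
proof
  fix v assume v: "v \<in> keys (perm_monom n a b \<pi>)"
  show "v \<in> xy_vars n"
  proof (rule ccontr)
    assume nv: "v \<notin> xy_vars n"
    have "Xvar (\<pi> i) \<noteq> v \<and> Yvar (\<pi> i) \<noteq> v" if "i \<in> {1..n}" for i
    proof -
      have "\<pi> i \<in> {1..n}" by (simp only: permutes_in_image[OF assms] that)
      then show ?thesis using nv by blast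
    qed
    then have "lookup (perm_monom n a b \<pi>) v = 0"
      by (auto simp: perm_monom_def lookup_sum lookup_add lookup_single when_def)
    then show False using v by (simp add: in_keys_iff)
  qed
qed

lemma xymonom_in: "xymonom n a b \<in> xypolys n"
  unfolding xymonom_def by (intro xypolys_single keys_perm_monom permutes_id)

lemma xymonom_cong:
  "(\<And>i. i \<in> {1..n} \<Longrightarrow> a i = a' i \<and> b i = b' i) \<Longrightarrow> xymonom n a b = xymonom n a' b'"
  unfolding xymonom_prod by (intro prod.cong) auto

lemma sym_monom_cong:
  "(\<And>i. i \<in> {1..n} \<Longrightarrow> a i = a' i \<and> b i = b' i) \<Longrightarrow> sym_monom n a b = sym_monom n a' b'"
  unfolding sym_monom_def by (metis xymonom_cong)

lemma sym_monom_in: "sym_monom n a b \<in> diag_invariants n"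
  unfolding sym_monom_def by (intro symmetrize_in xymonom_in)

lemma monomial_eq_perm_monom:
  assumes "keys m \<subseteq> xy_vars n"
  shows "m = perm_monom n (\<lambda>i. lookup m (Xvar i)) (\<lambda>i. lookup m (Yvar i)) id"
proof (rule poly_mapping_eqI)
  fix v
  let ?a = "\<lambda>i. lookup m (Xvar i)" and ?b = "\<lambda>i. lookup m (Yvar i)"
  show "lookup m v = lookup (perm_monom n ?a ?b id) v"
  proof (cases "v \<in> xy_vars n")
    case True
    then show ?thesis
      using lookup_perm_monom[OF permutes_id[of "{1..n}"], where a = ?a and b = ?b] by auto
  next
    case False
    then have "v \<notin> keys m" "v \<notin> keys (perm_monom n ?a ?b id)"
      using assms keys_perm_monom[OF permutes_id[of "{1..n}"], of ?a ?b] by blast+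
    then show ?thesis by (simp add: in_keys_iff)
  qed
qed

lemma diag_act_xymonom:
  "diag_act \<beta> (xymonom n a b) = Const (\<Prod>i=1..n. of_int (sgn (\<beta> (int i))) ^ (a i + b i)) *
     single (perm_monom n a b (sp_abs \<beta>)) 1"
proof -
  have "diag_act \<beta> (xymonom n a b) =
    (\<Prod>i=1..n. Const (of_int (sgn (\<beta> (int i)))) ^ (a i + b i) *
       (Var (Xvar (sp_abs \<beta> i)) ^ a i * Var (Yvar (sp_abs \<beta> i)) ^ b i))"
    unfolding xymonom_prod diag_act_def act2_prod act2_mult act2_power act2_Var
    by (intro prod.cong) (simp_all add: power_mult_distrib power_add mult_ac)
  also have "\<dots> = Const (\<Prod>i=1..n. of_int (sgn (\<beta> (int i))) ^ (a i + b i)) *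
     single (perm_monom n a b (sp_abs \<beta>)) 1"
  proof -
    have "Const (prod g I) = (\<Prod>i\<in>I. Const (g i))" for g and I :: "nat set"
      by (induction I rule: infinite_finite_induct) (auto simp: Const_mult)
    then show ?thesis by (simp add: prod.distrib single_perm_monom Const_power)
  qed
  finally show ?thesis .
qed

lemma signed_perms_nonzero: "\<beta> \<in> signed_perms n \<Longrightarrow> i \<in> {1..n} \<Longrightarrow> \<beta> (int i) \<noteq> 0"
  using signed_perms_range[of \<beta> n "int i"] by auto

lemma diag_act_xymonom_matched:
  assumes "\<beta> \<in> signed_perms n" "parity_matched n a b"
  shows "diag_act \<beta> (xymonom n a b) = single (perm_monom n a b (sp_abs \<beta>)) 1"
proof -
  have "(of_int (sgn (\<beta> (int i))) :: rat) ^ (a i + b i) = 1" if "i \<in> {1..n}" for i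
  proof -
    have "sgn (\<beta> (int i)) = 1 \<or> sgn (\<beta> (int i)) = - 1"
      using signed_perms_nonzero[OF assms(1) that] by (auto simp: sgn_if)
    moreover have "even (a i + b i)" using assms(2) that by (simp add: parity_matched_def)
    ultimately show ?thesis by (auto simp: uminus_power_if)
  qed
  then have "(\<Prod>i=1..n. (of_int (sgn (\<beta> (int i))) :: rat) ^ (a i + b i)) = 1"
    by (intro prod.neutral) blast
  then show ?thesis unfolding diag_act_xymonom by simp
qed

text \<open>Flipping the sign of \<open>x\<^sub>i\<close> and \<open>y\<^sub>i\<close> for an index with \<open>a\<^sub>i + b\<^sub>i\<close> odd negates the monomial but not its
symmetrization.\<close>

lemma sym_monom_unmatched:
  assumes "\<not> parity_matched n a b"
  shows "sym_monom n a b = 0"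
proof -
  obtain i where i: "i \<in> {1..n}" "odd (a i + b i)"
    using assms unfolding parity_matched_def by blast
  define \<beta> where "\<beta> = make_signed n id (\<lambda>j. j \<noteq> i)"
  have b: "\<beta> \<in> signed_perms n" unfolding \<beta>_def by (intro make_signed_in permutes_id)
  have "sp_abs \<beta> = id" unfolding \<beta>_def by (intro sp_abs_make_signed permutes_id)
  moreover have "(\<Prod>j=1..n. (of_int (sgn (\<beta> (int j))) :: rat) ^ (a j + b j)) = - 1"
  proof -
    have s: "sgn (\<beta> (int j)) = (if j = i then - 1 else 1)" if "j \<in> {1..n}" for j
      using that by (auto simp: \<beta>_def make_signed_def)
    have "(\<Prod>j=1..n. (of_int (sgn (\<beta> (int j))) :: rat) ^ (a j + b j)) =
        (\<Prod>j=1..n. if j = i then - 1 else 1)"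
      using i(2) by (intro prod.cong refl) (simp add: s)
    also have "\<dots> = - 1" using i(1) by (simp add: prod.delta)
    finally show ?thesis .
  qed
  ultimately have "diag_act \<beta> (xymonom n a b) = Const (- 1) * xymonom n a b"
    unfolding diag_act_xymonom by (simp add: xymonom_def)
  then have e: "sym_monom n a b = - sym_monom n a b"
    unfolding sym_monom_def
    using symmetrize_diag_act[OF b, of "xymonom n a b"] symmetrize_Const_mult[of n "- 1"]
    by (simp add: Const_minus)
  show ?thesis
  proof (rule poly_mapping_eqI)
    fix m
    have "lookup (sym_monom n a b) m = - lookup (sym_monom n a b) m"
      by (subst e) simp
    then show "lookup (sym_monom n a b) m = lookup 0 m" by simp
  qed
qed

text \<open>A simultaneous permutation of both exponent vectors is the action of a signed permutation without
signs; when the parities match, the action moves monomials without introducing a sign.\<close>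

lemma sym_monom_permute:
  assumes p: "\<pi> permutes {1..n}" and m: "parity_matched n a b"
  shows "sym_monom n (a \<circ> \<pi>) (b \<circ> \<pi>) = sym_monom n a b"
proof -
  have q: "finv \<pi> permutes {1..n}" by (rule permutes_inv[OF p])
  define \<beta> where "\<beta> = make_signed n (finv \<pi>) (\<lambda>_. True)"
  have b: "\<beta> \<in> signed_perms n" unfolding \<beta>_def by (rule make_signed_in[OF q])
  have "xymonom n (a \<circ> \<pi>) (b \<circ> \<pi>) = single (perm_monom n a b (finv \<pi>)) 1"
  proof -
    have "perm_monom n (a \<circ> \<pi>) (b \<circ> \<pi>) id =
      (\<Sum>i=1..n. single (Xvar (finv \<pi> (\<pi> i))) (a (\<pi> i)) + single (Yvar (finv \<pi> (\<pi> i))) (b (\<pi> i)))"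
      by (simp add: perm_monom_def permutes_inverses[OF p])
    also have "\<dots> = perm_monom n a b (finv \<pi>)"
      unfolding perm_monom_def by (rule sum.reindex_bij_betw[OF permutes_imp_bij[OF p]])
    finally show ?thesis by (simp add: xymonom_def)
  qed
  also have "\<dots> = diag_act \<beta> (xymonom n a b)"
    unfolding diag_act_xymonom_matched[OF b m] by (simp add: \<beta>_def sp_abs_make_signed[OF q])
  finally show ?thesis unfolding sym_monom_def using symmetrize_diag_act[OF b] by simp
qed

lemma sp_abs_image: "sp_abs ` signed_perms n = {\<pi>. \<pi> permutes {1..n}}"
proof
  show "sp_abs ` signed_perms n \<subseteq> {\<pi>. \<pi> permutes {1..n}}"
    using sp_abs_permutes by blast
  show "{\<pi>. \<pi> permutes {1..n}} \<subseteq> sp_abs ` signed_perms n"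
  proof
    fix \<pi> assume "\<pi> \<in> {\<pi>. \<pi> permutes {1..n}}"
    then have "make_signed n \<pi> (\<lambda>_. True) \<in> signed_perms n" "sp_abs (make_signed n \<pi> (\<lambda>_. True)) = \<pi>"
      using make_signed_in sp_abs_make_signed by blast+
    then show "\<pi> \<in> sp_abs ` signed_perms n" by (metis imageI)
  qed
qed

text \<open>The group acts on the monomials of the orbit transitively, so all fibres of the map from the group to
the orbit have the same size \<open>c\<close>, the order of the stabilizer.\<close>

lemma sym_monom_orbit_sum:
  assumes m: "parity_matched n a b"
  obtains c where "c > 0" "sym_monom n a b = Const (of_nat c) * orbit_sum n a b"
proof -
  let ?G = "signed_perms n"
  define \<mu> where "\<mu> \<beta> = perm_monom n a b (sp_abs \<beta>)" for \<beta>
  define c where "c = card {\<beta> \<in> ?G. \<mu> \<beta> = \<mu> id}"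
  \<comment> \<open>The monomials \<open>\<mu> \<beta>\<close> are permuted by the group, so equality of two of them is preserved by
    translation; hence the fibre over \<open>\<mu> \<gamma>\<close> is a translate of the stabilizer.\<close>
  have act: "diag_act \<gamma> (single (\<mu> \<beta>) 1) = single (\<mu> (\<gamma> \<circ> \<beta>)) 1" if "\<gamma> \<in> ?G" "\<beta> \<in> ?G" for \<gamma> \<beta>
    unfolding \<mu>_def
    using diag_act_xymonom_matched[OF that(2) m] diag_act_xymonom_matched[OF signed_perms_comp[OF that] m]
      act2_act2[OF that(1) that(1), of \<beta> \<beta> "xymonom n a b"]
    by (simp add: diag_act_def)
  have inj: "\<mu> (\<gamma> \<circ> \<beta>) = \<mu> (\<gamma> \<circ> \<beta>')" if "\<gamma> \<in> ?G" "\<beta> \<in> ?G" "\<beta>' \<in> ?G" "\<mu> \<beta> = \<mu> \<beta>'" for \<gamma> \<beta> \<beta>'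
  proof -
    have "single (\<mu> (\<gamma> \<circ> \<beta>)) (1::rat) = single (\<mu> (\<gamma> \<circ> \<beta>')) 1"
      using act[OF that(1,2)] act[OF that(1,3)] that(4) by simp
    then have "keys (single (\<mu> (\<gamma> \<circ> \<beta>)) (1::rat)) = keys (single (\<mu> (\<gamma> \<circ> \<beta>')) (1::rat))" by simp
    then show ?thesis by simp
  qed
  have fib: "card {\<beta> \<in> ?G. \<mu> \<beta> = \<mu> \<gamma>} = c" if g: "\<gamma> \<in> ?G" for \<gamma>
  proof -
    note ii = signed_perms_inv_apply[OF g]
    have e: "finv \<gamma> \<circ> \<gamma> = id" "\<gamma> \<circ> (finv \<gamma> \<circ> \<beta>) = \<beta>" "finv \<gamma> \<circ> (\<gamma> \<circ> \<beta>) = \<beta>" for \<beta>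
      using ii by (auto simp: fun_eq_iff)
    have "bij_betw (\<lambda>\<beta>. \<gamma> \<circ> \<beta>) {\<beta> \<in> ?G. \<mu> \<beta> = \<mu> id} {\<beta> \<in> ?G. \<mu> \<beta> = \<mu> \<gamma>}"
    proof (rule bij_betwI[where g = "\<lambda>\<beta>. finv \<gamma> \<circ> \<beta>"])
      show "(\<lambda>\<beta>. \<gamma> \<circ> \<beta>) \<in> {\<beta> \<in> ?G. \<mu> \<beta> = \<mu> id} \<rightarrow> {\<beta> \<in> ?G. \<mu> \<beta> = \<mu> \<gamma>}"
      proof
        fix \<beta> assume "\<beta> \<in> {\<beta> \<in> ?G. \<mu> \<beta> = \<mu> id}"
        then have "\<beta> \<in> ?G" "\<mu> \<beta> = \<mu> id" by simp_all
        then have "\<mu> (\<gamma> \<circ> \<beta>) = \<mu> (\<gamma> \<circ> id)" "\<gamma> \<circ> \<beta> \<in> ?G"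
          using inj[OF g _ signed_perms_id] signed_perms_comp[OF g] by blast+
        then show "\<gamma> \<circ> \<beta> \<in> {\<beta> \<in> ?G. \<mu> \<beta> = \<mu> \<gamma>}" by simp
      qed
      show "(\<lambda>\<beta>. finv \<gamma> \<circ> \<beta>) \<in> {\<beta> \<in> ?G. \<mu> \<beta> = \<mu> \<gamma>} \<rightarrow> {\<beta> \<in> ?G. \<mu> \<beta> = \<mu> id}"
      proof
        fix \<beta> assume "\<beta> \<in> {\<beta> \<in> ?G. \<mu> \<beta> = \<mu> \<gamma>}"
        then have "\<beta> \<in> ?G" "\<mu> \<beta> = \<mu> \<gamma>" by simp_all
        then have "\<mu> (finv \<gamma> \<circ> \<beta>) = \<mu> (finv \<gamma> \<circ> \<gamma>)" "finv \<gamma> \<circ> \<beta> \<in> ?G"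
          using inj[OF signed_perms_inv[OF g] _ g] signed_perms_comp[OF signed_perms_inv[OF g]] by blast+
        then show "finv \<gamma> \<circ> \<beta> \<in> {\<beta> \<in> ?G. \<mu> \<beta> = \<mu> id}" by (simp only: e mem_Collect_eq)
      qed
    qed (simp_all add: e)
    from bij_betw_same_card[OF this] show ?thesis by (simp add: c_def)
  qed
  have c: "c > 0"
    unfolding c_def using finite_signed_perms[of n] signed_perms_id[of n] by (auto simp: card_gt_0_iff)
  have "sym_monom n a b = (\<Sum>\<beta>\<in>?G. single (\<mu> \<beta>) 1)"
    unfolding sym_monom_def symmetrize_def \<mu>_def
    by (intro sum.cong refl diag_act_xymonom_matched m)
  also have "\<dots> = (\<Sum>m \<in> \<mu> ` ?G. \<Sum>\<beta> \<in> {\<beta> \<in> ?G. \<mu> \<beta> = m}. single (\<mu> \<beta>) 1)"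
    by (rule sum.image_gen[OF finite_signed_perms])
  also have "\<dots> = (\<Sum>m \<in> \<mu> ` ?G. of_nat c * single m 1)"
  proof (intro sum.cong refl)
    fix m assume "m \<in> \<mu> ` ?G"
    then obtain \<gamma> where "\<gamma> \<in> ?G" "m = \<mu> \<gamma>" by blast
    then have cm: "card {\<beta> \<in> ?G. \<mu> \<beta> = m} = c" using fib by simp
    have "(\<Sum>\<beta> \<in> {\<beta> \<in> ?G. \<mu> \<beta> = m}. single (\<mu> \<beta>) (1::rat)) = (\<Sum>\<beta> \<in> {\<beta> \<in> ?G. \<mu> \<beta> = m}. single m 1)"
      by (intro sum.cong) auto
    also have "\<dots> = of_nat c * single m 1" unfolding sum_constant cm ..
    finally show "(\<Sum>\<beta> \<in> {\<beta> \<in> ?G. \<mu> \<beta> = m}. single (\<mu> \<beta>) (1::rat)) = of_nat c * single m 1" .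
  qed
  also have "\<mu> ` ?G = perm_monom n a b ` {\<pi>. \<pi> permutes {1..n}}"
    unfolding \<mu>_def sp_abs_image[symmetric] by (simp add: image_image)
  finally have "sym_monom n a b = Const (of_nat c) * orbit_sum n a b"
    by (simp add: orbit_sum_def sum_distrib_left Const_of_nat)
  with c show thesis by (rule that)
qed

lemma orbit_sum_eq_sym_monom:
  assumes "parity_matched n a b"
  obtains c where "orbit_sum n a b = Const c * sym_monom n a b"
proof -
  obtain k where k: "k > 0" "sym_monom n a b = Const (of_nat k) * orbit_sum n a b"
    using sym_monom_orbit_sum[OF assms] .
  have "Const (1 / of_nat k) * sym_monom n a b = Const (1 / of_nat k * of_nat k) * orbit_sum n a b"
    unfolding k(2) Const_mult by (simp add: mult.assoc)
  then have "orbit_sum n a b = Const (1 / of_nat k) * sym_monom n a b"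
    using k(1) by simp
  then show thesis by (rule that)
qed

text \<open>Symmetrizing an invariant multiplies it by the order of the group, while symmetrizing it term by term
produces symmetrized monomials.\<close>

lemma diag_invariant_expand:
  assumes "f \<in> diag_invariants n"
  shows "Const (of_nat (card (signed_perms n))) * f =
    (\<Sum>m\<in>keys f. Const (lookup f m) * sym_monom n (\<lambda>i. lookup m (Xvar i)) (\<lambda>i. lookup m (Yvar i)))"
proof -
  have "single m (lookup f m) = Const (lookup f m) * xymonom n (\<lambda>i. lookup m (Xvar i)) (\<lambda>i. lookup m (Yvar i))"
    if "m \<in> keys f" for m
  proof -
    have "keys m \<subseteq> xy_vars n" using assms that unfolding diag_invariants_def xypolys_iff by blast
    from monomial_eq_perm_monom[OF this] show ?thesis
      by (simp add: xymonom_def Const_def mult_single)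
  qed
  then have "f = (\<Sum>m\<in>keys f. Const (lookup f m) * xymonom n (\<lambda>i. lookup m (Xvar i)) (\<lambda>i. lookup m (Yvar i)))"
    using poly_mapping_expand[of f] by simp
  then have "symmetrize n f = symmetrize n (\<Sum>m\<in>keys f. Const (lookup f m) * xymonom n (\<lambda>i. lookup m (Xvar i)) (\<lambda>i. lookup m (Yvar i)))"
    by (rule arg_cong)
  then show ?thesis
    unfolding symmetrize_invariant[OF assms] symmetrize_sum symmetrize_Const_mult sym_monom_def .
qed

section \<open>Elementary symmetric functions of the squares\<close>

text \<open>The elementary symmetric polynomial of degree \<open>k\<close> in the squares of the \<open>x\<^sub>i\<close> or of the \<open>y\<^sub>i\<close>,
according to whether \<open>V\<close> is \<^term>\<open>Xvar\<close> or \<^term>\<open>Yvar\<close>.\<close>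

definition elem_sym_sq :: "nat \<Rightarrow> (nat \<Rightarrow> var) \<Rightarrow> nat \<Rightarrow> xypoly" where
  "elem_sym_sq n V k = (\<Sum>S | S \<subseteq> {1..n} \<and> card S = k. \<Prod>i\<in>S. Var (V i) ^ 2)"

lemma sum_subsets_permute:
  assumes "\<sigma> permutes {1..n}"
  shows "(\<Sum>S | S \<subseteq> {1..n} \<and> card S = k. \<Prod>i\<in>S. F (\<sigma> i)) =
    (\<Sum>S | S \<subseteq> {1..n} \<and> card S = k. \<Prod>i\<in>S. (F i :: 'b :: comm_ring_1))"
proof -
  have inj: "inj \<sigma>" "inj (finv \<sigma>)" using permutes_inj[OF assms] permutes_inj[OF permutes_inv[OF assms]] .
  have im: "\<sigma> ` S \<subseteq> {1..n}" "finv \<sigma> ` S \<subseteq> {1..n}" if "S \<subseteq> {1..n}" for S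
    using that permutes_image[OF assms] permutes_image[OF permutes_inv[OF assms]] by (metis image_mono)+
  have "bij_betw (image \<sigma>) {S. S \<subseteq> {1..n} \<and> card S = k} {S. S \<subseteq> {1..n} \<and> card S = k}"
    by (rule bij_betwI[where g = "image (finv \<sigma>)"])
      (use im inj in \<open>simp_all add: card_image inj_on_subset image_image permutes_inverses[OF assms] Pi_iff\<close>)
  then have "(\<Sum>S | S \<subseteq> {1..n} \<and> card S = k. \<Prod>i\<in>S. F i) =
      (\<Sum>S | S \<subseteq> {1..n} \<and> card S = k. \<Prod>i\<in>\<sigma> ` S. F i)"
    by (rule sum.reindex_bij_betw[symmetric])
  then show ?thesis
    by (simp add: prod.reindex[OF inj_on_subset[OF inj(1)]])
qed

lemma elem_sym_sq_in:
  assumes V: "V = Xvar \<or> V = Yvar"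
  shows "elem_sym_sq n V k \<in> bi_invariants n"
proof -
  have inv: "act2 \<beta> \<gamma> (elem_sym_sq n V k) = elem_sym_sq n V k" if g: "\<beta> \<in> signed_perms n" "\<gamma> \<in> signed_perms n" for \<beta> \<gamma>
  proof -
    define \<sigma> where "\<sigma> = (if V = Xvar then sp_abs \<beta> else sp_abs \<gamma>)"
    have s: "\<sigma> permutes {1..n}" using sp_abs_permutes g by (simp add: \<sigma>_def)
    have ne: "Xvar \<noteq> Yvar" by (metis var.distinct(1))
    have sq: "Const (of_int (sgn (\<delta> (int i)))) ^ 2 = 1" if "\<delta> \<in> signed_perms n" "i \<in> {1..n}" for \<delta> i
      using signed_perms_nonzero[OF that] by (simp add: sgn_if Const_minus)
    have "act2 \<beta> \<gamma> (Var (V i) ^ 2) = Var (V (\<sigma> i)) ^ 2" if i: "i \<in> {1..n}" for i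
      using V ne sq[OF g(1) i] sq[OF g(2) i]
      by (auto simp: act2_power act2_Var power_mult_distrib \<sigma>_def)
    then have "act2 \<beta> \<gamma> (elem_sym_sq n V k) = (\<Sum>S | S \<subseteq> {1..n} \<and> card S = k. \<Prod>i\<in>S. Var (V (\<sigma> i)) ^ 2)"
      unfolding elem_sym_sq_def act2_sum act2_prod by (intro sum.cong prod.cong refl) blast
    also have "\<dots> = elem_sym_sq n V k"
      unfolding elem_sym_sq_def by (rule sum_subsets_permute[OF s, where F = "\<lambda>i. Var (V i) ^ 2"])
    finally show ?thesis .
  qed
  have "V i \<in> xy_vars n" if "i \<in> {1..n}" for i using V that by blast
  then have "elem_sym_sq n V k \<in> xypolys n"
    unfolding elem_sym_sq_def
    by (intro xypolys_sum xypolys_prod xypolys_power xypolys_Var) blast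
  with inv show ?thesis by (simp add: bi_invariants_def)
qed

definition raise_two :: "nat set \<Rightarrow> (nat \<Rightarrow> nat) \<Rightarrow> nat \<Rightarrow> nat" where
  "raise_two S a i = (if i \<in> S then a i + 2 else a i)"

lemma xymonom_raise:
  assumes "S \<subseteq> {1..n}"
  shows "xymonom n (raise_two S a) b = (\<Prod>i\<in>S. Var (Xvar i) ^ 2) * xymonom n a b"
    and "xymonom n a (raise_two S b) = (\<Prod>i\<in>S. Var (Yvar i) ^ 2) * xymonom n a b"
proof -
  have p: "(\<Prod>i=1..n. if i \<in> S then F i else (1::xypoly)) = (\<Prod>i\<in>S. F i)" for F
    using assms by (subst prod.inter_restrict[symmetric]) (simp_all add: Int_absorb1)
  have "xymonom n (raise_two S a) b = (\<Prod>i=1..n. (if i \<in> S then Var (Xvar i) ^ 2 else 1) *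
      (Var (Xvar i) ^ a i * Var (Yvar i) ^ b i))"
    unfolding xymonom_prod by (intro prod.cong refl) (simp add: raise_two_def power_add power2_eq_square mult_ac)
  then show "xymonom n (raise_two S a) b = (\<Prod>i\<in>S. Var (Xvar i) ^ 2) * xymonom n a b"
    by (simp only: prod.distrib p xymonom_prod)
  have "xymonom n a (raise_two S b) = (\<Prod>i=1..n. (if i \<in> S then Var (Yvar i) ^ 2 else 1) *
      (Var (Xvar i) ^ a i * Var (Yvar i) ^ b i))"
    unfolding xymonom_prod by (intro prod.cong refl) (simp add: raise_two_def power_add power2_eq_square mult_ac)
  then show "xymonom n a (raise_two S b) = (\<Prod>i\<in>S. Var (Yvar i) ^ 2) * xymonom n a b"
    by (simp only: prod.distrib p xymonom_prod)
qed

text \<open>Since the elementary symmetric function is bi-invariant, the product can be taken inside the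
symmetrization, where each of its terms raises the exponents on one set of positions.\<close>

lemma elem_sym_sq_mult:
  "elem_sym_sq n Xvar k * sym_monom n a b = (\<Sum>S | S \<subseteq> {1..n} \<and> card S = k. sym_monom n (raise_two S a) b)"
  "elem_sym_sq n Yvar k * sym_monom n a b = (\<Sum>S | S \<subseteq> {1..n} \<and> card S = k. sym_monom n a (raise_two S b))"
proof -
  have e: "Xvar = Xvar \<or> Xvar = Yvar" "Yvar = Xvar \<or> Yvar = Yvar" by simp_all
  show "elem_sym_sq n Xvar k * sym_monom n a b = (\<Sum>S | S \<subseteq> {1..n} \<and> card S = k. sym_monom n (raise_two S a) b)"
    "elem_sym_sq n Yvar k * sym_monom n a b = (\<Sum>S | S \<subseteq> {1..n} \<and> card S = k. sym_monom n a (raise_two S b))"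
    unfolding sym_monom_def symmetrize_mult[OF elem_sym_sq_in[OF e(1)], symmetric]
      symmetrize_mult[OF elem_sym_sq_in[OF e(2)], symmetric]
    by (simp_all add: elem_sym_sq_def sum_distrib_right xymonom_raise symmetrize_sum)
qed

lemma bihomogeneous_orbit_sum: "bihomogeneous n (\<Sum>i=1..n. a i) (\<Sum>i=1..n. b i) (orbit_sum n a b)"
  unfolding bihomogeneous_def
proof
  fix m assume "m \<in> keys (orbit_sum n a b)"
  then obtain \<pi> where p: "\<pi> permutes {1..n}" and m: "m = perm_monom n a b \<pi>"
    using keys_sum[of "\<lambda>m. single m (1::rat)" "perm_monom n a b ` {\<pi>. \<pi> permutes {1..n}}"]
    unfolding orbit_sum_def by fastforce
  have s: "(\<Sum>i=1..n. lookup m (V i)) = (\<Sum>i=1..n. lookup m (V (\<pi> i)))" for V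
    by (rule sum.reindex_bij_betw[OF permutes_imp_bij[OF p], symmetric])
  show "(\<Sum>i=1..n. lookup m (Xvar i)) = (\<Sum>i=1..n. a i) \<and> (\<Sum>i=1..n. lookup m (Yvar i)) = (\<Sum>i=1..n. b i)"
    unfolding s[of Xvar] s[of Yvar] unfolding m by (intro conjI sum.cong refl lookup_perm_monom[OF p])
qed

section \<open>The module spanned by the descent orbit sums\<close>

lemma sp_abs_eq_iff: "\<beta> \<in> signed_perms n \<Longrightarrow> sp_abs \<beta> i = sp_abs \<beta> j \<longleftrightarrow> i = j"
  using permutes_inj[OF sp_abs_permutes] by (auto dest: injD)

text \<open>The sign of \<open>\<beta>\<close> at \<open>i\<close> is the sign of its inverse at \<open>|\<beta>(i)|\<close>; this is why the two exponent
vectors of \<open>M\<^sub>\<beta>\<close> have matching parities.\<close>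

lemma inv_pos_iff:
  assumes b: "\<beta> \<in> signed_perms n"
  shows "finv \<beta> (int (sp_abs \<beta> i)) > 0 \<longleftrightarrow> \<beta> (int i) > 0"
proof -
  note inv = signed_perms_inv[OF b]
  consider "\<beta> (int i) = 0" | "\<beta> (int i) > 0" | "\<beta> (int i) < 0" by linarith
  then show ?thesis
  proof cases
    case 1
    then show ?thesis by (simp add: int_sp_abs signed_perms_zero[OF inv])
  next
    case 2
    then have "int (sp_abs \<beta> i) = \<beta> (int i)" by (simp add: int_sp_abs)
    moreover have "i \<noteq> 0" using 2 signed_perms_zero[OF b] by (intro notI) simp
    ultimately show ?thesis using 2 by (simp add: signed_perms_inv_apply[OF b])
  next
    case 3
    then have "int (sp_abs \<beta> i) = - \<beta> (int i)" by (simp add: int_sp_abs)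
    then show ?thesis using 3 signed_perms_odd[OF inv, of "\<beta> (int i)"]
      by (simp add: signed_perms_inv_apply[OF b])
  qed
qed

lemma parity_matched_gvec:
  assumes b: "\<beta> \<in> signed_perms n"
  shows "parity_matched n (gvec n \<beta>) (gvec_tilde n \<beta>)"
  by (simp add: parity_matched_def gvec_def gvec_tilde_def eta_def inv_pos_iff[OF b])

text \<open>The module generated by the polynomials \<open>M\<^sub>\<beta>\<close> over the ring of bi-invariants.\<close>

definition module_span :: "nat \<Rightarrow> xypoly set" where
  "module_span n = {(\<Sum>\<beta>\<in>signed_perms n. h \<beta> * Mpoly n \<beta>) | h. \<forall>\<beta>\<in>signed_perms n. h \<beta> \<in> bi_invariants n}"

lemma module_spanI: "(\<And>\<beta>. \<beta> \<in> signed_perms n \<Longrightarrow> h \<beta> \<in> bi_invariants n) \<Longrightarrow>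
    (\<Sum>\<beta>\<in>signed_perms n. h \<beta> * Mpoly n \<beta>) \<in> module_span n"
  unfolding module_span_def by blast

lemma module_spanE:
  assumes "f \<in> module_span n"
  obtains h where "\<And>\<beta>. \<beta> \<in> signed_perms n \<Longrightarrow> h \<beta> \<in> bi_invariants n"
    "f = (\<Sum>\<beta>\<in>signed_perms n. h \<beta> * Mpoly n \<beta>)"
  using assms unfolding module_span_def by blast

lemma module_span_mult:
  assumes "g \<in> bi_invariants n" "f \<in> module_span n"
  shows "g * f \<in> module_span n"
proof -
  obtain h where h: "\<And>\<beta>. \<beta> \<in> signed_perms n \<Longrightarrow> h \<beta> \<in> bi_invariants n"
    "f = (\<Sum>\<beta>\<in>signed_perms n. h \<beta> * Mpoly n \<beta>)" using assms(2) by (rule module_spanE) blast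
  have "g * f = (\<Sum>\<beta>\<in>signed_perms n. (g * h \<beta>) * Mpoly n \<beta>)"
    by (simp add: h(2) sum_distrib_left mult.assoc)
  then show ?thesis using module_spanI[of n "\<lambda>\<beta>. g * h \<beta>"] assms(1) h(1)
    by (simp add: bi_invariants_closed)
qed

lemma module_span_add:
  assumes "f \<in> module_span n" "g \<in> module_span n"
  shows "f + g \<in> module_span n"
proof -
  obtain h where h: "\<And>\<beta>. \<beta> \<in> signed_perms n \<Longrightarrow> h \<beta> \<in> bi_invariants n"
    "f = (\<Sum>\<beta>\<in>signed_perms n. h \<beta> * Mpoly n \<beta>)" using assms(1) by (rule module_spanE) blast
  obtain k where k: "\<And>\<beta>. \<beta> \<in> signed_perms n \<Longrightarrow> k \<beta> \<in> bi_invariants n"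
    "g = (\<Sum>\<beta>\<in>signed_perms n. k \<beta> * Mpoly n \<beta>)" using assms(2) by (rule module_spanE) blast
  have "f + g = (\<Sum>\<beta>\<in>signed_perms n. (h \<beta> + k \<beta>) * Mpoly n \<beta>)"
    by (simp add: h(2) k(2) sum.distrib distrib_right)
  then show ?thesis using module_spanI[of n "\<lambda>\<beta>. h \<beta> + k \<beta>"] h(1) k(1)
    by (simp add: bi_invariants_closed)
qed

lemma module_span_zero: "0 \<in> module_span n"
  using module_spanI[of n "\<lambda>_. 0"] bi_invariants_closed(1)[of 0 n] by simp

lemma module_span_sum: "(\<And>i. i \<in> I \<Longrightarrow> f i \<in> module_span n) \<Longrightarrow> sum f I \<in> module_span n"
  by (induction I rule: infinite_finite_induct) (auto intro: module_span_zero module_span_add)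

lemma module_span_Const_mult: "f \<in> module_span n \<Longrightarrow> Const c * f \<in> module_span n"
  by (intro module_span_mult bi_invariants_closed)

lemma module_span_diff: "f \<in> module_span n \<Longrightarrow> g \<in> module_span n \<Longrightarrow> f - g \<in> module_span n"
  using module_span_add[OF _ module_span_Const_mult[of g n "- 1"], of f] by (simp add: Const_minus)

lemma Mpoly_module_span:
  assumes "\<beta> \<in> signed_perms n"
  shows "Mpoly n \<beta> \<in> module_span n"
proof -
  have "(\<Sum>\<gamma>\<in>signed_perms n. Const (if \<gamma> = \<beta> then 1 else 0) * Mpoly n \<gamma>) = 
        (\<Sum>\<gamma>\<in>signed_perms n. if \<gamma> = \<beta> then Mpoly n \<gamma> else 0)"
    by (intro sum.cong) auto
  then show ?thesis using assms finite_signed_perms[of n]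
      module_spanI[of n "\<lambda>\<gamma>. Const (if \<gamma> = \<beta> then 1 else 0)", OF bi_invariants_closed(1)]
    by simp
qed

section \<open>The straightening step\<close>

text \<open>If \<open>T\<close> consists of the largest elements of \<open>X\<close> for the lexicographic order by \<open>(u, v)\<close>, then every
subset of the same size has a smaller \<open>u\<close>-sum, or the same \<open>u\<close>-sum and a smaller \<open>v\<close>-sum, unless
it differs from \<open>T\<close> only by exchanging elements with equal \<open>(u, v)\<close>.  To see this, match \<open>S - T\<close>
bijectively with \<open>T - S\<close>: each element is matched with one that is at least as large, and equality of
the sums forces equality for every matched pair.\<close>

lemma top_subset:
  fixes u v :: "nat \<Rightarrow> nat"
  assumes X: "finite X" "S \<subseteq> X" "T \<subseteq> X" and card: "card S = card T"
    and top: "\<And>i j. i \<in> X - T \<Longrightarrow> j \<in> T \<Longrightarrow> u i < u j \<or> u i = u j \<and> v i \<le> v j"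
  shows "sum u S < sum u T \<or> sum u S = sum u T \<and> sum v S < sum v T \<or>
    (\<exists>\<pi>. \<pi> permutes X \<and> u \<circ> \<pi> = u \<and> v \<circ> \<pi> = v \<and> (\<forall>i. \<pi> i \<in> T \<longleftrightarrow> i \<in> S))"
proof -
  have fin: "finite S" "finite T" using X finite_subset by blast+
  have "card (S - T) = card (T - S)"
    using card fin card_Diff_subset_Int[of S T] card_Diff_subset_Int[of T S]
    by (simp add: Int_commute)
  then obtain \<phi> where \<phi>: "bij_betw \<phi> (S - T) (T - S)"
    using finite_same_card_bij[of "S - T" "T - S"] fin by auto
  have \<phi>_in: "\<phi> i \<in> T - S" if "i \<in> S - T" for i using \<phi> that by (rule bij_betw_apply)
  have uv: "u i < u (\<phi> i) \<or> u i = u (\<phi> i) \<and> v i \<le> v (\<phi> i)" if "i \<in> S - T" for i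
    using top[of i "\<phi> i"] \<phi>_in[OF that] that X(2) by blast
  have split: "sum w S = sum w (S - T) + sum w (S \<inter> T)" "sum w T = (\<Sum>i\<in>S - T. w (\<phi> i)) + sum w (S \<inter> T)"
    for w :: "nat \<Rightarrow> nat"
  proof -
    show "sum w S = sum w (S - T) + sum w (S \<inter> T)"
      using sum.Int_Diff[OF fin(1), of w T] by simp
    show "sum w T = (\<Sum>i\<in>S - T. w (\<phi> i)) + sum w (S \<inter> T)"
      using sum.Int_Diff[OF fin(2), of w S] sum.reindex_bij_betw[OF \<phi>, of w] by (simp add: Int_commute)
  qed
  have ule: "u i \<le> u (\<phi> i)" if "i \<in> S - T" for i using uv[OF that] by linarith
  then have le: "sum u (S - T) \<le> (\<Sum>i\<in>S - T. u (\<phi> i))" by (rule sum_mono)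
  show ?thesis
  proof (cases "sum u (S - T) = (\<Sum>i\<in>S - T. u (\<phi> i))")
    case False
    then show ?thesis using le split[of u] by linarith
  next
    case u_eq: True
    have ueq: "u i = u (\<phi> i)" if "i \<in> S - T" for i
    proof (rule ccontr)
      assume "u i \<noteq> u (\<phi> i)"
      then have "sum u (S - T) < (\<Sum>i\<in>S - T. u (\<phi> i))"
        using ule that fin by (intro sum_strict_mono_ex1) (auto intro: le_neq_trans)
      then show False using u_eq by simp
    qed
    have vle: "v i \<le> v (\<phi> i)" if "i \<in> S - T" for i using uv[OF that] ueq[OF that] by simp
    then have le': "sum v (S - T) \<le> (\<Sum>i\<in>S - T. v (\<phi> i))" by (rule sum_mono)
    show ?thesis
    proof (cases "sum v (S - T) = (\<Sum>i\<in>S - T. v (\<phi> i))")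
      case False
      then show ?thesis using le' u_eq split[of v] split[of u] by linarith
    next
      case v_eq: True
      have veq: "v i = v (\<phi> i)" if "i \<in> S - T" for i
      proof (rule ccontr)
        assume "v i \<noteq> v (\<phi> i)"
        then have "sum v (S - T) < (\<Sum>i\<in>S - T. v (\<phi> i))"
          using vle that fin by (intro sum_strict_mono_ex1) (auto intro: le_neq_trans)
        then show False using v_eq by simp
      qed
      \<comment> \<open>The exchanging permutation is the involution swapping \<open>S - T\<close> and \<open>T - S\<close> along \<open>\<phi>\<close>.\<close>
      define \<psi> where "\<psi> = the_inv_into (S - T) \<phi>"
      have inj: "inj_on \<phi> (S - T)" using \<phi> by (rule bij_betw_imp_inj_on)
      have \<psi>\<phi>: "\<psi> (\<phi> i) = i" if "i \<in> S - T" for i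
        unfolding \<psi>_def using inj that by (rule the_inv_into_f_f)
      have surj: "\<exists>i\<in>S - T. j = \<phi> i" if "j \<in> T - S" for j
        using that bij_betw_imp_surj_on[OF \<phi>] by blast
      have \<psi>: "\<psi> j \<in> S - T \<and> \<phi> (\<psi> j) = j" if "j \<in> T - S" for j
        using surj[OF that] \<psi>\<phi> by auto
      define \<pi> where "\<pi> i = (if i \<in> S - T then \<phi> i else if i \<in> T - S then \<psi> i else i)" for i
      have invol: "\<pi> (\<pi> i) = i" for i
        using \<phi>_in[of i] \<psi>[of i] \<psi>\<phi>[of i] unfolding \<pi>_def by auto
      have "\<pi> permutes X"
      proof (rule bij_imp_permutes)
        have "\<pi> i \<in> X" if "i \<in> X" for i
          using \<phi>_in[of i] \<psi>[of i] that X unfolding \<pi>_def by auto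
        then show "bij_betw \<pi> X X"
          by (intro bij_betwI[where g = \<pi>]) (auto simp: invol)
        show "\<pi> i = i" if "i \<notin> X" for i using that X unfolding \<pi>_def by auto
      qed
      moreover have "w \<circ> \<pi> = w" if "\<And>i. i \<in> S - T \<Longrightarrow> w i = w (\<phi> i)" for w :: "nat \<Rightarrow> nat"
      proof
        fix i
        have "i \<in> T - S \<Longrightarrow> w (\<psi> i) = w i" using that[of "\<psi> i"] \<psi>[of i] by simp
        then show "(w \<circ> \<pi>) i = w i" using that[of i] unfolding \<pi>_def by auto
      qed
      then have "u \<circ> \<pi> = u" "v \<circ> \<pi> = v" using ueq veq by blast+
      moreover have "\<forall>i. \<pi> i \<in> T \<longleftrightarrow> i \<in> S"
        using \<phi>_in \<psi> unfolding \<pi>_def by auto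
      ultimately show ?thesis by blast
    qed
  qed
qed

text \<open>The two components of the straightening order.  The sum of squares grows most when the largest
exponents of one kind are raised; among equal exponents of that kind, \<open>\<Sum> a\<^sub>i b\<^sub>i\<close> detects whether
those paired with the largest exponents of the other kind were chosen.  Both are symmetric in \<open>a\<close>
and \<open>b\<close>, so the same order serves the straightening in the \<open>x\<close> and in the \<open>y\<close> variables.\<close>

definition sq_weight :: "nat \<Rightarrow> (nat \<Rightarrow> nat) \<Rightarrow> (nat \<Rightarrow> nat) \<Rightarrow> nat" where
  "sq_weight n a b = (\<Sum>i=1..n. a i ^ 2 + b i ^ 2)"

definition corr_weight :: "nat \<Rightarrow> (nat \<Rightarrow> nat) \<Rightarrow> (nat \<Rightarrow> nat) \<Rightarrow> nat" where
  "corr_weight n a b = (\<Sum>i=1..n. a i * b i)"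

definition lighter :: "nat \<Rightarrow> (nat \<Rightarrow> nat) \<Rightarrow> (nat \<Rightarrow> nat) \<Rightarrow> (nat \<Rightarrow> nat) \<Rightarrow> (nat \<Rightarrow> nat) \<Rightarrow> bool" where
  "lighter n a' b' a b \<longleftrightarrow> sq_weight n a' b' < sq_weight n a b \<or>
     sq_weight n a' b' = sq_weight n a b \<and> corr_weight n a' b' < corr_weight n a b"

lemma lighter_swap: "lighter n b' a' b a \<longleftrightarrow> lighter n a' b' a b"
  by (simp add: lighter_def sq_weight_def corr_weight_def add.commute mult.commute)

lemma weight_permute:
  assumes "\<pi> permutes {1..n}"
  shows "sq_weight n (a \<circ> \<pi>) (b \<circ> \<pi>) = sq_weight n a b"
    "corr_weight n (a \<circ> \<pi>) (b \<circ> \<pi>) = corr_weight n a b"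
  unfolding sq_weight_def corr_weight_def o_def
  by (rule sum.reindex_bij_betw[OF permutes_imp_bij[OF assms]])+

lemma sum_indicator_subset:
  fixes f :: "nat \<Rightarrow> nat"
  assumes "S \<subseteq> {1..n}"
  shows "(\<Sum>i=1..n. if i \<in> S then f i else 0) = sum f S"
  using assms by (subst sum.inter_restrict[symmetric]) (simp_all add: Int_absorb1)

lemma sq_weight_raise:
  assumes "S \<subseteq> {1..n}"
  shows "sq_weight n (raise_two S u) v = sq_weight n u v + 4 * sum u S + 4 * card S"
proof -
  have "sq_weight n (raise_two S u) v = (\<Sum>i=1..n. (u i ^ 2 + v i ^ 2) + (if i \<in> S then 4 * u i + 4 else 0))"
    unfolding sq_weight_def
    by (intro sum.cong) (auto simp: raise_two_def power2_eq_square algebra_simps)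
  also have "\<dots> = sq_weight n u v + (\<Sum>i\<in>S. 4 * u i + 4)"
    using sum_indicator_subset[OF assms] by (simp only: sum.distrib sq_weight_def)
  also have "(\<Sum>i\<in>S. 4 * u i + 4) = 4 * sum u S + 4 * card S"
    by (simp add: sum.distrib sum_distrib_left)
  finally show ?thesis by simp
qed

lemma corr_weight_raise:
  assumes "S \<subseteq> {1..n}"
  shows "corr_weight n (raise_two S u) v = corr_weight n u v + 2 * sum v S"
proof -
  have "corr_weight n (raise_two S u) v = (\<Sum>i=1..n. u i * v i + (if i \<in> S then 2 * v i else 0))"
    unfolding corr_weight_def by (intro sum.cong) (auto simp: raise_two_def algebra_simps)
  also have "\<dots> = corr_weight n u v + 2 * sum v S"
    using sum_indicator_subset[OF assms] by (simp only: sum.distrib corr_weight_def sum_distrib_left)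
  finally show ?thesis .
qed

text \<open>Let \<open>w\<close> be \<open>u\<close> lowered by \<open>2\<close> on \<open>T\<close>, where \<open>T\<close> holds the lexicographically largest pairs of
\<open>(w, v)\<close>.  In the product of \<open>N w v\<close> with the elementary symmetric function of degree \<open>|T|\<close>, the
terms are indexed by the sets \<open>S\<close> of size \<open>|T|\<close>.  By \<open>top_subset\<close> each of them is lighter than
\<open>N u v\<close> or equal to it, and \<open>S = T\<close> gives \<open>N u v\<close> itself; so \<open>N u v\<close> can be solved for.  The lemma
is stated for an abstract family \<open>N\<close> because it is used for both orders of the two kinds of
variables.\<close>

lemma straighten_step:
  fixes N :: "(nat \<Rightarrow> nat) \<Rightarrow> (nat \<Rightarrow> nat) \<Rightarrow> xypoly"
  assumes perm: "\<And>\<pi> u v. \<pi> permutes {1..n} \<Longrightarrow> parity_matched n u v \<Longrightarrow> N (u \<circ> \<pi>) (v \<circ> \<pi>) = N u v"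
    and mult: "\<And>k u v. e k * N u v = (\<Sum>S | S \<subseteq> {1..n} \<and> card S = k. N (raise_two S u) v)"
    and e: "\<And>k. e k \<in> bi_invariants n"
    and IH: "\<And>u' v'. parity_matched n u' v' \<Longrightarrow> lighter n u' v' u v \<Longrightarrow> N u' v' \<in> module_span n"
    and uv: "parity_matched n u v"
    and T: "T \<subseteq> {1..n}" "T \<noteq> {}" "\<And>j. j \<in> T \<Longrightarrow> 2 \<le> u j"
    and top: "\<And>i j. i \<in> {1..n} - T \<Longrightarrow> j \<in> T \<Longrightarrow> u i < u j - 2 \<or> u i = u j - 2 \<and> v i \<le> v j"
  shows "N u v \<in> module_span n"
proof -
  define w where "w i = (if i \<in> T then u i - 2 else u i)" for i
  \<comment> \<open>The subtraction is not truncated, as \<open>u\<close> is at least \<open>2\<close> on \<open>T\<close>.\<close>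
  have uw: "u = raise_two T w"
  proof
    show "u i = raise_two T w i" for i using T(3)[of i] by (cases "i \<in> T") (simp_all add: w_def raise_two_def)
  qed
  have pm: "parity_matched n (raise_two S w) v" for S
  proof -
    have "even (raise_two S w i) \<longleftrightarrow> even (u i)" for i
      unfolding uw by (simp add: raise_two_def)
    then show ?thesis using uv by (simp add: parity_matched_def)
  qed
  have pm_w: "parity_matched n w v"
    using pm[of "{}"] by (simp add: raise_two_def[abs_def])
  \<comment> \<open>\<open>Eq\<close> collects all sets whose term equals \<open>N u v\<close>; its size, the coefficient of \<open>N u v\<close> in the
    product, is nonzero because it contains \<open>T\<close>.\<close>
  define \<S> where "\<S> = {S. S \<subseteq> {1..n} \<and> card S = card T}"
  define Eq where "Eq = {S \<in> \<S>. N (raise_two S w) v = N u v}"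
  have fin: "finite \<S>" unfolding \<S>_def by simp
  have T_in: "T \<in> Eq" using T(1) uw by (simp add: Eq_def \<S>_def)
  have fin_T: "finite T" using T(1) finite_subset by blast
  have "sq_weight n w v < sq_weight n u v"
    using T(2) fin_T unfolding uw sq_weight_raise[OF T(1)] by (simp add: card_gt_0_iff)
  then have "N w v \<in> module_span n" by (intro IH pm_w) (simp add: lighter_def)
  then have prod: "e (card T) * N w v \<in> module_span n" by (rule module_span_mult[OF e])
  have low: "N (raise_two S w) v \<in> module_span n" if S: "S \<in> \<S> - Eq" for S
  proof -
    have SX: "S \<subseteq> {1..n}" "card S = card T" using S by (auto simp: \<S>_def)
    have top_w: "w i < w j \<or> w i = w j \<and> v i \<le> v j" if "i \<in> {1..n} - T" "j \<in> T" for i j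
      using top[OF that] that by (simp add: w_def)
    have "finite {1..n}" by simp
    from top_subset[where u = w and v = v, OF this SX(1) T(1) SX(2) top_w]
    consider "sum w S < sum w T \<or> sum w S = sum w T \<and> sum v S < sum v T"
      | \<pi> where "\<pi> permutes {1..n}" "w \<circ> \<pi> = w" "v \<circ> \<pi> = v" "\<forall>i. \<pi> i \<in> T \<longleftrightarrow> i \<in> S"
      by blast
    then show ?thesis
    proof cases
      case 1
      then have "lighter n (raise_two S w) v u v"
        unfolding uw lighter_def sq_weight_raise[OF T(1)] sq_weight_raise[OF SX(1)]
          corr_weight_raise[OF T(1)] corr_weight_raise[OF SX(1)] SX(2) by linarith
      then show ?thesis by (intro IH pm)
    next
      case 2
      have "w (\<pi> i) = w i" for i using 2(2) by (metis o_apply)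
      then have "raise_two S w = u \<circ> \<pi>" unfolding uw raise_two_def using 2(4) by (auto simp: fun_eq_iff)
      then have "N (raise_two S w) v = N (u \<circ> \<pi>) (v \<circ> \<pi>)" by (simp only: 2(3))
      then have "N (raise_two S w) v = N u v" using perm[OF 2(1) uv] by simp
      then show ?thesis using S by (simp add: Eq_def)
    qed
  qed
  have "e (card T) * N w v = (\<Sum>S\<in>\<S> - Eq. N (raise_two S w) v) + (\<Sum>S\<in>Eq. N (raise_two S w) v)"
    unfolding mult \<S>_def[symmetric] using fin by (intro sum.subset_diff) (auto simp: Eq_def)
  also have "(\<Sum>S\<in>Eq. N (raise_two S w) v) = (\<Sum>S\<in>Eq. N u v)"
    by (intro sum.cong refl) (simp add: Eq_def)
  also have "\<dots> = Const (of_nat (card Eq)) * N u v" by (simp add: Const_of_nat)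
  finally have "Const (of_nat (card Eq)) * N u v = e (card T) * N w v - (\<Sum>S\<in>\<S> - Eq. N (raise_two S w) v)"
    by simp
  then have "Const (of_nat (card Eq)) * N u v \<in> module_span n"
    using prod low by (simp only: module_span_diff module_span_sum)
  then have "Const (1 / of_nat (card Eq)) * (Const (of_nat (card Eq)) * N u v) \<in> module_span n"
    by (rule module_span_Const_mult)
  moreover have "card Eq > 0" using T_in fin by (auto simp: card_gt_0_iff Eq_def)
  ultimately show ?thesis by (simp flip: mult.assoc Const_mult)
qed

section \<open>Sorting exponents into a signed permutation\<close>

text \<open>The vector \<open>a\<close> is weakly increasing, its ties are compatible with \<open>\<beta>\<close>, and its parities are the signs of
\<open>\<beta>\<close>.  The vector \<^term>\<open>gvec n \<beta>\<close> has this property, and it is the smallest one that does.\<close>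

definition sorts :: "nat \<Rightarrow> (int \<Rightarrow> int) \<Rightarrow> (nat \<Rightarrow> nat) \<Rightarrow> bool" where
  "sorts n \<beta> a \<longleftrightarrow> (\<forall>i\<in>{1..n}. odd (a i) \<longleftrightarrow> \<beta> (int i) > 0) \<and>
     (\<forall>i\<in>{1..n}. \<forall>j\<in>{1..n}. i < j \<longrightarrow> a i < a j \<or> a i = a j \<and> sp_abs \<beta> i < sp_abs \<beta> j)"

lemma gvec_Suc:
  assumes i: "i \<in> {1..<n}"
  shows "gvec n \<beta> (Suc i) + eta \<beta> i = gvec n \<beta> i + eta \<beta> (Suc i) +
    (if prec (\<beta> (int (Suc i))) (\<beta> (int i)) then 2 else 0)"
proof -
  have "{j \<in> Des n \<beta>. j < Suc i} = (if i \<in> Des n \<beta> then insert i {j \<in> Des n \<beta>. j < i} else {j \<in> Des n \<beta>. j < i})"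
    by (auto simp: less_Suc_eq)
  moreover have "finite {j \<in> Des n \<beta>. j < i}" by (simp add: Des_def)
  ultimately have "delta n \<beta> (Suc i) = delta n \<beta> i + (if i \<in> Des n \<beta> then 1 else 0)"
    unfolding delta_def by simp
  moreover have "i \<in> Des n \<beta> \<longleftrightarrow> prec (\<beta> (int (Suc i))) (\<beta> (int i))"
    using i by (simp add: Des_def)
  ultimately show ?thesis by (simp add: gvec_def)
qed

lemma gvec_one: "gvec n \<beta> 1 = eta \<beta> 1"
proof -
  have "{j \<in> Des n \<beta>. j < 1} = {}" by (auto simp: Des_def)
  then show ?thesis by (simp add: gvec_def delta_def)
qed

lemma odd_gvec_iff: "odd (gvec n \<beta> i) \<longleftrightarrow> \<beta> (int i) > 0"
  by (simp add: gvec_def eta_def)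

text \<open>Without a descent two neighbours of the same sign have increasing absolute values, because both the
negative and the positive numbers are ordered by absolute value.\<close>

lemma gvec_Suc_mono:
  assumes b: "\<beta> \<in> signed_perms n" and i: "i \<in> {1..<n}"
  shows "gvec n \<beta> i < gvec n \<beta> (Suc i) \<or>
    gvec n \<beta> i = gvec n \<beta> (Suc i) \<and> sp_abs \<beta> i < sp_abs \<beta> (Suc i)"
proof -
  have nz: "\<beta> (int i) \<noteq> 0" "\<beta> (int (Suc i)) \<noteq> 0"
    using i signed_perms_nonzero[OF b, of i] signed_perms_nonzero[OF b, of "Suc i"] by auto
  have "sp_abs \<beta> i \<noteq> sp_abs \<beta> (Suc i)" using sp_abs_eq_iff[OF b] by simp
  then show ?thesis
    using gvec_Suc[OF i, of \<beta>] nz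
    by (auto simp: eta_def prec_def sp_abs_def split: if_splits)
qed

text \<open>At a descent between entries of the same sign, \<open>a\<close> cannot be constant, and by parity it grows by at
least \<open>2\<close>; where the sign changes, \<^term>\<open>gvec n \<beta>\<close> grows by \<open>1\<close> in either direction, and the parity of \<open>a\<close>
changes too.\<close>

lemma sorts_gvec_Suc:
  assumes b: "\<beta> \<in> signed_perms n" and a: "sorts n \<beta> a" and i: "i \<in> {1..<n}"
  shows "a i + gvec n \<beta> (Suc i) \<le> a (Suc i) + gvec n \<beta> i"
proof -
  have nz: "\<beta> (int i) \<noteq> 0" "\<beta> (int (Suc i)) \<noteq> 0"
    using i signed_perms_nonzero[OF b, of i] signed_perms_nonzero[OF b, of "Suc i"] by auto
  have odd: "odd (a i) \<longleftrightarrow> \<beta> (int i) > 0" "odd (a (Suc i)) \<longleftrightarrow> \<beta> (int (Suc i)) > 0"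
    and le: "a i < a (Suc i) \<or> a i = a (Suc i) \<and> sp_abs \<beta> i < sp_abs \<beta> (Suc i)"
    using a i unfolding sorts_def by auto
  have two: "a i + 2 \<le> a (Suc i)" if "a i < a (Suc i)" "odd (a i) = odd (a (Suc i))"
    using that by presburger
  show ?thesis
  proof (cases "(\<beta> (int i) > 0) = (\<beta> (int (Suc i)) > 0)")
    case True
    then have eta: "eta \<beta> i = eta \<beta> (Suc i)" by (simp add: eta_def)
    show ?thesis
    proof (cases "prec (\<beta> (int (Suc i))) (\<beta> (int i))")
      case True
      then have "sp_abs \<beta> (Suc i) < sp_abs \<beta> i"
        using \<open>(\<beta> (int i) > 0) = (\<beta> (int (Suc i)) > 0)\<close> by (auto simp: prec_def sp_abs_def)
      then have "a i < a (Suc i)" using le by auto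
      then have "a i + 2 \<le> a (Suc i)" using two odd \<open>(\<beta> (int i) > 0) = (\<beta> (int (Suc i)) > 0)\<close> by blast
      then show ?thesis using gvec_Suc[OF i, of \<beta>] eta by (simp split: if_splits)
    next
      case False
      then show ?thesis using gvec_Suc[OF i, of \<beta>] eta le by auto
    qed
  next
    case False
    then have "odd (a i) \<noteq> odd (a (Suc i))" using odd by blast
    then have "a i < a (Suc i)" using le by auto
    moreover have "gvec n \<beta> (Suc i) = gvec n \<beta> i + 1"
      using gvec_Suc[OF i, of \<beta>] False nz by (auto simp: eta_def prec_def split: if_splits)
    ultimately show ?thesis by simp
  qed
qed

lemma gvec_mono:
  assumes b: "\<beta> \<in> signed_perms n" and ij: "1 \<le> i" "i < j" "j \<le> n"
  shows "gvec n \<beta> i < gvec n \<beta> j \<or> gvec n \<beta> i = gvec n \<beta> j \<and> sp_abs \<beta> i < sp_abs \<beta> j"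
  using ij(2,3)
proof (induction j)
  case 0
  then show ?case by simp
next
  case (Suc j)
  have s: "gvec n \<beta> j < gvec n \<beta> (Suc j) \<or> gvec n \<beta> j = gvec n \<beta> (Suc j) \<and> sp_abs \<beta> j < sp_abs \<beta> (Suc j)"
    using Suc.prems ij(1) by (intro gvec_Suc_mono[OF b]) auto
  show ?case
  proof (cases "i = j")
    case False
    then have "gvec n \<beta> i < gvec n \<beta> j \<or> gvec n \<beta> i = gvec n \<beta> j \<and> sp_abs \<beta> i < sp_abs \<beta> j"
      using Suc by simp
    then show ?thesis using s by linarith
  qed (use s in simp)
qed

lemma sorts_gvec_mono:
  assumes b: "\<beta> \<in> signed_perms n" and a: "sorts n \<beta> a" and ij: "1 \<le> i" "i \<le> j" "j \<le> n"
  shows "a i + gvec n \<beta> j \<le> a j + gvec n \<beta> i"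
  using ij(2,3)
proof (induction j)
  case 0
  then show ?case using ij by simp
next
  case (Suc j)
  show ?case
  proof (cases "i = Suc j")
    case False
    then have "a i + gvec n \<beta> j \<le> a j + gvec n \<beta> i" using Suc by simp
    moreover have "a j + gvec n \<beta> (Suc j) \<le> a (Suc j) + gvec n \<beta> j"
      using False Suc.prems ij(1) by (intro sorts_gvec_Suc[OF b a]) auto
    ultimately show ?thesis by linarith
  qed simp
qed

text \<open>The difference \<open>a - g(\<beta>)\<close> is even and weakly increasing, so it is at least \<open>2\<close> from the first
position \<open>m\<close> where it is nonzero.  If lowering \<open>a\<close> by \<open>2\<close> on \<open>{m..n}\<close> creates a tie between \<open>i < m\<close>
and \<open>j \<ge> m\<close>, then \<open>g(\<beta>)\<close> has a tie there as well, hence \<open>|\<beta>(i)| < |\<beta>(j)|\<close>.\<close>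

lemma reducible_positions:
  assumes b: "\<beta> \<in> signed_perms n" and a: "sorts n \<beta> a"
    and ne: "i0 \<in> {1..n}" "a i0 \<noteq> gvec n \<beta> i0"
  obtains T where "T \<subseteq> {1..n}" "T \<noteq> {}" "\<And>j. j \<in> T \<Longrightarrow> 2 \<le> a j"
    "\<And>i j. i \<in> {1..n} - T \<Longrightarrow> j \<in> T \<Longrightarrow> a i < a j - 2 \<or> a i = a j - 2 \<and> sp_abs \<beta> i < sp_abs \<beta> j"
proof -
  let ?g = "gvec n \<beta>"
  define m where "m = (LEAST i. i \<in> {1..n} \<and> a i \<noteq> ?g i)"
  have m: "m \<in> {1..n}" "a m \<noteq> ?g m"
    using LeastI[of "\<lambda>i. i \<in> {1..n} \<and> a i \<noteq> ?g i" i0] ne unfolding m_def by blast+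
  have below: "a i = ?g i" if "i \<in> {1..n}" "i < m" for i
    using not_less_Least[of i "\<lambda>i. i \<in> {1..n} \<and> a i \<noteq> ?g i"] that unfolding m_def by blast
  have par: "odd (a i) \<longleftrightarrow> odd (?g i)" if "i \<in> {1..n}" for i
    using a that unfolding sorts_def odd_gvec_iff by blast
  have "?g 1 \<le> a 1"
  proof -
    have "odd (a 1) \<longleftrightarrow> \<beta> (int 1) > 0" using a m(1) unfolding sorts_def by auto
    then show ?thesis unfolding gvec_one eta_def by (cases "a 1") auto
  qed
  then have "?g m \<le> a m" using sorts_gvec_mono[OF b a, of 1 m] m(1) by auto
  then have am: "?g m + 2 \<le> a m" using m(2) par[OF m(1)]
    by (cases "a m = Suc (gvec n \<beta> m)") (simp, linarith)
  have aj: "?g j + 2 \<le> a j" if "j \<in> {m..n}" for j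
    using sorts_gvec_mono[OF b a, of m j] that m(1) am by auto
  show thesis
  proof (rule that[of "{m..n}"])
    show "{m..n} \<subseteq> {1..n}" "{m..n} \<noteq> {}" using m(1) by auto
    show "2 \<le> a j" if "j \<in> {m..n}" for j using aj[OF that] by simp
    show "a i < a j - 2 \<or> a i = a j - 2 \<and> sp_abs \<beta> i < sp_abs \<beta> j"
      if i: "i \<in> {1..n} - {m..n}" and j: "j \<in> {m..n}" for i j
    proof -
      have ij: "1 \<le> i" "i < m" "i < j" "j \<le> n" using i j by auto
      then have "a i = ?g i" using below[of i] i by blast
      then show ?thesis using gvec_mono[OF b ij(1) ij(3) ij(4)] aj[OF j] by linarith
    qed
  qed
qed

text \<open>The \<open>\<rho>\<close> of the conclusion sends an element to its rank for the strict linear order \<open>R\<close>.\<close>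

lemma rank_permutation:
  fixes R :: "nat \<Rightarrow> nat \<Rightarrow> bool"
  assumes irr: "\<And>i. \<not> R i i" and trans: "\<And>i j k. R i j \<Longrightarrow> R j k \<Longrightarrow> R i k"
    and total: "\<And>i j. i \<noteq> j \<Longrightarrow> R i j \<or> R j i"
  obtains \<rho> where "\<rho> permutes {1..n}" "\<And>i j. i \<in> {1..n} \<Longrightarrow> j \<in> {1..n} \<Longrightarrow> \<rho> i < \<rho> j \<longleftrightarrow> R i j"
proof -
  define \<rho> where "\<rho> i = (if i \<in> {1..n} then Suc (card {j \<in> {1..n}. R j i}) else i)" for i
  have mono: "\<rho> i < \<rho> j" if "i \<in> {1..n}" "j \<in> {1..n}" "R i j" for i j
  proof -
    have "{l \<in> {1..n}. R l i} \<subset> {l \<in> {1..n}. R l j}"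
      using that irr trans by blast
    then have "card {l \<in> {1..n}. R l i} < card {l \<in> {1..n}. R l j}"
      by (intro psubset_card_mono) simp_all
    then show ?thesis using that by (simp add: \<rho>_def)
  qed
  have iff: "\<rho> i < \<rho> j \<longleftrightarrow> R i j" if "i \<in> {1..n}" "j \<in> {1..n}" for i j
    using mono[OF that] mono[OF that(2,1)] total[of i j] by (metis less_irrefl less_asym)
  have "\<rho> i \<in> {1..n}" if "i \<in> {1..n}" for i
  proof -
    have "card {j \<in> {1..n}. R j i} \<le> card ({1..n} - {i})"
      using irr by (intro card_mono) auto
    then show ?thesis using that by (auto simp: \<rho>_def)
  qed
  moreover have inj: "inj_on \<rho> {1..n}"
    by (rule inj_onI) (metis iff less_irrefl total)
  ultimately have "\<rho> ` {1..n} = {1..n}"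
    by (intro endo_inj_surj) auto
  then have "bij_betw \<rho> {1..n} {1..n}" using inj by (simp add: bij_betw_def)
  then have "\<rho> permutes {1..n}" by (rule bij_imp_permutes) (auto simp: \<rho>_def)
  then show thesis using iff by (rule that)
qed

text \<open>Two rank functions are combined: \<open>\<rho>\<close> ranks the indices by \<open>(a, b, index)\<close> and \<open>\<tau>\<close> by
\<open>(b, a, index)\<close>.  Using the index as the last criterion makes ties of the two orders consistent, which
is what both instances of \<^const>\<open>sorts\<close> require of ties.\<close>

lemma sorting_signed_perm:
  assumes pm: "parity_matched n a b"
  obtains \<pi> \<beta> where "\<pi> permutes {1..n}" "\<beta> \<in> signed_perms n" "sorts n \<beta> (a \<circ> \<pi>)"
    "sorts n (finv \<beta>) (b \<circ> \<pi> \<circ> sp_abs (finv \<beta>))"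
proof -
  define R where "R a b i j \<longleftrightarrow> a i < a j \<or> a i = a j \<and> (b i < b j \<or> b i = b j \<and> i < j)"
    for a b :: "nat \<Rightarrow> nat" and i j :: nat
  have R: "\<not> R a b i i" "R a b i j \<Longrightarrow> R a b j k \<Longrightarrow> R a b i k" "i \<noteq> j \<Longrightarrow> R a b i j \<or> R a b j i"
    for a b i j k unfolding R_def by linarith+
  obtain \<rho> where \<rho>: "\<rho> permutes {1..n}" "\<And>i j. i \<in> {1..n} \<Longrightarrow> j \<in> {1..n} \<Longrightarrow> \<rho> i < \<rho> j \<longleftrightarrow> R a b i j"
    using rank_permutation[of "R a b" n] R by metis
  obtain \<tau> where \<tau>: "\<tau> permutes {1..n}" "\<And>i j. i \<in> {1..n} \<Longrightarrow> j \<in> {1..n} \<Longrightarrow> \<tau> i < \<tau> j \<longleftrightarrow> R b a i j"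
    using rank_permutation[of "R b a" n] R by metis
  define \<pi> where "\<pi> = finv \<rho>"
  have \<pi>: "\<pi> permutes {1..n}" unfolding \<pi>_def by (rule permutes_inv[OF \<rho>(1)])
  have \<rho>\<pi>: "\<rho> (\<pi> i) = i" for i unfolding \<pi>_def by (rule permutes_inverses(1)[OF \<rho>(1)])
  have \<pi>in: "\<pi> i \<in> {1..n} \<longleftrightarrow> i \<in> {1..n}" for i by (rule permutes_in_image[OF \<pi>])
  define \<sigma> where "\<sigma> = \<tau> \<circ> \<pi>"
  have \<sigma>: "\<sigma> permutes {1..n}" unfolding \<sigma>_def by (rule permutes_compose[OF \<pi> \<tau>(1)])
  define \<beta> where "\<beta> = make_signed n \<sigma> (\<lambda>i. odd (a (\<pi> i)))"
  have b: "\<beta> \<in> signed_perms n" unfolding \<beta>_def by (rule make_signed_in[OF \<sigma>])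
  have abs: "sp_abs \<beta> = \<sigma>" unfolding \<beta>_def by (rule sp_abs_make_signed[OF \<sigma>])
  have pos: "\<beta> (int i) > 0 \<longleftrightarrow> odd (a (\<pi> i))" if "i \<in> {1..n}" for i
    unfolding \<beta>_def by (rule make_signed_pos_iff[OF \<sigma> that])
  have ra: "i < j \<longleftrightarrow> R a b (\<pi> i) (\<pi> j)" if "i \<in> {1..n}" "j \<in> {1..n}" for i j
    using \<rho>(2)[of "\<pi> i" "\<pi> j"] that by (simp only: \<rho>\<pi> \<pi>in)
  have rb: "\<sigma> i < \<sigma> j \<longleftrightarrow> R b a (\<pi> i) (\<pi> j)" if "i \<in> {1..n}" "j \<in> {1..n}" for i j
    using \<tau>(2)[of "\<pi> i" "\<pi> j"] that by (simp only: \<pi>in \<sigma>_def o_apply)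
  have sa: "sorts n \<beta> (a \<circ> \<pi>)"
    unfolding sorts_def abs
  proof (intro conjI ballI impI)
    show "odd ((a \<circ> \<pi>) i) \<longleftrightarrow> \<beta> (int i) > 0" if "i \<in> {1..n}" for i
      using pos[OF that] by simp
    show "(a \<circ> \<pi>) i < (a \<circ> \<pi>) j \<or> (a \<circ> \<pi>) i = (a \<circ> \<pi>) j \<and> \<sigma> i < \<sigma> j"
      if "i \<in> {1..n}" "j \<in> {1..n}" "i < j" for i j
      using ra[OF that(1,2)] rb[OF that(1,2)] that(3) unfolding R_def o_apply by linarith
  qed
  have sb: "sorts n (finv \<beta>) (b \<circ> \<pi> \<circ> sp_abs (finv \<beta>))"
    unfolding sorts_def
  proof (intro conjI ballI impI)
    let ?s = "sp_abs (finv \<beta>)"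
    have s_in: "?s j \<in> {1..n}" if "j \<in> {1..n}" for j
      by (simp only: sp_abs_in[OF signed_perms_inv[OF b]] that)
    have s: "\<sigma> (?s j) = j" for j using sp_abs_inv(2)[OF b, of j] by (simp only: abs)
    show "odd ((b \<circ> \<pi> \<circ> ?s) j) \<longleftrightarrow> finv \<beta> (int j) > 0" if "j \<in> {1..n}" for j
    proof -
      have "finv \<beta> (int j) > 0 \<longleftrightarrow> \<beta> (int (?s j)) > 0"
        using inv_pos_iff[OF b, of "?s j"] by (simp only: sp_abs_inv(2)[OF b])
      also have "\<dots> \<longleftrightarrow> odd (a (\<pi> (?s j)))" by (rule pos[OF s_in[OF that]])
      also have "\<dots> \<longleftrightarrow> odd (b (\<pi> (?s j)))"
      proof -
        have "\<pi> (?s j) \<in> {1..n}" by (simp only: \<pi>in s_in[OF that])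
        then show ?thesis using pm unfolding parity_matched_def by auto
      qed
      finally show ?thesis by simp
    qed
    show "(b \<circ> \<pi> \<circ> ?s) i < (b \<circ> \<pi> \<circ> ?s) j \<or> (b \<circ> \<pi> \<circ> ?s) i = (b \<circ> \<pi> \<circ> ?s) j \<and> ?s i < ?s j"
      if "i \<in> {1..n}" "j \<in> {1..n}" "i < j" for i j
      using ra[OF s_in[OF that(1)] s_in[OF that(2)]] rb[OF s_in[OF that(1)] s_in[OF that(2)]] that(3)
      unfolding R_def o_apply s by linarith
  qed
  show thesis by (rule that[OF \<pi> b sa sb])
qed

section \<open>Diagonal invariants are spanned over the bi-invariants\<close>

lemma sorts_mono:
  assumes "sorts n \<beta> a" "i \<in> {1..n}" "j \<in> {1..n}" "i < j"
  shows "a i \<le> a j"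
proof -
  have "a i < a j \<or> a i = a j \<and> sp_abs \<beta> i < sp_abs \<beta> j"
    using assms unfolding sorts_def by blast
  then show ?thesis by linarith
qed

text \<open>Well-founded induction along the straightening order.  After sorting, one of three things happens: the
\<open>x\<close>-exponents can be straightened, or the \<open>y\<close>-exponents can (after reindexing along the inverse
signed permutation, which exchanges the roles of the two kinds of variables), or both exponent vectors
agree with those of \<open>M\<^sub>\<beta>\<close>.\<close>

lemma sym_monom_module_span:
  assumes "parity_matched n a b"
  shows "sym_monom n a b \<in> module_span n"
  using assms
proof (induction "(sq_weight n a b, corr_weight n a b)" arbitrary: a b
    rule: wf_induct_rule[OF wf_lex_prod[OF wf_less_than wf_less_than]])
  case (1 a b)
  have IH: "sym_monom n a' b' \<in> module_span n" if "parity_matched n a' b'" "lighter n a' b' a b" for a' b'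
    using 1(1)[OF _ that(1)] that(2) by (simp add: lighter_def)
  obtain \<pi> \<beta> where \<pi>: "\<pi> permutes {1..n}" and b: "\<beta> \<in> signed_perms n" and sa: "sorts n \<beta> (a \<circ> \<pi>)"
    and sb: "sorts n (finv \<beta>) (b \<circ> \<pi> \<circ> sp_abs (finv \<beta>))"
    using sorting_signed_perm[OF 1(2)] by metis
  let ?s = "sp_abs (finv \<beta>)"
  note binv = signed_perms_inv[OF b]
  \<comment> \<open>\<open>(a1, b1)\<close> lists the pairs with \<open>a\<close> increasing, \<open>(a2, b2)\<close> with \<open>b\<close> increasing.\<close>
  define a1 b1 where "a1 = a \<circ> \<pi>" and "b1 = b \<circ> \<pi>"
  have eq1: "sym_monom n a b = sym_monom n a1 b1"
    unfolding a1_def b1_def using sym_monom_permute[OF \<pi> 1(2)] by simp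
  have pm1: "parity_matched n a1 b1"
    using 1(2) permutes_in_image[OF \<pi>] unfolding parity_matched_def a1_def b1_def o_apply by blast
  have IH1: "sym_monom n a' b' \<in> module_span n" if "parity_matched n a' b'" "lighter n a' b' a1 b1" for a' b'
    using IH[OF that(1)] that(2) weight_permute[OF \<pi>] by (simp add: lighter_def a1_def b1_def)
  have s: "?s permutes {1..n}" by (rule sp_abs_permutes[OF binv])
  define a2 b2 where "a2 = a1 \<circ> ?s" and "b2 = b1 \<circ> ?s"
  have eq2: "sym_monom n a1 b1 = sym_monom n a2 b2"
    unfolding a2_def b2_def using sym_monom_permute[OF s pm1] by simp
  have pm2: "parity_matched n b2 a2"
    using pm1 permutes_in_image[OF s] unfolding parity_matched_def a2_def b2_def o_apply
    by (metis add.commute)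
  have IH2: "sym_monom n a' b' \<in> module_span n" if "parity_matched n b' a'" "lighter n b' a' b2 a2" for a' b'
  proof (rule IH1)
    show "parity_matched n a' b'" using that(1) by (simp add: parity_matched_def add.commute)
    show "lighter n a' b' a1 b1"
      using that(2) weight_permute[OF s] unfolding lighter_swap[of n b'] by (simp add: lighter_def a2_def b2_def)
  qed
  have sa1: "sorts n \<beta> a1" using sa by (simp add: a1_def)
  have sb2: "sorts n (finv \<beta>) b2" using sb by (simp add: b2_def b1_def)
  have s_in: "sp_abs \<beta> i \<in> {1..n}" "?s i \<in> {1..n}" if "i \<in> {1..n}" for i
    by (simp_all only: sp_abs_in[OF b] sp_abs_in[OF binv] that)
  have "sym_monom n a1 b1 \<in> module_span n"
  proof (cases "\<forall>i\<in>{1..n}. a1 i = gvec n \<beta> i")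
    case False
    then obtain i0 where i0: "i0 \<in> {1..n}" "a1 i0 \<noteq> gvec n \<beta> i0" by blast
    obtain T where T: "T \<subseteq> {1..n}" "T \<noteq> {}" "\<And>j. j \<in> T \<Longrightarrow> 2 \<le> a1 j"
      and top: "\<And>i j. i \<in> {1..n} - T \<Longrightarrow> j \<in> T \<Longrightarrow>
        a1 i < a1 j - 2 \<or> a1 i = a1 j - 2 \<and> sp_abs \<beta> i < sp_abs \<beta> j"
      using reducible_positions[OF b sa1 i0] by metis
    show ?thesis
    proof (rule straighten_step[where N = "sym_monom n" and e = "elem_sym_sq n Xvar",
          OF sym_monom_permute elem_sym_sq_mult(1) elem_sym_sq_in IH1 pm1 T])
      fix i j assume ij: "i \<in> {1..n} - T" "j \<in> T"
      have "b1 i \<le> b1 j" if "sp_abs \<beta> i < sp_abs \<beta> j"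
        using sorts_mono[OF sb2, of "sp_abs \<beta> i" "sp_abs \<beta> j"] s_in(1)[of i] s_in(1)[of j] ij T(1) that
        by (auto simp: b2_def sp_abs_inv[OF b])
      then show "a1 i < a1 j - 2 \<or> a1 i = a1 j - 2 \<and> b1 i \<le> b1 j" using top[OF ij] by blast
    qed simp_all
  next
    case a_eq: True
    show ?thesis
    proof (cases "\<forall>i\<in>{1..n}. b2 i = gvec n (finv \<beta>) i")
      case False
      then obtain i0 where i0: "i0 \<in> {1..n}" "b2 i0 \<noteq> gvec n (finv \<beta>) i0" by blast
      obtain T where T: "T \<subseteq> {1..n}" "T \<noteq> {}" "\<And>j. j \<in> T \<Longrightarrow> 2 \<le> b2 j"
        and top: "\<And>i j. i \<in> {1..n} - T \<Longrightarrow> j \<in> T \<Longrightarrow> b2 i < b2 j - 2 \<or> b2 i = b2 j - 2 \<and> ?s i < ?s j"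
        using reducible_positions[OF binv sb2 i0] by metis
      have "sym_monom n a2 b2 \<in> module_span n"
      proof (rule straighten_step[where N = "\<lambda>u v. sym_monom n v u" and e = "elem_sym_sq n Yvar",
            OF _ elem_sym_sq_mult(2) elem_sym_sq_in IH2 pm2 T])
        show "sym_monom n (v \<circ> \<pi>) (u \<circ> \<pi>) = sym_monom n v u"
          if "\<pi> permutes {1..n}" "parity_matched n u v" for \<pi> u v
          using that by (intro sym_monom_permute) (simp_all add: parity_matched_def add.commute)
        fix i j assume ij: "i \<in> {1..n} - T" "j \<in> T"
        have "a2 i \<le> a2 j" if "?s i < ?s j"
          using sorts_mono[OF sa1, of "?s i" "?s j"] s_in(2)[of i] s_in(2)[of j] ij T(1) that
          by (auto simp: a2_def)
        then show "b2 i < b2 j - 2 \<or> b2 i = b2 j - 2 \<and> a2 i \<le> a2 j" using top[OF ij] by blast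
      qed simp_all
      then show ?thesis unfolding eq2 .
    next
      case b_eq: True
      have "b1 i = gvec_tilde n \<beta> i" if "i \<in> {1..n}" for i
        using b_eq s_in(1)[OF that] unfolding b2_def gvec_tilde_def o_apply
        by (metis sp_abs_inv(1)[OF b])
      then have "sym_monom n a1 b1 = sym_monom n (gvec n \<beta>) (gvec_tilde n \<beta>)"
        using a_eq by (intro sym_monom_cong) blast
      moreover obtain c where "sym_monom n (gvec n \<beta>) (gvec_tilde n \<beta>) = Const (of_nat c) * Mpoly n \<beta>"
        unfolding Mpoly_def using sym_monom_orbit_sum[OF parity_matched_gvec[OF b]] by metis
      ultimately show ?thesis
        using module_span_Const_mult[OF Mpoly_module_span[OF b]] by simp
    qed
  qed
  then show ?case unfolding eq1 .
qed

lemma diag_invariants_module_span: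
  assumes "f \<in> diag_invariants n"
  shows "f \<in> module_span n"
proof -
  let ?c = "of_nat (card (signed_perms n)) :: rat"
  have "sym_monom n a b \<in> module_span n" for a b
    by (cases "parity_matched n a b") (simp_all add: sym_monom_module_span sym_monom_unmatched module_span_zero)
  then have "Const ?c * f \<in> module_span n"
    unfolding diag_invariant_expand[OF assms] by (intro module_span_sum module_span_Const_mult)
  then have "Const (1 / ?c) * (Const ?c * f) \<in> module_span n" by (rule module_span_Const_mult)
  then show ?thesis using card_signed_perms_pos[of n] by (simp flip: mult.assoc Const_mult)
qed

section \<open>Independence by evaluation\<close>

text \<open>The point with coordinates \<open>x\<^sub>i = t \<beta>(i)\<close> and \<open>y\<^sub>i = t \<gamma>(i)\<close>.  It is the image of \<open>x = y = t(1, \<dots>, n)\<close>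
under \<open>(\<beta>, \<gamma>)\<close>, and for \<open>t \<noteq> 0\<close> different pairs give different points.\<close>

definition point :: "rat \<Rightarrow> (int \<Rightarrow> int) \<Rightarrow> (int \<Rightarrow> int) \<Rightarrow> var \<Rightarrow> rat" where
  "point t \<beta> \<gamma> v = (case v of Xvar i \<Rightarrow> t * of_int (\<beta> (int i)) | Yvar i \<Rightarrow> t * of_int (\<gamma> (int i)))"

definition eval_at :: "rat \<Rightarrow> (int \<Rightarrow> int) \<Rightarrow> (int \<Rightarrow> int) \<Rightarrow> xypoly \<Rightarrow> rat" where
  "eval_at t \<beta> \<gamma> = poly_val (\<lambda>c. c) (point t \<beta> \<gamma>)"

lemma eval_at_diff: "eval_at t \<beta> \<gamma> (p - q) = eval_at t \<beta> \<gamma> p - eval_at t \<beta> \<gamma> q"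
  and eval_at_mult: "eval_at t \<beta> \<gamma> (p * q) = eval_at t \<beta> \<gamma> p * eval_at t \<beta> \<gamma> q"
  and eval_at_sum: "eval_at t \<beta> \<gamma> (sum f I) = (\<Sum>i\<in>I. eval_at t \<beta> \<gamma> (f i))"
  and eval_at_prod: "eval_at t \<beta> \<gamma> (prod g J) = (\<Prod>j\<in>J. eval_at t \<beta> \<gamma> (g j))"
  and eval_at_Const: "eval_at t \<beta> \<gamma> (Const c) = c"
  and eval_at_Var: "eval_at t \<beta> \<gamma> (Var v) = point t \<beta> \<gamma> v"
  and eval_at_zero: "eval_at t \<beta> \<gamma> 0 = 0"
  by (simp_all add: eval_at_def rat.poly_val_diff rat.poly_val_mult rat.poly_val_sum
      rat.poly_val_prod poly_val_Const poly_val_Var rat.scalar_hom_axioms rat.poly_val_zero)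

lemma eval_at_act2:
  assumes "\<beta>' \<in> signed_perms n" "\<gamma>' \<in> signed_perms n"
  shows "eval_at t \<beta>' \<gamma>' (act2 \<beta> \<gamma> p) = eval_at t (\<beta>' \<circ> \<beta>) (\<gamma>' \<circ> \<gamma>) p"
proof -
  have s: "of_int (sgn (\<beta> (int i))) * of_int (\<beta>' (int (sp_abs \<beta> i))) = (of_int (\<beta>' (\<beta> (int i))) :: rat)"
    if b: "\<beta>' \<in> signed_perms n" for \<beta> \<beta>' i
  proof -
    have "sgn z * \<beta>' \<bar>z\<bar> = \<beta>' z" for z
      using signed_perms_odd[OF b, of z] signed_perms_zero[OF b] by (simp add: sgn_if)
    then have "sgn (\<beta> (int i)) * \<beta>' (int (sp_abs \<beta> i)) = \<beta>' (\<beta> (int i))" by (simp add: int_sp_abs)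
    then show ?thesis by (metis of_int_mult)
  qed
  have "eval_at t \<beta>' \<gamma>' (act_var \<beta> \<gamma> v) = point t (\<beta>' \<circ> \<beta>) (\<gamma>' \<circ> \<gamma>) v" for v
  proof (cases v)
    case (Xvar i)
    then show ?thesis using s[OF assms(1), of \<beta> i]
      by (simp add: eval_at_mult eval_at_Const eval_at_Var point_def mult.left_commute)
  next
    case (Yvar i)
    then show ?thesis using s[OF assms(2), of \<gamma> i]
      by (simp add: eval_at_mult eval_at_Const eval_at_Var point_def mult.left_commute)
  qed
  then have "point t (\<beta>' \<circ> \<beta>) (\<gamma>' \<circ> \<gamma>) = (\<lambda>v. eval_at t \<beta>' \<gamma>' (act_var \<beta> \<gamma> v))" by auto
  then show ?thesis
    unfolding act2_def eval_at_def using poly_val_substitute[OF rat.scalar_hom_axioms] by simp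
qed

text \<open>All these points lie in one orbit of \<open>G \<times> G\<close>.\<close>

lemma eval_at_bi_invariant:
  assumes "\<beta> \<in> signed_perms n" "\<gamma> \<in> signed_perms n" "h \<in> bi_invariants n"
  shows "eval_at t \<beta> \<gamma> h = eval_at t id id h"
  using eval_at_act2[OF signed_perms_id signed_perms_id, of t \<beta> \<gamma> h] assms
  by (simp add: bi_invariants_def)

lemma point_separates:
  assumes "\<beta> \<in> signed_perms n" "\<gamma> \<in> signed_perms n" "\<beta>' \<in> signed_perms n" "\<gamma>' \<in> signed_perms n"
    and "(\<beta>, \<gamma>) \<noteq> (\<beta>', \<gamma>')" "t \<noteq> 0"
  shows "\<exists>v\<in>xy_vars n. point t \<beta> \<gamma> v \<noteq> point t \<beta>' \<gamma>' v"
proof (rule ccontr)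
  assume "\<not> ?thesis"
  then have e: "point t \<beta> \<gamma> v = point t \<beta>' \<gamma>' v" if "v \<in> xy_vars n" for v using that by blast
  have "\<beta> i = \<beta>' i \<and> \<gamma> i = \<gamma>' i" if "i \<in> {1..int n}" for i
  proof -
    have "nat i \<in> {1..n}" using that by auto
    then have "Xvar (nat i) \<in> xy_vars n" "Yvar (nat i) \<in> xy_vars n" by blast+
    from e[OF this(1)] e[OF this(2)] show ?thesis using that assms(6) by (simp add: point_def)
  qed
  then have "\<beta> = \<beta>'" "\<gamma> = \<gamma>'" using signed_perms_eqI assms(1-4) by blast+
  then show False using assms(5) by simp
qed

lemma lagrange_polynomial:
  assumes b: "\<beta> \<in> signed_perms n" "\<gamma> \<in> signed_perms n" and t: "t \<noteq> 0"
  obtains p where "p \<in> xypolys n"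
    "\<And>\<beta>' \<gamma>'. \<beta>' \<in> signed_perms n \<Longrightarrow> \<gamma>' \<in> signed_perms n \<Longrightarrow>
       eval_at t \<beta>' \<gamma>' p = (if \<beta>' = \<beta> \<and> \<gamma>' = \<gamma> then 1 else 0)"
proof -
  let ?D = "signed_perms n \<times> signed_perms n - {(\<beta>, \<gamma>)}"
  have "\<exists>v. v \<in> xy_vars n \<and> point t \<beta> \<gamma> v \<noteq> point t (fst d) (snd d) v" if "d \<in> ?D" for d
    using point_separates[OF b, of "fst d" "snd d" t] that t by (cases d) auto
  then obtain V where V: "\<And>d. d \<in> ?D \<Longrightarrow> V d \<in> xy_vars n \<and> point t \<beta> \<gamma> (V d) \<noteq> point t (fst d) (snd d) (V d)"
    by metis
  define L where "L d = Const (1 / (point t \<beta> \<gamma> (V d) - point t (fst d) (snd d) (V d))) *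
     (Var (V d) - Const (point t (fst d) (snd d) (V d)))" for d
  have fin: "finite ?D" using finite_signed_perms by blast
  show thesis
  proof (rule that[of "\<Prod>d\<in>?D. L d"])
    show "(\<Prod>d\<in>?D. L d) \<in> xypolys n"
      unfolding L_def using V by (intro xypolys_prod xypolys_mult xypolys_Const xypolys_diff xypolys_Var) blast
    fix \<beta>' \<gamma>' assume b': "\<beta>' \<in> signed_perms n" "\<gamma>' \<in> signed_perms n"
    show "eval_at t \<beta>' \<gamma>' (\<Prod>d\<in>?D. L d) = (if \<beta>' = \<beta> \<and> \<gamma>' = \<gamma> then 1 else 0)"
    proof (cases "\<beta>' = \<beta> \<and> \<gamma>' = \<gamma>")
      case True
      have "eval_at t \<beta> \<gamma> (L d) = 1" if "d \<in> ?D" for d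
        using V[OF that] by (simp add: L_def eval_at_mult eval_at_diff eval_at_Const eval_at_Var)
      then show ?thesis using True unfolding eval_at_prod by (simp add: prod.neutral)
    next
      case False
      then have "(\<beta>', \<gamma>') \<in> ?D" using b' by auto
      moreover have "eval_at t \<beta>' \<gamma>' (L (\<beta>', \<gamma>')) = 0"
        by (simp add: L_def eval_at_mult eval_at_diff eval_at_Const eval_at_Var)
      ultimately have "eval_at t \<beta>' \<gamma>' (\<Prod>d\<in>?D. L d) = 0"
        unfolding eval_at_prod using fin by (intro prod_zero) blast+
      then show ?thesis using False by simp
    qed
  qed
qed

text \<open>Symmetrizing a Lagrange polynomial for the point of \<open>(id, \<gamma>)\<close> adds up its values at the points of
\<open>(\<delta>, \<gamma>' \<circ> \<delta>)\<close>; only \<open>\<delta> = id\<close> can contribute.\<close>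

lemma interpolating_invariant:
  assumes g: "\<gamma> \<in> signed_perms n" and t: "t \<noteq> 0"
  obtains f where "f \<in> diag_invariants n"
    "\<And>\<gamma>'. \<gamma>' \<in> signed_perms n \<Longrightarrow> eval_at t id \<gamma>' f = (if \<gamma>' = \<gamma> then 1 else 0)"
proof -
  obtain p where p: "p \<in> xypolys n"
    "\<And>\<beta>' \<gamma>'. \<beta>' \<in> signed_perms n \<Longrightarrow> \<gamma>' \<in> signed_perms n \<Longrightarrow>
       eval_at t \<beta>' \<gamma>' p = (if \<beta>' = id \<and> \<gamma>' = \<gamma> then 1 else 0)"
    using lagrange_polynomial[OF signed_perms_id g t] by metis
  show thesis
  proof (rule that)
    show "symmetrize n p \<in> diag_invariants n" by (rule symmetrize_in[OF p(1)])
    fix \<gamma>' assume g': "\<gamma>' \<in> signed_perms n"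
    have "eval_at t id \<gamma>' (symmetrize n p) = (\<Sum>\<delta>\<in>signed_perms n. eval_at t \<delta> (\<gamma>' \<circ> \<delta>) p)"
      by (simp add: symmetrize_def diag_act_def eval_at_sum eval_at_act2[OF signed_perms_id g'])
    also have "\<dots> = (\<Sum>\<delta>\<in>signed_perms n. if \<delta> = id then (if \<gamma>' = \<gamma> then 1 else 0) else 0)"
      using signed_perms_comp[OF g'] by (intro sum.cong refl) (auto simp: p(2))
    also have "\<dots> = (if \<gamma>' = \<gamma> then 1 else 0)"
      using finite_signed_perms[of n] signed_perms_id[of n] by simp
    finally show "eval_at t id \<gamma>' (symmetrize n p) = (if \<gamma>' = \<gamma> then 1 else 0)" .
  qed
qed

lemma square_right_inverse_imp_kernel_zero:
  fixes M K :: "'a \<Rightarrow> 'a \<Rightarrow> 'b::field"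
  assumes fin: "finite G"
    and right: "\<And>g g'. g \<in> G \<Longrightarrow> g' \<in> G \<Longrightarrow> (\<Sum>b\<in>G. M g b * K b g') = (if g = g' then 1 else 0)"
    and ker: "\<And>g. g \<in> G \<Longrightarrow> (\<Sum>b\<in>G. M g b * d b) = 0"
    and a: "a \<in> G"
  shows "d a = 0"
proof -
  let ?N = "card G"
  obtain e where e: "bij_betw e {0..<?N} G" using ex_bij_betw_nat_finite[OF fin] by blast
  have e_in: "e i \<in> G" if "i < ?N" for i using bij_betw_apply[OF e, of i] that by simp
  have e_eq: "e i = e j \<longleftrightarrow> i = j" if "i < ?N" "j < ?N" for i j
    using bij_betw_imp_inj_on[OF e] that by (auto dest: inj_onD)
  have reindex: "(\<Sum>b\<in>G. F b) = (\<Sum>k = 0..<?N. F (e k))" for F :: "'a \<Rightarrow> 'b"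
    by (rule sum.reindex_bij_betw[OF e, symmetric])
  define A where "A = mat ?N ?N (\<lambda>(i, j). M (e i) (e j))"
  define B where "B = mat ?N ?N (\<lambda>(i, j). K (e i) (e j))"
  define x where "x = vec ?N (\<lambda>i. d (e i))"
  have car: "A \<in> carrier_mat ?N ?N" "B \<in> carrier_mat ?N ?N" "x \<in> carrier_vec ?N"
    by (simp_all add: A_def B_def x_def)
  have "A * B = 1\<^sub>m ?N"
    by (rule eq_matI) (simp_all add: A_def B_def scalar_prod_def right[OF e_in e_in, unfolded reindex] e_eq)
  then have BA: "B * A = 1\<^sub>m ?N" by (rule mat_mult_left_right_inverse[OF car(1,2)])
  have "A *\<^sub>v x = 0\<^sub>v ?N"
    by (rule eq_vecI) (simp_all add: A_def x_def scalar_prod_def ker[OF e_in, unfolded reindex])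
  then have "B *\<^sub>v (A *\<^sub>v x) = 0\<^sub>v ?N"
    using car(2) by (intro eq_vecI) (simp_all add: scalar_prod_right_zero[OF row_carrier_vec])
  then have "x = 0\<^sub>v ?N"
    using BA car by (simp flip: assoc_mult_mat_vec[OF car(2,1,3)])
  moreover have "a \<in> e ` {0..<?N}" using a bij_betw_imp_surj_on[OF e] by simp
  then obtain i where "i < ?N" "a = e i" by auto
  ultimately show ?thesis by (metis index_zero_vec(1) index_vec x_def)
qed

text \<open>The values of the \<open>M\<^sub>\<beta>\<close> at the points of \<open>(id, \<gamma>)\<close> form a square matrix.  Expanding the interpolating
invariants in terms of the \<open>M\<^sub>\<beta>\<close> gives a right inverse of it, so its kernel is zero; and a relation
between the \<open>M\<^sub>\<beta>\<close>, evaluated at these points, is an element of the kernel because the coefficients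
take the same value at all of them.\<close>

lemma eval_coefficients_zero:
  assumes h: "\<And>\<beta>. \<beta> \<in> signed_perms n \<Longrightarrow> h \<beta> \<in> bi_invariants n"
    and z: "(\<Sum>\<beta>\<in>signed_perms n. h \<beta> * Mpoly n \<beta>) = 0" and t: "t \<noteq> 0" and b: "\<beta> \<in> signed_perms n"
  shows "eval_at t id id (h \<beta>) = 0"
proof -
  let ?G = "signed_perms n"
  have ev: "eval_at t id \<gamma> (\<Sum>\<beta>\<in>?G. k \<beta> * Mpoly n \<beta>) = (\<Sum>\<beta>\<in>?G. eval_at t id \<gamma> (Mpoly n \<beta>) * eval_at t id id (k \<beta>))"
    if "\<gamma> \<in> ?G" "\<And>\<beta>. \<beta> \<in> ?G \<Longrightarrow> k \<beta> \<in> bi_invariants n" for \<gamma> k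
    unfolding eval_at_sum eval_at_mult
    by (intro sum.cong refl) (simp add: eval_at_bi_invariant[OF signed_perms_id that(1) that(2)])
  have "\<exists>k. \<forall>\<gamma>\<in>?G. (\<Sum>\<beta>\<in>?G. eval_at t id \<gamma> (Mpoly n \<beta>) * k \<beta>) = (if \<gamma> = \<gamma>' then 1 else 0)"
    if g': "\<gamma>' \<in> ?G" for \<gamma>'
  proof -
    obtain f where f: "f \<in> diag_invariants n"
      "\<And>\<gamma>. \<gamma> \<in> ?G \<Longrightarrow> eval_at t id \<gamma> f = (if \<gamma> = \<gamma>' then 1 else 0)"
      using interpolating_invariant[OF g' t] by metis
    obtain k where k: "\<And>\<beta>. \<beta> \<in> ?G \<Longrightarrow> k \<beta> \<in> bi_invariants n" "f = (\<Sum>\<beta>\<in>?G. k \<beta> * Mpoly n \<beta>)"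
      using diag_invariants_module_span[OF f(1)] by (rule module_spanE) blast
    have "(\<Sum>\<beta>\<in>?G. eval_at t id \<gamma> (Mpoly n \<beta>) * eval_at t id id (k \<beta>)) = (if \<gamma> = \<gamma>' then 1 else 0)"
      if "\<gamma> \<in> ?G" for \<gamma>
      using ev[OF that k(1)] f(2)[OF that] k(2) by simp
    then show ?thesis by (intro exI[of _ "\<lambda>\<beta>. eval_at t id id (k \<beta>)"] ballI)
  qed
  then have "\<forall>\<gamma>'\<in>?G. \<exists>k. \<forall>\<gamma>\<in>?G. (\<Sum>\<beta>\<in>?G. eval_at t id \<gamma> (Mpoly n \<beta>) * k \<beta>) = (if \<gamma> = \<gamma>' then 1 else 0)"
    by (rule ballI)
  from bchoice[OF this] obtain K where K: "\<And>\<gamma> \<gamma>'. \<gamma> \<in> ?G \<Longrightarrow> \<gamma>' \<in> ?G \<Longrightarrow>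
      (\<Sum>\<beta>\<in>?G. eval_at t id \<gamma> (Mpoly n \<beta>) * K \<gamma>' \<beta>) = (if \<gamma> = \<gamma>' then 1 else 0)"
    by blast
  show ?thesis
  proof (rule square_right_inverse_imp_kernel_zero[OF finite_signed_perms, where a = \<beta> and
        M = "\<lambda>\<gamma> \<beta>. eval_at t id \<gamma> (Mpoly n \<beta>)" and K = "\<lambda>\<beta> \<gamma>. K \<gamma> \<beta>" and
        d = "\<lambda>\<beta>. eval_at t id id (h \<beta>)"])
    show "(\<Sum>\<beta>\<in>?G. eval_at t id \<gamma> (Mpoly n \<beta>) * eval_at t id id (h \<beta>)) = 0" if "\<gamma> \<in> ?G" for \<gamma>
      using ev[OF that, of h] h by (simp add: z eval_at_zero)
  qed (use K b in auto)
qed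

text \<open>Restricting \<open>h\<close> to the line through the origin and \<open>(1, \<dots>, n, 1, \<dots>, n)\<close> gives a univariate
polynomial with infinitely many zeros.\<close>

lemma lookup_zero_of_eval:
  assumes "\<And>t. t \<noteq> 0 \<Longrightarrow> eval_at t id id h = 0"
  shows "lookup h 0 = 0"
proof -
  define q where "q = poly_val (\<lambda>c. [:c:]) (\<lambda>v. [:0, point 1 id id v:]) h"
  have q: "poly q t = poly_val (\<lambda>c. c) (\<lambda>v. t * point 1 id id v) h" for t
    by (simp add: q_def poly_val_def monom_val_def poly_sum poly_prod)
  have "poly q t = eval_at t id id h" for t
  proof -
    have "(\<lambda>v. t * point 1 id id v) = point t id id" by (auto simp: point_def split: var.split)
    then show ?thesis unfolding q eval_at_def by simp
  qed
  then have "- {0} \<subseteq> {t. poly q t = 0}" using assms by auto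
  moreover have "infinite (- {0 :: rat})" by (simp add: infinite_UNIV_char_0)
  ultimately have "infinite {t. poly q t = 0}" using infinite_super by blast
  then have "q = 0" using poly_roots_finite by blast
  then show ?thesis using q[of 0] by (simp add: lookup_zero_eq)
qed

lemma constant_terms_zero:
  assumes "\<And>\<beta>. \<beta> \<in> signed_perms n \<Longrightarrow> h \<beta> \<in> bi_invariants n"
    and "(\<Sum>\<beta>\<in>signed_perms n. h \<beta> * Mpoly n \<beta>) = 0" and "\<beta> \<in> signed_perms n"
  shows "lookup (h \<beta>) 0 = 0"
  using eval_coefficients_zero[OF assms(1,2) _ assms(3)] by (intro lookup_zero_of_eval) blast

section \<open>The ideal of the coinvariants\<close>

lemma xyring_simps [simp]:
  "mult (xyring n) = (*)" "one (xyring n) = 1" "zero (xyring n) = 0" "add (xyring n) = (+)"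
  by (simp_all add: xyring_def)

lemma xyring_cring: "cring (xyring n)"
proof (rule cringI)
  show "abelian_group (xyring n)"
  proof (rule abelian_groupI)
    show "\<exists>y\<in>xypolys n. y \<oplus>\<^bsub>xyring n\<^esub> x = \<zero>\<^bsub>xyring n\<^esub>" if "x \<in> xypolys n" for x
      using xypolys_uminus[OF that] by (intro bexI[of _ "- x"]) simp_all
  qed (simp_all add: xypolys_zero xypolys_add add.assoc add.commute)
  show "comm_monoid (xyring n)"
    by (rule comm_monoidI) (simp_all add: xypolys_one xypolys_mult mult.assoc mult.commute)
qed (simp add: distrib_right)

lemma xyring_ring: "ring (xyring n)"
  using xyring_cring by (rule cring.axioms(1))

lemma xyring_a_inv:
  assumes "x \<in> xypolys n"
  shows "\<ominus>\<^bsub>xyring n\<^esub> x = - x"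
proof -
  interpret ring "xyring n" by (rule xyring_ring)
  show ?thesis using assms xypolys_uminus[OF assms] by (intro minus_equality) simp_all
qed

lemma xyring_idealI:
  assumes J: "J \<subseteq> xypolys n" "0 \<in> J" "\<And>a b. a \<in> J \<Longrightarrow> b \<in> J \<Longrightarrow> a + b \<in> J"
    and m: "\<And>r a. r \<in> xypolys n \<Longrightarrow> a \<in> J \<Longrightarrow> r * a \<in> J"
  shows "ideal J (xyring n)"
proof (rule idealI[OF xyring_ring])
  interpret ring "xyring n" by (rule xyring_ring)
  have "- a \<in> J" if "a \<in> J" for a using m[OF xypolys_Const[of "- 1"] that] by (simp add: Const_minus)
  then show "subgroup J (add_monoid (xyring n))"
    using J by (intro add.subgroupI) (auto simp: xyring_a_inv subset_iff simp flip: a_inv_def)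
  show "x \<otimes>\<^bsub>xyring n\<^esub> a \<in> J" "a \<otimes>\<^bsub>xyring n\<^esub> x \<in> J" if "a \<in> J" "x \<in> xypolys n" for a x
    using m[OF that(2,1)] by (simp_all add: mult.commute)
qed

text \<open>The generators of the ideal.\<close>

definition pos_bi_invariants :: "nat \<Rightarrow> xypoly set" where
  "pos_bi_invariants n = {p \<in> bi_invariants n. lookup p 0 = 0}"

lemma coinv_ideal_eq: "coinv_ideal n = Idl\<^bsub>xyring n\<^esub> (pos_bi_invariants n)"
proof -
  have "{p \<in> xypolys n. (\<forall>\<beta>\<in>signed_perms n. \<forall>\<gamma>\<in>signed_perms n. act2 \<beta> \<gamma> p = p) \<and> lookup p 0 = 0}
      = pos_bi_invariants n"
    by (auto simp: pos_bi_invariants_def bi_invariants_def)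
  then show ?thesis by (simp only: coinv_ideal_def)
qed

lemma pos_bi_invariants_subset: "pos_bi_invariants n \<subseteq> xypolys n"
  by (auto simp: pos_bi_invariants_def bi_invariants_def)

lemma coinv_ideal_ideal: "ideal (coinv_ideal n) (xyring n)"
  unfolding coinv_ideal_eq by (rule ring.genideal_ideal[OF xyring_ring pos_bi_invariants_subset])

lemma pos_bi_invariants_coinv_ideal: "pos_bi_invariants n \<subseteq> coinv_ideal n"
  unfolding coinv_ideal_eq by (rule ring.genideal_self[OF xyring_ring pos_bi_invariants_subset])

lemma coinv_ideal_minimal:
  "ideal J (xyring n) \<Longrightarrow> pos_bi_invariants n \<subseteq> J \<Longrightarrow> coinv_ideal n \<subseteq> J"
  unfolding coinv_ideal_eq by (rule ring.genideal_minimal[OF xyring_ring])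

lemma coinv_ideal_subset: "coinv_ideal n \<subseteq> xypolys n"
  using ideal.Icarr[OF coinv_ideal_ideal] by blast

lemma coinv_ideal_zero: "0 \<in> coinv_ideal n"
  and coinv_ideal_add: "a \<in> coinv_ideal n \<Longrightarrow> b \<in> coinv_ideal n \<Longrightarrow> a + b \<in> coinv_ideal n"
  and coinv_ideal_mult: "a \<in> coinv_ideal n \<Longrightarrow> r \<in> xypolys n \<Longrightarrow> r * a \<in> coinv_ideal n"
proof -
  interpret ideal "coinv_ideal n" "xyring n" by (rule coinv_ideal_ideal)
  show "0 \<in> coinv_ideal n" using additive_subgroup.zero_closed[OF additive_subgroup_axioms] by simp
  show "a + b \<in> coinv_ideal n" if "a \<in> coinv_ideal n" "b \<in> coinv_ideal n"
    using additive_subgroup.a_closed[OF additive_subgroup_axioms that] by simp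
  show "r * a \<in> coinv_ideal n" if "a \<in> coinv_ideal n" "r \<in> xypolys n"
    using I_l_closed[OF that] by simp
qed

lemma coinv_ideal_uminus: "a \<in> coinv_ideal n \<Longrightarrow> - a \<in> coinv_ideal n"
  using coinv_ideal_mult[OF _ xypolys_Const[of "- 1"]] by (simp add: Const_minus)

lemma coinv_ideal_diff: "a \<in> coinv_ideal n \<Longrightarrow> b \<in> coinv_ideal n \<Longrightarrow> a - b \<in> coinv_ideal n"
  using coinv_ideal_add[OF _ coinv_ideal_uminus[of b n], of a] by simp

lemma coinv_ideal_sum: "(\<And>i. i \<in> I \<Longrightarrow> f i \<in> coinv_ideal n) \<Longrightarrow> sum f I \<in> coinv_ideal n"
  by (induction I rule: infinite_finite_induct) (auto intro: coinv_ideal_zero coinv_ideal_add)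

lemma Mpoly_diag_invariant:
  assumes b: "\<beta> \<in> signed_perms n"
  shows "Mpoly n \<beta> \<in> diag_invariants n"
proof -
  obtain c where "Mpoly n \<beta> = Const c * sym_monom n (gvec n \<beta>) (gvec_tilde n \<beta>)"
    unfolding Mpoly_def using orbit_sum_eq_sym_monom[OF parity_matched_gvec[OF b]] by blast
  then show ?thesis using sym_monom_in[of n "gvec n \<beta>" "gvec_tilde n \<beta>"]
    by (simp add: diag_invariants_def diag_act_def act2_mult act2_Const xypolys_mult xypolys_Const)
qed

lemma Mpoly_in: "\<beta> \<in> signed_perms n \<Longrightarrow> Mpoly n \<beta> \<in> xypolys n"
  using Mpoly_diag_invariant by (auto simp: diag_invariants_def)

text \<open>The polynomials \<open>f\<close> for which all \<open>symmetrize n (r * f)\<close> have such an expansion form an ideal.  It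
contains the generators \<open>g\<close>, because the symmetrization of \<open>r g\<close> is \<open>g\<close> times that of \<open>r\<close>, and
\<open>g\<close> has no constant term.  The multiplier \<open>r\<close> is what makes the set closed under multiplication.\<close>

lemma symmetrize_coinv_ideal:
  assumes "f \<in> coinv_ideal n"
  obtains h where "\<And>\<beta>. \<beta> \<in> signed_perms n \<Longrightarrow> h \<beta> \<in> pos_bi_invariants n"
    "symmetrize n f = (\<Sum>\<beta>\<in>signed_perms n. h \<beta> * Mpoly n \<beta>)"
proof -
  define P where "P g \<longleftrightarrow> (\<exists>h. (\<forall>\<beta>\<in>signed_perms n. h \<beta> \<in> pos_bi_invariants n) \<and>
     g = (\<Sum>\<beta>\<in>signed_perms n. h \<beta> * Mpoly n \<beta>))" for g
  define J where "J = {f \<in> xypolys n. \<forall>r\<in>xypolys n. P (symmetrize n (r * f))}"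
  have P_add: "P (f + g)" if PP: "P f" "P g" for f g
  proof -
    obtain h where h: "\<forall>\<beta>\<in>signed_perms n. h \<beta> \<in> pos_bi_invariants n" "f = (\<Sum>\<beta>\<in>signed_perms n. h \<beta> * Mpoly n \<beta>)"
      using PP(1)[unfolded P_def] by blast
    obtain k where k: "\<forall>\<beta>\<in>signed_perms n. k \<beta> \<in> pos_bi_invariants n" "g = (\<Sum>\<beta>\<in>signed_perms n. k \<beta> * Mpoly n \<beta>)"
      using PP(2)[unfolded P_def] by blast
    have "\<forall>\<beta>\<in>signed_perms n. h \<beta> + k \<beta> \<in> pos_bi_invariants n"
      using h(1) k(1) by (simp add: pos_bi_invariants_def bi_invariants_closed lookup_add)
    moreover have "f + g = (\<Sum>\<beta>\<in>signed_perms n. (h \<beta> + k \<beta>) * Mpoly n \<beta>)"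
      by (simp add: h(2) k(2) sum.distrib distrib_right)
    ultimately show ?thesis unfolding P_def by (intro exI[of _ "\<lambda>\<beta>. h \<beta> + k \<beta>"]) blast
  qed
  have "0 \<in> pos_bi_invariants n"
    using bi_invariants_closed(1)[of 0 n] by (simp add: pos_bi_invariants_def)
  then have P0: "P 0" unfolding P_def by (intro exI[of _ "\<lambda>_. 0"]) simp
  have "ideal J (xyring n)"
  proof (rule xyring_idealI)
    show "J \<subseteq> xypolys n" by (auto simp: J_def)
    have "symmetrize n 0 = 0" by (simp add: symmetrize_def diag_act_def act2_zero)
    then show "0 \<in> J" using P0 by (simp add: J_def xypolys_zero)
    show "a + b \<in> J" if "a \<in> J" "b \<in> J" for a b
      using that P_add by (simp add: J_def distrib_left symmetrize_add xypolys_add)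
    show "r * a \<in> J" if "r \<in> xypolys n" "a \<in> J" for r a
      using that unfolding J_def by (simp add: xypolys_mult flip: mult.assoc)
  qed
  moreover have "pos_bi_invariants n \<subseteq> J"
  proof
    fix g assume g: "g \<in> pos_bi_invariants n"
    then have gb: "g \<in> bi_invariants n" by (simp add: pos_bi_invariants_def)
    have "P (symmetrize n (r * g))" if r: "r \<in> xypolys n" for r
    proof -
      obtain k where k: "\<And>\<beta>. \<beta> \<in> signed_perms n \<Longrightarrow> k \<beta> \<in> bi_invariants n"
          "symmetrize n r = (\<Sum>\<beta>\<in>signed_perms n. k \<beta> * Mpoly n \<beta>)"
        using diag_invariants_module_span[OF symmetrize_in[OF r]] by (rule module_spanE) blast
      have "symmetrize n (r * g) = g * symmetrize n r"
        using symmetrize_mult[OF gb, of r] by (simp add: mult.commute)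
      also have "\<dots> = (\<Sum>\<beta>\<in>signed_perms n. (g * k \<beta>) * Mpoly n \<beta>)"
        by (simp add: k(2) sum_distrib_left mult.assoc)
      finally have "symmetrize n (r * g) = (\<Sum>\<beta>\<in>signed_perms n. (g * k \<beta>) * Mpoly n \<beta>)" .
      moreover have "\<forall>\<beta>\<in>signed_perms n. g * k \<beta> \<in> pos_bi_invariants n"
        using k(1) g by (simp add: pos_bi_invariants_def bi_invariants_closed lookup_mult_zero)
      ultimately show ?thesis unfolding P_def by (intro exI[of _ "\<lambda>\<beta>. g * k \<beta>"]) blast
    qed
    then show "g \<in> J" using g pos_bi_invariants_subset by (auto simp: J_def)
  qed
  ultimately have "f \<in> J" using coinv_ideal_minimal assms by blast
  then have "P (symmetrize n (1 * f))" unfolding J_def using xypolys_one by blast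
  then have "P (symmetrize n f)" by simp
  then show thesis unfolding P_def using that by blast
qed

lemma Mpoly_independent_mod_ideal:
  assumes c: "(\<Sum>\<beta>\<in>signed_perms n. Const (c \<beta>) * Mpoly n \<beta>) \<in> coinv_ideal n"
    and b: "\<beta> \<in> signed_perms n"
  shows "c \<beta> = 0"
proof -
  let ?G = "signed_perms n"
  let ?f = "\<Sum>\<beta>\<in>?G. Const (c \<beta>) * Mpoly n \<beta>"
  let ?N = "of_nat (card ?G) :: rat"
  obtain h where h: "\<And>\<beta>. \<beta> \<in> ?G \<Longrightarrow> h \<beta> \<in> pos_bi_invariants n"
    "symmetrize n ?f = (\<Sum>\<beta>\<in>?G. h \<beta> * Mpoly n \<beta>)"
    by (rule symmetrize_coinv_ideal[OF c]) blast
  have "symmetrize n ?f = (\<Sum>\<beta>\<in>?G. Const (c \<beta>) * (Const ?N * Mpoly n \<beta>))"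
    unfolding symmetrize_sum symmetrize_Const_mult
    by (intro sum.cong refl) (simp add: symmetrize_invariant[OF Mpoly_diag_invariant])
  then have "(\<Sum>\<beta>\<in>?G. (Const (c \<beta> * ?N) - h \<beta>) * Mpoly n \<beta>) = 0"
    using h(2) by (simp add: left_diff_distrib sum_subtractf Const_mult mult.assoc)
  moreover have "Const (c \<beta> * ?N) - h \<beta> \<in> bi_invariants n" if "\<beta> \<in> ?G" for \<beta>
    using h(1)[OF that] by (intro bi_invariants_closed) (simp add: pos_bi_invariants_def)
  ultimately have "lookup (Const (c \<beta> * ?N) - h \<beta>) 0 = 0"
    using constant_terms_zero[where h = "\<lambda>\<beta>. Const (c \<beta> * ?N) - h \<beta>", OF _ _ b] by blast
  then have "c \<beta> * ?N = 0"
    using h(1)[OF b] by (simp add: lookup_minus Const_def pos_bi_invariants_def)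
  then show ?thesis using card_signed_perms_pos[of n] by simp
qed

text \<open>Modulo the ideal, each coefficient in an expansion over the bi-invariants may be replaced by its
constant term.\<close>

lemma Mpoly_spans_mod_ideal:
  assumes "f \<in> diag_invariants n"
  obtains c where "f - (\<Sum>\<beta>\<in>signed_perms n. Const (c \<beta>) * Mpoly n \<beta>) \<in> coinv_ideal n"
proof -
  obtain h where h: "\<And>\<beta>. \<beta> \<in> signed_perms n \<Longrightarrow> h \<beta> \<in> bi_invariants n"
    "f = (\<Sum>\<beta>\<in>signed_perms n. h \<beta> * Mpoly n \<beta>)"
    using diag_invariants_module_span[OF assms] by (rule module_spanE) blast
  have "f - (\<Sum>\<beta>\<in>signed_perms n. Const (lookup (h \<beta>) 0) * Mpoly n \<beta>) =
      (\<Sum>\<beta>\<in>signed_perms n. Mpoly n \<beta> * (h \<beta> - Const (lookup (h \<beta>) 0)))"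
    by (simp add: h(2) right_diff_distrib sum_subtractf mult.commute)
  also have "\<dots> \<in> coinv_ideal n"
  proof (intro coinv_ideal_sum coinv_ideal_mult Mpoly_in)
    fix \<beta> assume "\<beta> \<in> signed_perms n"
    then have "h \<beta> - Const (lookup (h \<beta>) 0) \<in> bi_invariants n"
      by (intro bi_invariants_closed h(1))
    moreover have "lookup (h \<beta> - Const (lookup (h \<beta>) 0)) 0 = 0"
      by (simp add: lookup_minus Const_def)
    ultimately have "h \<beta> - Const (lookup (h \<beta>) 0) \<in> pos_bi_invariants n"
      unfolding pos_bi_invariants_def by blast
    then show "h \<beta> - Const (lookup (h \<beta>) 0) \<in> coinv_ideal n" using pos_bi_invariants_coinv_ideal by blast
  qed
  finally show thesis by (rule that)
qed

lemma diag_act_coinv_ideal: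
  assumes b: "\<beta> \<in> signed_perms n" and f: "f \<in> coinv_ideal n"
  shows "diag_act \<beta> f \<in> coinv_ideal n"
proof -
  let ?J = "{f \<in> xypolys n. diag_act \<beta> f \<in> coinv_ideal n}"
  have "ideal ?J (xyring n)"
  proof (rule xyring_idealI)
    show "0 \<in> ?J" by (simp add: xypolys_zero diag_act_def act2_zero coinv_ideal_zero)
    show "a + b \<in> ?J" if "a \<in> ?J" "b \<in> ?J" for a b
      using that by (simp add: diag_act_def act2_add xypolys_add coinv_ideal_add)
    show "r * a \<in> ?J" if "r \<in> xypolys n" "a \<in> ?J" for r a
      using that b by (simp add: diag_act_def act2_mult xypolys_mult coinv_ideal_mult act2_in)
  qed auto
  moreover have "pos_bi_invariants n \<subseteq> ?J"
  proof
    fix g assume g: "g \<in> pos_bi_invariants n"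
    then have "diag_act \<beta> g = g" using b by (simp add: pos_bi_invariants_def bi_invariants_def diag_act_def)
    then show "g \<in> ?J" using g pos_bi_invariants_subset pos_bi_invariants_coinv_ideal by auto
  qed
  ultimately show ?thesis using coinv_ideal_minimal f by blast
qed

section \<open>The trivial component\<close>

lemma coinv_class_eq: "coinv_class n p = (\<lambda>i. i + p) ` coinv_ideal n"
  unfolding coinv_class_def a_r_coset_def' by auto

lemma mem_coinv_class: "q \<in> coinv_class n p \<longleftrightarrow> q - p \<in> coinv_ideal n"
  unfolding coinv_class_eq by (auto intro: image_eqI[of _ _ "q - p"])

lemma coinv_class_eq_iff: "coinv_class n p = coinv_class n q \<longleftrightarrow> p - q \<in> coinv_ideal n"
proof
  assume "coinv_class n p = coinv_class n q"
  moreover have "p \<in> coinv_class n p" by (simp add: mem_coinv_class coinv_ideal_zero)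
  ultimately show "p - q \<in> coinv_ideal n" by (simp add: mem_coinv_class)
next
  assume pq: "p - q \<in> coinv_ideal n"
  have "r - p \<in> coinv_ideal n \<longleftrightarrow> r - q \<in> coinv_ideal n" for r
    using coinv_ideal_add[OF _ pq, of "r - p"] coinv_ideal_diff[OF _ pq, of "r - q"] by auto
  then show "coinv_class n p = coinv_class n q" by (auto simp: mem_coinv_class)
qed

lemma diag_act_inv:
  assumes "\<beta> \<in> signed_perms n" "p \<in> xypolys n"
  shows "diag_act \<beta> (diag_act (finv \<beta>) p) = p"
proof -
  have "\<beta> \<circ> finv \<beta> = id" using signed_perms_inv_apply[OF assms(1)] by auto
  then show ?thesis
    by (simp add: diag_act_def act2_act2[OF assms(1) assms(1)] act2_id[OF assms(2)])
qed

lemma diag_act_coinv_class: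
  assumes b: "\<beta> \<in> signed_perms n"
  shows "diag_act \<beta> ` coinv_class n p = coinv_class n (diag_act \<beta> p)"
proof
  have add: "diag_act \<beta> (f + g) = diag_act \<beta> f + diag_act \<beta> g" for f g
    by (simp add: diag_act_def act2_add)
  show "diag_act \<beta> ` coinv_class n p \<subseteq> coinv_class n (diag_act \<beta> p)"
    unfolding coinv_class_eq using diag_act_coinv_ideal[OF b] by (auto simp: add)
  show "coinv_class n (diag_act \<beta> p) \<subseteq> diag_act \<beta> ` coinv_class n p"
  proof
    fix q assume "q \<in> coinv_class n (diag_act \<beta> p)"
    then obtain i where i: "i \<in> coinv_ideal n" "q = i + diag_act \<beta> p" unfolding coinv_class_eq by blast
    have "q = diag_act \<beta> (diag_act (finv \<beta>) i + p)"
      using i(2) diag_act_inv[OF b subsetD[OF coinv_ideal_subset i(1)]] by (simp add: add)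
    moreover have "diag_act (finv \<beta>) i + p \<in> coinv_class n p"
      unfolding coinv_class_eq using diag_act_coinv_ideal[OF signed_perms_inv[OF b] i(1)] by blast
    ultimately show "q \<in> diag_act \<beta> ` coinv_class n p" by blast
  qed
qed

lemma trivial_component_simps:
  "zero (trivial_component n) = coinv_ideal n"
  "add (trivial_component n) = add (xyring n Quot coinv_ideal n)"
  "smult (trivial_component n) c A = coinv_class n (Const c) \<otimes>\<^bsub>xyring n Quot coinv_ideal n\<^esub> A"
  "carrier (trivial_component n) = {A \<in> coinv_class n ` xypolys n. \<forall>\<beta> \<in> signed_perms n. diag_act \<beta> ` A = A}"
  by (auto simp: trivial_component_def coinv_def ring.defs module.defs FactRing_def A_RCOSETS_def' coinv_class_def)

lemma coinv_class_zero: "coinv_class n 0 = coinv_ideal n"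
  by (simp add: coinv_class_eq)

lemma trivial_component_ops:
  assumes "p \<in> xypolys n"
  shows "q \<in> xypolys n \<Longrightarrow> coinv_class n p \<oplus>\<^bsub>trivial_component n\<^esub> coinv_class n q = coinv_class n (p + q)"
    and "c \<odot>\<^bsub>trivial_component n\<^esub> coinv_class n p = coinv_class n (Const c * p)"
proof -
  note hom = ideal.rcos_ring_hom[OF coinv_ideal_ideal[of n]]
  show "coinv_class n p \<oplus>\<^bsub>trivial_component n\<^esub> coinv_class n q = coinv_class n (p + q)" if "q \<in> xypolys n"
    using ring_hom_add[OF hom assms that] by (simp add: trivial_component_simps coinv_class_def)
  show "c \<odot>\<^bsub>trivial_component n\<^esub> coinv_class n p = coinv_class n (Const c * p)"
    using ring_hom_mult[OF hom xypolys_Const assms] by (simp add: trivial_component_simps coinv_class_def)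
qed

text \<open>An invariant class contains an invariant polynomial: if \<open>\<beta>p - p\<close> lies in the ideal for all \<open>\<beta>\<close>, then
\<open>p\<close> is congruent to its average over the group.\<close>

lemma carrier_trivial_component:
  "carrier (trivial_component n) = coinv_class n ` diag_invariants n"
proof
  show "coinv_class n ` diag_invariants n \<subseteq> carrier (trivial_component n)"
  proof
    fix A assume "A \<in> coinv_class n ` diag_invariants n"
    then obtain p where p: "p \<in> xypolys n" "\<forall>\<beta>\<in>signed_perms n. diag_act \<beta> p = p" "A = coinv_class n p"
      by (auto simp: diag_invariants_def)
    then have "\<forall>\<beta>\<in>signed_perms n. diag_act \<beta> ` A = A" by (simp add: diag_act_coinv_class)
    then show "A \<in> carrier (trivial_component n)" using p by (simp add: trivial_component_simps)
  qed
  show "carrier (trivial_component n) \<subseteq> coinv_class n ` diag_invariants n"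
  proof
    fix A assume "A \<in> carrier (trivial_component n)"
    then obtain p where p: "p \<in> xypolys n" "A = coinv_class n p"
      and inv: "\<And>\<beta>. \<beta> \<in> signed_perms n \<Longrightarrow> diag_act \<beta> ` coinv_class n p = coinv_class n p"
      by (auto simp: trivial_component_simps)
    let ?N = "of_nat (card (signed_perms n)) :: rat"
    define q where "q = Const (1 / ?N) * symmetrize n p"
    have d: "diag_act \<beta> p - p \<in> coinv_ideal n" if "\<beta> \<in> signed_perms n" for \<beta>
      using inv[OF that] by (simp add: diag_act_coinv_class[OF that] coinv_class_eq_iff)
    have "symmetrize n p - Const ?N * p = (\<Sum>\<beta>\<in>signed_perms n. diag_act \<beta> p - p)"
      by (simp add: symmetrize_def sum_subtractf Const_of_nat)
    also have "\<dots> \<in> coinv_ideal n" by (intro coinv_ideal_sum d)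
    finally have "Const (1 / ?N) * (symmetrize n p - Const ?N * p) \<in> coinv_ideal n"
      by (intro coinv_ideal_mult xypolys_Const)
    moreover have "Const (1 / ?N) * (symmetrize n p - Const ?N * p) = q - p"
      using card_signed_perms_pos[of n]
      by (simp add: q_def right_diff_distrib flip: mult.assoc Const_mult)
    ultimately have "A = coinv_class n q" using p(2) by (simp add: coinv_class_eq_iff[symmetric])
    moreover have "q \<in> diag_invariants n"
      using symmetrize_in[OF p(1)]
      by (simp add: q_def diag_invariants_def diag_act_def act2_mult act2_Const xypolys_mult xypolys_Const)
    ultimately show "A \<in> coinv_class n ` diag_invariants n" by blast
  qed
qed

lemma diag_invariants_closed:
  "p \<in> diag_invariants n \<Longrightarrow> q \<in> diag_invariants n \<Longrightarrow> p + q \<in> diag_invariants n"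
  "p \<in> diag_invariants n \<Longrightarrow> Const c * p \<in> diag_invariants n"
  "0 \<in> diag_invariants n"
  by (simp_all add: diag_invariants_def diag_act_def act2_add act2_mult act2_Const act2_zero
      xypolys_add xypolys_mult xypolys_Const xypolys_zero)

lemma diag_invariants_sum:
  "(\<And>i. i \<in> I \<Longrightarrow> f i \<in> diag_invariants n) \<Longrightarrow> sum f I \<in> diag_invariants n"
  by (induction I rule: infinite_finite_induct) (auto intro: diag_invariants_closed)

lemma diag_invariants_xypolys: "p \<in> diag_invariants n \<Longrightarrow> p \<in> xypolys n"
  by (simp add: diag_invariants_def)

lemma trivial_component_abelian_group: "abelian_group (trivial_component n)"
proof (rule abelian_groupI; unfold carrier_trivial_component)
  fix A B C assume "A \<in> coinv_class n ` diag_invariants n" "B \<in> coinv_class n ` diag_invariants n"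
    "C \<in> coinv_class n ` diag_invariants n"
  then obtain p q r where pqr: "p \<in> diag_invariants n" "q \<in> diag_invariants n" "r \<in> diag_invariants n"
    "A = coinv_class n p" "B = coinv_class n q" "C = coinv_class n r" by blast
  then show "A \<oplus>\<^bsub>trivial_component n\<^esub> B \<in> coinv_class n ` diag_invariants n"
    "A \<oplus>\<^bsub>trivial_component n\<^esub> B \<oplus>\<^bsub>trivial_component n\<^esub> C =
      A \<oplus>\<^bsub>trivial_component n\<^esub> (B \<oplus>\<^bsub>trivial_component n\<^esub> C)"
    "A \<oplus>\<^bsub>trivial_component n\<^esub> B = B \<oplus>\<^bsub>trivial_component n\<^esub> A"
    by (simp_all add: trivial_component_ops diag_invariants_xypolys diag_invariants_closed xypolys_add
        add_ac)
next
  show "\<zero>\<^bsub>trivial_component n\<^esub> \<in> coinv_class n ` diag_invariants n"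
    using diag_invariants_closed(3) by (auto simp: trivial_component_simps coinv_class_zero[symmetric])
  fix A assume "A \<in> coinv_class n ` diag_invariants n"
  then obtain p where p: "p \<in> diag_invariants n" "A = coinv_class n p" by blast
  then show "\<zero>\<^bsub>trivial_component n\<^esub> \<oplus>\<^bsub>trivial_component n\<^esub> A = A"
    unfolding trivial_component_simps(1) coinv_class_zero[symmetric]
    by (simp add: trivial_component_ops diag_invariants_xypolys xypolys_zero)
  have "Const (- 1) * p \<in> diag_invariants n" using p(1) by (rule diag_invariants_closed)
  moreover have "coinv_class n (Const (- 1) * p) \<oplus>\<^bsub>trivial_component n\<^esub> A = \<zero>\<^bsub>trivial_component n\<^esub>"
    unfolding trivial_component_simps(1) coinv_class_zero[symmetric] p(2)
    using p(1) by (simp add: trivial_component_ops diag_invariants_xypolys xypolys_uminus Const_minus)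
  ultimately show "\<exists>B\<in>coinv_class n ` diag_invariants n. B \<oplus>\<^bsub>trivial_component n\<^esub> A = \<zero>\<^bsub>trivial_component n\<^esub>"
    by blast
qed

lemma trivial_component_vectorspace: "vectorspace (class_ring :: rat ring) (trivial_component n)"
proof -
  have "module (class_ring :: rat ring) (trivial_component n)"
  proof (rule moduleI)
    show "cring (class_ring :: rat ring)" by (rule class_cring.cring_axioms)
    show "abelian_group (trivial_component n)" by (rule trivial_component_abelian_group)
    fix a b :: rat and A B
    assume "A \<in> carrier (trivial_component n)" "B \<in> carrier (trivial_component n)"
    then obtain p q where "p \<in> diag_invariants n" "q \<in> diag_invariants n"
      "A = coinv_class n p" "B = coinv_class n q" unfolding carrier_trivial_component by blast
    then show "a \<odot>\<^bsub>trivial_component n\<^esub> A \<in> carrier (trivial_component n)"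
      "(a \<oplus>\<^bsub>class_ring\<^esub> b) \<odot>\<^bsub>trivial_component n\<^esub> A =
        a \<odot>\<^bsub>trivial_component n\<^esub> A \<oplus>\<^bsub>trivial_component n\<^esub> b \<odot>\<^bsub>trivial_component n\<^esub> A"
      "a \<odot>\<^bsub>trivial_component n\<^esub> (A \<oplus>\<^bsub>trivial_component n\<^esub> B) =
        a \<odot>\<^bsub>trivial_component n\<^esub> A \<oplus>\<^bsub>trivial_component n\<^esub> a \<odot>\<^bsub>trivial_component n\<^esub> B"
      "(a \<otimes>\<^bsub>class_ring\<^esub> b) \<odot>\<^bsub>trivial_component n\<^esub> A =
        a \<odot>\<^bsub>trivial_component n\<^esub> (b \<odot>\<^bsub>trivial_component n\<^esub> A)"
      "\<one>\<^bsub>class_ring\<^esub> \<odot>\<^bsub>trivial_component n\<^esub> A = A"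
      by (simp_all add: carrier_trivial_component trivial_component_ops diag_invariants_xypolys
          diag_invariants_closed xypolys_add xypolys_mult xypolys_Const Const_add Const_mult
          distrib_left distrib_right mult.assoc)
  qed
  moreover have "field (class_ring :: rat ring)" by (rule class_field.field_axioms)
  ultimately show ?thesis by (rule vectorspace.intro)
qed

lemma finsum_coinv_class:
  assumes "finite B" "\<And>b. b \<in> B \<Longrightarrow> f b \<in> diag_invariants n"
  shows "finsum (trivial_component n) (\<lambda>b. coinv_class n (f b)) B = coinv_class n (sum f B)"
proof -
  interpret abelian_group "trivial_component n" by (rule trivial_component_abelian_group)
  show ?thesis
    using assms
  proof (induction B rule: finite_induct)
    case empty
    then show ?case by (simp add: coinv_class_zero trivial_component_simps)
  next
    case (insert b B)
    have "finsum (trivial_component n) (\<lambda>b. coinv_class n (f b)) (insert b B) =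
        coinv_class n (f b) \<oplus>\<^bsub>trivial_component n\<^esub> finsum (trivial_component n) (\<lambda>b. coinv_class n (f b)) B"
      using insert by (intro finsum_insert) (auto simp: carrier_trivial_component)
    also have "\<dots> = coinv_class n (f b + sum f B)"
      using insert by (simp add: trivial_component_ops diag_invariants_xypolys diag_invariants_sum)
    finally show ?case using insert by simp
  qed
qed

text \<open>Distinct signed permutations give distinct classes, so the set of classes may be indexed by the group
when linear combinations are formed.\<close>

lemma inj_on_Mpoly_class: "inj_on (\<lambda>\<beta>. coinv_class n (Mpoly n \<beta>)) (signed_perms n)"
proof (rule inj_onI, rule ccontr)
  fix \<beta> \<gamma> assume b: "\<beta> \<in> signed_perms n" "\<gamma> \<in> signed_perms n"
    and e: "coinv_class n (Mpoly n \<beta>) = coinv_class n (Mpoly n \<gamma>)" and ne: "\<beta> \<noteq> \<gamma>"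
  define c :: "_ \<Rightarrow> rat" where "c \<delta> = (if \<delta> = \<beta> then 1 else if \<delta> = \<gamma> then - 1 else 0)" for \<delta>
  have "(\<Sum>\<delta>\<in>signed_perms n. Const (c \<delta>) * Mpoly n \<delta>) = (\<Sum>\<delta>\<in>{\<beta>, \<gamma>}. Const (c \<delta>) * Mpoly n \<delta>)"
    using b finite_signed_perms by (intro sum.mono_neutral_right) (auto simp: c_def)
  also have "\<dots> = Mpoly n \<beta> - Mpoly n \<gamma>" using ne by (simp add: c_def Const_minus)
  also have "\<dots> \<in> coinv_ideal n" using e by (simp add: coinv_class_eq_iff)
  finally have "c \<beta> = 0" using Mpoly_independent_mod_ideal b(1) by blast
  then show False by (simp add: c_def)
qed

theorem proposition13p1:
  fixes n :: nat
  assumes "n \<ge> 1"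
  shows "vectorspace (class_ring :: rat ring) (trivial_component n) \<and>
    vectorspace.basis (class_ring :: rat ring) (trivial_component n)
      {coinv_class n (Mpoly n \<beta>) | \<beta>. \<beta> \<in> signed_perms n} \<and>
    (\<forall>A \<in> {coinv_class n (Mpoly n \<beta>) | \<beta>. \<beta> \<in> signed_perms n}.
      \<exists>d e. A \<in> coinv_bidegree n d e)"
proof (intro conjI)
  let ?V = "trivial_component n" and ?G = "signed_perms n"
  let ?m = "\<lambda>\<beta>. coinv_class n (Mpoly n \<beta>)"
  interpret V: vectorspace "class_ring :: rat ring" ?V by (rule trivial_component_vectorspace)
  show "vectorspace (class_ring :: rat ring) ?V" by (rule trivial_component_vectorspace)
  have set_eq: "{?m \<beta> | \<beta>. \<beta> \<in> ?G} = ?m ` ?G" by blast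
  have fin: "finite (?m ` ?G)" using finite_signed_perms by blast
  have sub: "?m ` ?G \<subseteq> carrier ?V"
    unfolding carrier_trivial_component using Mpoly_diag_invariant by blast
  have lincomb: "V.lincomb a (?m ` ?G) = coinv_class n (\<Sum>\<beta>\<in>?G. Const (a (?m \<beta>)) * Mpoly n \<beta>)" for a
  proof -
    have "V.lincomb a (?m ` ?G) = finsum ?V (\<lambda>\<beta>. a (?m \<beta>) \<odot>\<^bsub>?V\<^esub> ?m \<beta>) ?G"
      unfolding V.lincomb_def using sub
      by (intro V.finsum_reindex[OF _ inj_on_Mpoly_class]) (auto simp: subset_iff)
    also have "\<dots> = finsum ?V (\<lambda>\<beta>. coinv_class n (Const (a (?m \<beta>)) * Mpoly n \<beta>)) ?G"
      by (intro V.finsum_cong')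
        (auto simp: trivial_component_ops Mpoly_in carrier_trivial_component
          intro!: imageI diag_invariants_closed Mpoly_diag_invariant)
    also have "\<dots> = coinv_class n (\<Sum>\<beta>\<in>?G. Const (a (?m \<beta>)) * Mpoly n \<beta>)"
      by (intro finsum_coinv_class finite_signed_perms diag_invariants_closed Mpoly_diag_invariant)
    finally show ?thesis .
  qed
  have "V.lin_indpt (?m ` ?G)"
  proof (rule V.finite_lin_indpt2[OF fin sub], rule ballI)
    fix a v assume "V.lincomb a (?m ` ?G) = \<zero>\<^bsub>?V\<^esub>" and v: "v \<in> ?m ` ?G"
    then have "coinv_class n (\<Sum>\<beta>\<in>?G. Const (a (?m \<beta>)) * Mpoly n \<beta>) = coinv_class n 0"
      by (simp add: lincomb trivial_component_simps coinv_class_zero)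
    then have "(\<Sum>\<beta>\<in>?G. Const (a (?m \<beta>)) * Mpoly n \<beta>) \<in> coinv_ideal n"
      by (simp add: coinv_class_eq_iff)
    then have "a (?m \<beta>) = 0" if "\<beta> \<in> ?G" for \<beta>
      using Mpoly_independent_mod_ideal[where c = "\<lambda>\<beta>. a (?m \<beta>)"] that by blast
    then show "a v = \<zero>\<^bsub>class_ring\<^esub>" using v by auto
  qed
  moreover have "V.gen_set (?m ` ?G)"
  proof
    show "V.span (?m ` ?G) \<subseteq> carrier ?V" using V.span_closed[OF sub] by blast
    show "carrier ?V \<subseteq> V.span (?m ` ?G)"
    proof
      fix A assume "A \<in> carrier ?V"
      then obtain f where f: "f \<in> diag_invariants n" "A = coinv_class n f"
        unfolding carrier_trivial_component by blast
      obtain c where c: "f - (\<Sum>\<beta>\<in>?G. Const (c \<beta>) * Mpoly n \<beta>) \<in> coinv_ideal n"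
        using Mpoly_spans_mod_ideal[OF f(1)] by blast
      define a where "a v = c (the_inv_into ?G ?m v)" for v
      have "a (?m \<beta>) = c \<beta>" if "\<beta> \<in> ?G" for \<beta>
        unfolding a_def using the_inv_into_f_f[OF inj_on_Mpoly_class that] by simp
      then have "A = V.lincomb a (?m ` ?G)"
        unfolding lincomb f(2) coinv_class_eq_iff using c by simp
      then show "A \<in> V.span (?m ` ?G)"
        unfolding V.span_def using fin by auto
    qed
  qed
  ultimately show "vectorspace.basis (class_ring :: rat ring) ?V {?m \<beta> | \<beta>. \<beta> \<in> ?G}"
    unfolding V.basis_def set_eq using sub by blast
  show "\<forall>A \<in> {?m \<beta> | \<beta>. \<beta> \<in> ?G}. \<exists>d e. A \<in> coinv_bidegree n d e"
  proof
    fix A assume "A \<in> {?m \<beta> | \<beta>. \<beta> \<in> ?G}"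
    then obtain \<beta> where b: "\<beta> \<in> ?G" "A = ?m \<beta>" by blast
    have "bihomogeneous n (sum (gvec n \<beta>) {1..n}) (sum (gvec_tilde n \<beta>) {1..n}) (Mpoly n \<beta>)"
      unfolding Mpoly_def by (rule bihomogeneous_orbit_sum)
    then show "\<exists>d e. A \<in> coinv_bidegree n d e"
      unfolding coinv_bidegree_def b(2) using Mpoly_in[OF b(1)] by blast
  qed
qed

end
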